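(* For any integer $s>1$, let $G_s$ be the semi-direct product $C_{s^2-1}\rtimes_\xi C_2=\langle\sigma\rangle\rtimes_\xi\langle\tau\rangle$, where $C_{s^2-1}=\langle\sigma\rangle$ is cyclic of order $s^2-1$, $C_2=\langle\tau\rangle$ is cyclic of order $2$, and $\xi:C_2\to\mathrm{Aut}(C_{s^2-1})$ is given by $\xi(\tau)(\sigma)=\sigma^s$. Then for any field $k$ of characteristic $2$, the group algebra $kG_s$ has a separable deformation.
   Context: All algebras are associative and unital. $k[[t]]$ is the ring of formal power series over the field $k$ and $k((t))$ is its field of fractions. Separable algebra: a finite-dimensional algebra $A$ over a field $F$ is separable over $F$ if $\overline{F}\otimes_F A$ is a semi-simple algebra, where $\overline{F}$ is the algebraic closure of $F$. Deformation: let $A$ be an algebra over a field $k$. A $k((t))$-algebra $A_t$ is a deformation of $A$ if there exists a $k[[t]]$-algebra structure on the free $k[[t]]$-module $[A]_t:=k[[t]]\otimes_k A$ such that (1) $A_t\cong k((t))\otimes_{k[[t]]}[A]_t$ as $k((t))$-algebras, and (2) $A\cong [A]_t/t[A]_t$ as $k$-algebras. A deformation $A_t$ of $A$ is called a separable deformation of $A$ if $A_t$ is a separable algebra over $k((t))$. *)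

theory Defs
  imports "HOL-Algebra.Algebra" "HOL-Algebra.Algebraic_Closure_Type"
    "HOL-Computational_Algebra.Formal_Laurent_Series"
begin

section \<open>Associative unital algebras\<close>

text \<open>
  Scalars are the elements of a type of class \<^class>\<open>comm_ring_1\<close> (or \<^class>\<open>field\<close>), so that
  \<open>'k fps\<close> is \<open>k[[t]]\<close>, \<open>'k fls\<close> is its field of fractions \<open>k((t))\<close>, and \<open>'f alg_closure\<close> is the
  algebraic closure of \<open>'f\<close>.  Algebras are records of type \<open>('r, 'a) module\<close>.  The library locale
  \<^locale>\<open>algebra\<close> is not used because it requires the multiplication to be commutative.
\<close>

definition assoc_algebra :: "('r::comm_ring_1, 'a) module \<Rightarrow> bool" where
  "assoc_algebra A \<longleftrightarrow>
     module (ring_of_type_algebra :: 'r ring) A \<and> ring A \<and>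
     (\<forall>c. \<forall>x\<in>carrier A. \<forall>y\<in>carrier A.
        (c \<odot>\<^bsub>A\<^esub> x) \<otimes>\<^bsub>A\<^esub> y = c \<odot>\<^bsub>A\<^esub> (x \<otimes>\<^bsub>A\<^esub> y) \<and>
        x \<otimes>\<^bsub>A\<^esub> (c \<odot>\<^bsub>A\<^esub> y) = c \<odot>\<^bsub>A\<^esub> (x \<otimes>\<^bsub>A\<^esub> y))"

definition algebra_iso :: "('r, 'a) module \<Rightarrow> ('r, 'b) module \<Rightarrow> bool" where
  "algebra_iso A B \<longleftrightarrow>
     (\<exists>h \<in> ring_iso A B. \<forall>c. \<forall>x\<in>carrier A. h (c \<odot>\<^bsub>A\<^esub> x) = c \<odot>\<^bsub>B\<^esub> h x)"

definition finite_dimensional_algebra :: "('r, 'a) module \<Rightarrow> bool" where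
  "finite_dimensional_algebra A \<longleftrightarrow>
     (\<exists>S. finite S \<and> S \<subseteq> carrier A \<and>
        (\<forall>a\<in>carrier A. \<exists>c. a = (\<Oplus>\<^bsub>A\<^esub>x\<in>S. c x \<odot>\<^bsub>A\<^esub> x)))"

definition with_smult :: "('a, 'm) ring_scheme \<Rightarrow> ('r \<Rightarrow> 'a \<Rightarrow> 'a) \<Rightarrow> ('r, 'a) module" where
  "with_smult R f = \<lparr>carrier = carrier R, monoid.mult = monoid.mult R, monoid.one = \<one>\<^bsub>R\<^esub>,
     ring.zero = \<zero>\<^bsub>R\<^esub>, add = add R, module.smult = f\<rparr>"

definition restrict_scalars :: "('r \<Rightarrow> 's) \<Rightarrow> ('s, 'a) module \<Rightarrow> ('r, 'a) module" where
  "restrict_scalars \<phi> M = with_smult M (\<lambda>r. module.smult M (\<phi> r))"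

text \<open>For an ideal \<open>I\<close> that is also a submodule, \<open>c\<close> acts on the coset of \<open>x\<close> by giving the coset
  of \<open>c \<odot> x\<close>.\<close>

definition quotient_algebra :: "('r, 'a) module \<Rightarrow> 'a set \<Rightarrow> ('r, 'a set) module" where
  "quotient_algebra A I = with_smult (A Quot I) (\<lambda>c C. \<Union>x\<in>C. I +>\<^bsub>A\<^esub> (c \<odot>\<^bsub>A\<^esub> x))"


section \<open>Group algebras\<close>

definition group_algebra :: "('g, 'm) monoid_scheme \<Rightarrow> ('r::comm_ring_1, 'g \<Rightarrow>\<^sub>0 'r) module" where
  "group_algebra G =
     \<lparr>carrier = {f. Poly_Mapping.keys f \<subseteq> carrier G},
      monoid.mult = (\<lambda>f f'. \<Sum>g\<in>Poly_Mapping.keys f. \<Sum>g'\<in>Poly_Mapping.keys f'.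
         Poly_Mapping.single (g \<otimes>\<^bsub>G\<^esub> g') (Poly_Mapping.lookup f g * Poly_Mapping.lookup f' g')),
      monoid.one = Poly_Mapping.single \<one>\<^bsub>G\<^esub> 1,
      ring.zero = 0,
      add = (+),
      module.smult = (\<lambda>c. Poly_Mapping.map ((*) c))\<rparr>"


section \<open>Extension of scalars\<close>

text \<open>
  For a ring homomorphism \<open>\<phi> : R \<rightarrow> S\<close> of commutative rings and an \<open>R\<close>-module \<open>M\<close>, the \<open>S\<close>-module
  \<open>S \<otimes>\<^sub>R M\<close> is the free abelian group on \<open>S \<times> M\<close> modulo the subgroup generated by the relations of
  bilinearity and balancedness, with \<open>S\<close> acting on the left factor.  If \<open>M\<close> is an \<open>R\<close>-algebra, then
  the free abelian group is the integral monoid ring of the multiplicative monoid of \<open>S \<times> M\<close>, the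
  subgroup is an ideal of it, and the quotient ring multiplies by
  \<open>(s \<otimes> x) (s' \<otimes> x') = s s' \<otimes> x x'\<close>.  The carrier, addition, zero and scalar multiplication of
  the result do not depend on the multiplication of \<open>M\<close>.
\<close>

type_synonym ('s, 'a) tensor = "('s \<times> 'a \<Rightarrow>\<^sub>0 int) set"

definition free_tensor :: "('r, 'a) module \<Rightarrow> ('s::comm_ring_1, 's \<times> 'a \<Rightarrow>\<^sub>0 int) module" where
  "free_tensor M =
     with_smult (group_algebra ((ring_of_type_algebra :: 's ring) \<times>\<times> M) ::
         (int, 's \<times> 'a \<Rightarrow>\<^sub>0 int) module)
       (\<lambda>c. frag_extend (\<lambda>(s, x). frag_of (c * s, x)))"

definition tensor_relations ::
  "('r \<Rightarrow> 's::comm_ring_1) \<Rightarrow> ('r, 'a) module \<Rightarrow> ('s \<times> 'a \<Rightarrow>\<^sub>0 int) set" where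
  "tensor_relations \<phi> M =
     {frag_of (s + s', x) - frag_of (s, x) - frag_of (s', x) | s s' x. x \<in> carrier M} \<union>
     {frag_of (s, x \<oplus>\<^bsub>M\<^esub> x') - frag_of (s, x) - frag_of (s, x') | s x x'.
        x \<in> carrier M \<and> x' \<in> carrier M} \<union>
     {frag_of (s * \<phi> r, x) - frag_of (s, r \<odot>\<^bsub>M\<^esub> x) | s r x. x \<in> carrier M}"

definition extend_scalars ::
  "('r \<Rightarrow> 's::comm_ring_1) \<Rightarrow> ('r, 'a) module \<Rightarrow> ('s, ('s, 'a) tensor) module" where
  "extend_scalars \<phi> M =
     quotient_algebra (free_tensor M)
       (generate (add_monoid (free_tensor M :: ('s, _) module)) (tensor_relations \<phi> M))"


section \<open>Separable algebras\<close>

definition left_ideal :: "'a set \<Rightarrow> ('a, 'm) ring_scheme \<Rightarrow> bool" where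
  "left_ideal L R \<longleftrightarrow>
     additive_subgroup L R \<and> (\<forall>a\<in>carrier R. \<forall>x\<in>L. a \<otimes>\<^bsub>R\<^esub> x \<in> L)"

text \<open>A ring is semisimple if its left regular module is, that is, if every submodule of the left
  regular module is a direct summand.\<close>

definition semisimple_ring :: "('a, 'm) ring_scheme \<Rightarrow> bool" where
  "semisimple_ring R \<longleftrightarrow> ring R \<and>
     (\<forall>L. left_ideal L R \<longrightarrow>
        (\<exists>L'. left_ideal L' R \<and> L \<inter> L' = {\<zero>\<^bsub>R\<^esub>} \<and> L <+>\<^bsub>R\<^esub> L' = carrier R))"

definition separable_algebra :: "('f::field, 'a) module \<Rightarrow> bool" where
  "separable_algebra A \<longleftrightarrow>
     assoc_algebra A \<and> finite_dimensional_algebra A \<and>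
     semisimple_ring (extend_scalars (to_ac :: 'f \<Rightarrow> 'f alg_closure) A)"


section \<open>Deformations\<close>

text \<open>In the definition below, \<open>B\<close> is an algebra structure on the \<open>k[[t]]\<close>-module
  \<open>k[[t]] \<otimes>\<^sub>k A\<close>.\<close>

definition deformation :: "('k::field, 'a) module \<Rightarrow> ('k fls, 'b) module \<Rightarrow> bool" where
  "deformation A A\<^sub>t \<longleftrightarrow>
     assoc_algebra A \<and> assoc_algebra A\<^sub>t \<and>
     (\<exists>B :: ('k fps, ('k fps, 'a) tensor) module.
        assoc_algebra B \<and>
        carrier B = carrier (extend_scalars fps_const A) \<and>
        ring.zero B = ring.zero (extend_scalars fps_const A) \<and>
        add B = add (extend_scalars fps_const A) \<and>
        module.smult B = module.smult (extend_scalars fps_const A) \<and>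
        algebra_iso A\<^sub>t (extend_scalars fps_to_fls B) \<and>
        algebra_iso A
          (restrict_scalars fps_const
             (quotient_algebra B ((\<lambda>x. fps_X \<odot>\<^bsub>B\<^esub> x) ` carrier B))))"

text \<open>Being a separable deformation is invariant under isomorphism of \<open>k((t))\<close>-algebras, and by
  definition a deformation is isomorphic to an algebra whose elements have the type used here for
  those of \<open>A\<^sub>t\<close>.  Fixing this type is therefore no restriction.\<close>

definition has_separable_deformation :: "('k::field, 'a) module \<Rightarrow> bool" where
  "has_separable_deformation A \<longleftrightarrow>
     (\<exists>A\<^sub>t :: ('k fls, ('k fls, ('k fps, 'a) tensor) tensor) module.
        deformation A A\<^sub>t \<and> separable_algebra A\<^sub>t)"


section \<open>The groups\<close>

definition semidirect_product ::
  "('n, 'p) monoid_scheme \<Rightarrow> ('h, 'q) monoid_scheme \<Rightarrow> ('h \<Rightarrow> 'n \<Rightarrow> 'n) \<Rightarrow> ('n \<times> 'h) monoid" where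
  "semidirect_product N H \<xi> =
     \<lparr>carrier = carrier N \<times> carrier H,
      monoid.mult = (\<lambda>(n, h) (n', h'). (n \<otimes>\<^bsub>N\<^esub> \<xi> h n', h \<otimes>\<^bsub>H\<^esub> h')),
      monoid.one = (\<one>\<^bsub>N\<^esub>, \<one>\<^bsub>H\<^esub>)\<rparr>"

text \<open>The cyclic group of order \<open>n\<close> is \<^term>\<open>integer_mod_group n\<close>, with generator \<open>1\<close>; so
  \<open>\<sigma> = 1\<close> and \<open>\<tau> = 1\<close>.\<close>

definition \<xi>_action :: "nat \<Rightarrow> int \<Rightarrow> int \<Rightarrow> int" where
  "\<xi>_action s h = (\<lambda>x\<in>carrier (integer_mod_group (s^2 - 1)).
     x [^]\<^bsub>integer_mod_group (s^2 - 1)\<^esub> (s ^ nat h))"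

text \<open>The homomorphism with \<open>\<xi>(\<tau>)(\<sigma>) = \<sigma>\<^sup>s\<close>; it exists because \<open>s\<^sup>2\<close> is \<open>1\<close> modulo \<open>s\<^sup>2 - 1\<close>.\<close>

lemma \<xi>_action_generator:
  assumes "s > 1"
  shows "\<xi>_action s 1 1 = 1 [^]\<^bsub>integer_mod_group (s^2 - 1)\<^esub> s"
proof -
  have "1 < s\<^sup>2 - 1" using assms power_mono[of 2 s 2] by simp
  then have "1 \<in> carrier (integer_mod_group (s\<^sup>2 - 1))" unfolding carrier_integer_mod_group
    by (auto simp del: of_nat_diff)
  then show ?thesis by (simp add: \<xi>_action_def)
qed

lemma \<xi>_action_hom:
  assumes "s > 1"
  shows "\<xi>_action s \<in> hom (integer_mod_group 2) (AutoGroup (integer_mod_group (s^2 - 1)))"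
proof -
  define n where "n = s^2 - 1"
  define N where "N = integer_mod_group n"
  have n: "n > 1" unfolding n_def using assms power_mono[of 2 s 2] by simp
  have carN: "carrier N = {0..<int n}" using n by (simp add: N_def carrier_integer_mod_group)
  have ss: "int s * int s = int n + 1"
    using assms unfolding n_def by (simp add: of_nat_diff power2_eq_square)
  have red: "int s * (int s * x mod int n) mod int n = x" if "x \<in> carrier N" for x
  proof -
    have "int s * (int s * x mod int n) mod int n = (x + int n * x) mod int n"
      using ss by (simp add: mod_mult_right_eq mult.assoc[symmetric] distrib_right)
    then show ?thesis using that carN by simp
  qed
  have x0: "\<xi>_action s 0 = (\<lambda>x\<in>carrier N. x)"
    unfolding \<xi>_action_def n_def[symmetric] N_def[symmetric]
    by (rule restrict_ext) (use carN in \<open>simp add: N_def\<close>)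
  have x1: "\<xi>_action s 1 = (\<lambda>x\<in>carrier N. int s * x mod int n)"
    unfolding \<xi>_action_def n_def[symmetric] N_def[symmetric]
    by (rule restrict_ext) (simp add: N_def)
  have auto0: "\<xi>_action s 0 \<in> auto N"
    unfolding x0 by (rule group.id_in_auto) (simp add: N_def)
  have auto1: "\<xi>_action s 1 \<in> auto N"
  proof -
    have "bij_betw (\<xi>_action s 1) (carrier N) (carrier N)"
      by (rule bij_betw_byWitness[where f' = "\<xi>_action s 1"])
        (use n in \<open>auto simp: x1 red carN[symmetric]\<close>, (simp_all add: carN red)?)
    moreover have "\<xi>_action s 1 \<in> hom N N"
      by (rule homI) (use n in \<open>auto simp: x1 carrier_integer_mod_group N_def distrib_left mod_simps\<close>)
    ultimately show ?thesis by (simp add: auto_def Bij_def x1)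
  qed
  have comp: "compose (carrier N) (\<xi>_action s 1) (\<xi>_action s 1) = \<xi>_action s 0"
    unfolding compose_def x0
    by (rule restrict_ext) (use n in \<open>simp add: x1 red\<close>, simp add: carN red)
  have ext: "f \<in> extensional (carrier N)" if "f \<in> auto N" for f
    using that by (simp add: auto_def Bij_def)
  have m: "f \<otimes>\<^bsub>AutoGroup N\<^esub> g = compose (carrier N) f g" if "f \<in> auto N" "g \<in> auto N" for f g
    using that by (simp add: AutoGroup_def BijGroup_def auto_def)
  have c2: "carrier (integer_mod_group 2) = {0, 1}"
    by (auto simp: carrier_integer_mod_group)
  have c10: "compose (carrier N) (\<xi>_action s 1) (\<xi>_action s 0) = \<xi>_action s 1"
    unfolding compose_def by (auto simp: x0 x1)
  have c01: "compose (carrier N) (\<xi>_action s 0) (\<xi>_action s 1) = \<xi>_action s 1"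
    unfolding compose_def x0 by (use n in \<open>auto simp: x1 carN\<close>)
  have c00: "compose (carrier N) (\<xi>_action s 0) (\<xi>_action s 0) = \<xi>_action s 0"
    unfolding compose_def x0 by auto
  have "\<xi>_action s \<in> hom (integer_mod_group 2) (AutoGroup N)"
    by (rule homI) (auto simp: c2 m auto0 auto1 comp c10 c01 c00 AutoGroup_def[of N, THEN arg_cong[of _ _ carrier]])
  then show ?thesis by (simp add: N_def n_def)
qed

definition group_G :: "nat \<Rightarrow> (int \<times> int) monoid" where
  "group_G s = semidirect_product (integer_mod_group (s^2 - 1)) (integer_mod_group 2) (\<xi>_action s)"

end

theory Submission
  imports Defs "HOL-Library.Product_Plus"
begin

text \<open>
  Put \<open>n = s\<^sup>2 - 1\<close>.  The group algebra of \<open>G\<^sub>s\<close> is \<open>k[X]/(X\<^sup>n - 1)\<close> with an element \<open>y\<close> adjoined such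
  that \<open>y p(X) = p(X\<^sup>s) y\<close> and \<open>y\<^sup>2 = 1\<close>.  The polynomial \<open>X\<^sup>n - 1\<close> is \<open>((X\<^sup>s)\<^sup>s - X) / X\<close>, so the
  modulus records that \<open>X \<mapsto> X\<^sup>s\<close> is an involution, with the fixed point \<open>0\<close> taken out.  This suggests
  deforming the map rather than the modulus.  For a parameter \<open>u\<close> let \<open>f = X\<^sup>s + c\<close>, where
  \<open>c = u - u\<^sup>s\<close> is chosen to make \<open>u\<close> a fixed point of \<open>f\<close>, and let \<open>\<pi> = (f \<circ> f - X) / (X - u)\<close>, a
  monic polynomial of degree \<open>n\<close>.  Substitution of \<open>f\<close> is an involution \<open>\<eta>\<close> of \<open>R[X]/(\<pi>)\<close> over every
  integral domain \<open>R\<close>.  At a fixed point of \<open>f\<close>, an element \<open>y\<close> with \<open>y\<^sup>2 = 1\<close> would be inseparable in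
  characteristic two, and so one sets \<open>y\<^sup>2 = b y + 1\<close> with \<open>b = u h\<close>, where \<open>f \<circ> f - X = (f - X) h\<close>.
  Since \<open>\<eta>(p) - p\<close> is a multiple of \<open>f - X\<close>, the element \<open>b\<close> kills it, and this is what associativity
  requires.  The result is the algebra \<open>twisted_algebra s u\<close>, free of rank \<open>2 n\<close>; at \<open>u = 0\<close> it is
  the group algebra (\<open>group_algebra_twisted_algebra\<close>), and at \<open>u = t\<close> over \<open>k[[t]]\<close> it is the
  deformation (\<open>group_algebra_deformation\<close>).

  The family is compatible with every change of base (\<open>extend_scalars_twisted_algebra\<close>), and it
  remains to see that over the algebraic closure of \<open>k((t))\<close> it is semisimple at \<open>u = t\<close>
  (\<open>semisimple_twisted_algebra\<close>).  There the polynomial \<open>\<pi>\<close> is separable (\<open>modulus_separable\<close>): a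
  multiple root \<open>x\<close> would make \<open>x\<close> and \<open>x + c\<close> roots of unity, whereas \<open>c = t - t\<^sup>s\<close> is
  transcendental over \<open>k\<close>.  Also \<open>h\<close> does not vanish at a fixed point of \<open>f\<close>
  (\<open>cofactor_coprime\<close>).  Geometrically, an orbit \<open>{x, f(x)}\<close> of length two contributes a matrix algebra
  of size two, and a fixed point contributes the separable quadratic algebra \<open>y\<^sup>2 = b y + 1\<close>, \<open>b \<noteq> 0\<close>.
  The proof does not decompose the algebra into these blocks.  As in Maschke's theorem, it turns a
  linear projection onto a left ideal into a linear projection that commutes with \<open>X\<close>
  (\<open>polynomial_averaging\<close>) and then also with \<open>y\<close> (\<open>twisted_averaging\<close>); the coefficients of both
  averages come from Bezout identities for \<open>\<pi>, \<pi>'\<close> and for \<open>f - X, h\<close>.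
\<close>


section \<open>Associative algebras\<close>

lemma assoc_algebraI:
  fixes A :: "('r::comm_ring_1, 'a) module"
  assumes "\<And>x y. x \<in> carrier A \<Longrightarrow> y \<in> carrier A \<Longrightarrow> x \<oplus>\<^bsub>A\<^esub> y \<in> carrier A"
    and "\<And>x y. x \<in> carrier A \<Longrightarrow> y \<in> carrier A \<Longrightarrow> x \<otimes>\<^bsub>A\<^esub> y \<in> carrier A"
    and "\<And>c x. x \<in> carrier A \<Longrightarrow> c \<odot>\<^bsub>A\<^esub> x \<in> carrier A"
    and "\<zero>\<^bsub>A\<^esub> \<in> carrier A" and "\<one>\<^bsub>A\<^esub> \<in> carrier A"
    and "\<And>x y z. x \<in> carrier A \<Longrightarrow> y \<in> carrier A \<Longrightarrow> z \<in> carrier A \<Longrightarrow>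
      (x \<oplus>\<^bsub>A\<^esub> y) \<oplus>\<^bsub>A\<^esub> z = x \<oplus>\<^bsub>A\<^esub> (y \<oplus>\<^bsub>A\<^esub> z)"
    and "\<And>x y. x \<in> carrier A \<Longrightarrow> y \<in> carrier A \<Longrightarrow> x \<oplus>\<^bsub>A\<^esub> y = y \<oplus>\<^bsub>A\<^esub> x"
    and "\<And>x. x \<in> carrier A \<Longrightarrow> \<zero>\<^bsub>A\<^esub> \<oplus>\<^bsub>A\<^esub> x = x"
    and "\<And>x. x \<in> carrier A \<Longrightarrow> \<exists>y\<in>carrier A. y \<oplus>\<^bsub>A\<^esub> x = \<zero>\<^bsub>A\<^esub>"
    and "\<And>x y z. x \<in> carrier A \<Longrightarrow> y \<in> carrier A \<Longrightarrow> z \<in> carrier A \<Longrightarrow>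
      (x \<otimes>\<^bsub>A\<^esub> y) \<otimes>\<^bsub>A\<^esub> z = x \<otimes>\<^bsub>A\<^esub> (y \<otimes>\<^bsub>A\<^esub> z)"
    and "\<And>x. x \<in> carrier A \<Longrightarrow> \<one>\<^bsub>A\<^esub> \<otimes>\<^bsub>A\<^esub> x = x"
    and "\<And>x. x \<in> carrier A \<Longrightarrow> x \<otimes>\<^bsub>A\<^esub> \<one>\<^bsub>A\<^esub> = x"
    and "\<And>x y z. x \<in> carrier A \<Longrightarrow> y \<in> carrier A \<Longrightarrow> z \<in> carrier A \<Longrightarrow>
      (x \<oplus>\<^bsub>A\<^esub> y) \<otimes>\<^bsub>A\<^esub> z = x \<otimes>\<^bsub>A\<^esub> z \<oplus>\<^bsub>A\<^esub> y \<otimes>\<^bsub>A\<^esub> z"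
    and "\<And>x y z. x \<in> carrier A \<Longrightarrow> y \<in> carrier A \<Longrightarrow> z \<in> carrier A \<Longrightarrow>
      z \<otimes>\<^bsub>A\<^esub> (x \<oplus>\<^bsub>A\<^esub> y) = z \<otimes>\<^bsub>A\<^esub> x \<oplus>\<^bsub>A\<^esub> z \<otimes>\<^bsub>A\<^esub> y"
    and "\<And>c d x. x \<in> carrier A \<Longrightarrow> (c + d) \<odot>\<^bsub>A\<^esub> x = c \<odot>\<^bsub>A\<^esub> x \<oplus>\<^bsub>A\<^esub> d \<odot>\<^bsub>A\<^esub> x"
    and "\<And>c x y. x \<in> carrier A \<Longrightarrow> y \<in> carrier A \<Longrightarrow>
      c \<odot>\<^bsub>A\<^esub> (x \<oplus>\<^bsub>A\<^esub> y) = c \<odot>\<^bsub>A\<^esub> x \<oplus>\<^bsub>A\<^esub> c \<odot>\<^bsub>A\<^esub> y"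
    and "\<And>c d x. x \<in> carrier A \<Longrightarrow> (c * d) \<odot>\<^bsub>A\<^esub> x = c \<odot>\<^bsub>A\<^esub> (d \<odot>\<^bsub>A\<^esub> x)"
    and "\<And>x. x \<in> carrier A \<Longrightarrow> 1 \<odot>\<^bsub>A\<^esub> x = x"
    and "\<And>c x y. x \<in> carrier A \<Longrightarrow> y \<in> carrier A \<Longrightarrow>
      (c \<odot>\<^bsub>A\<^esub> x) \<otimes>\<^bsub>A\<^esub> y = c \<odot>\<^bsub>A\<^esub> (x \<otimes>\<^bsub>A\<^esub> y)"
    and "\<And>c x y. x \<in> carrier A \<Longrightarrow> y \<in> carrier A \<Longrightarrow>
      x \<otimes>\<^bsub>A\<^esub> (c \<odot>\<^bsub>A\<^esub> y) = c \<odot>\<^bsub>A\<^esub> (x \<otimes>\<^bsub>A\<^esub> y)"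
  shows "assoc_algebra A"
proof -
  have ag: "abelian_group A"
    by (rule abelian_groupI) (use assms in auto)
  have "ring A"
  proof (rule ringI[OF ag])
    show "monoid A" by (rule monoidI) (use assms in auto)
  qed (use assms in auto)
  moreover have "module (ring_of_type_algebra :: 'r ring) A"
    by (rule moduleI) (use assms ag cring_from_type_algebra in \<open>auto simp: ring_of_type_algebra_def\<close>)
  ultimately show ?thesis
    unfolding assoc_algebra_def using assms by auto
qed

lemma assoc_algebraD:
  fixes A :: "('r::comm_ring_1, 'a) module"
  assumes "assoc_algebra A"
  shows "ring A"
    and "\<And>c x. x \<in> carrier A \<Longrightarrow> c \<odot>\<^bsub>A\<^esub> x \<in> carrier A"
    and "\<And>c d x. x \<in> carrier A \<Longrightarrow> (c + d) \<odot>\<^bsub>A\<^esub> x = c \<odot>\<^bsub>A\<^esub> x \<oplus>\<^bsub>A\<^esub> d \<odot>\<^bsub>A\<^esub> x"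
    and "\<And>c x y. x \<in> carrier A \<Longrightarrow> y \<in> carrier A \<Longrightarrow>
      c \<odot>\<^bsub>A\<^esub> (x \<oplus>\<^bsub>A\<^esub> y) = c \<odot>\<^bsub>A\<^esub> x \<oplus>\<^bsub>A\<^esub> c \<odot>\<^bsub>A\<^esub> y"
    and "\<And>c d x. x \<in> carrier A \<Longrightarrow> (c * d) \<odot>\<^bsub>A\<^esub> x = c \<odot>\<^bsub>A\<^esub> (d \<odot>\<^bsub>A\<^esub> x)"
    and "\<And>x. x \<in> carrier A \<Longrightarrow> 1 \<odot>\<^bsub>A\<^esub> x = x"
    and "\<And>c x y. x \<in> carrier A \<Longrightarrow> y \<in> carrier A \<Longrightarrow>
      (c \<odot>\<^bsub>A\<^esub> x) \<otimes>\<^bsub>A\<^esub> y = c \<odot>\<^bsub>A\<^esub> (x \<otimes>\<^bsub>A\<^esub> y)"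
    and "\<And>c x y. x \<in> carrier A \<Longrightarrow> y \<in> carrier A \<Longrightarrow>
      x \<otimes>\<^bsub>A\<^esub> (c \<odot>\<^bsub>A\<^esub> y) = c \<odot>\<^bsub>A\<^esub> (x \<otimes>\<^bsub>A\<^esub> y)"
proof -
  interpret M: module "ring_of_type_algebra :: 'r ring" A
    using assms by (simp add: assoc_algebra_def)
  note [simp] = ring_of_type_algebra_def
  show "ring A" using assms by (simp add: assoc_algebra_def)
  show "c \<odot>\<^bsub>A\<^esub> x \<in> carrier A" if "x \<in> carrier A" for c x
    using M.smult_closed[of c x] that by simp
  show "(c + d) \<odot>\<^bsub>A\<^esub> x = c \<odot>\<^bsub>A\<^esub> x \<oplus>\<^bsub>A\<^esub> d \<odot>\<^bsub>A\<^esub> x" if "x \<in> carrier A" for c d x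
    using M.smult_l_distr[of c d x] that by simp
  show "c \<odot>\<^bsub>A\<^esub> (x \<oplus>\<^bsub>A\<^esub> y) = c \<odot>\<^bsub>A\<^esub> x \<oplus>\<^bsub>A\<^esub> c \<odot>\<^bsub>A\<^esub> y"
    if "x \<in> carrier A" "y \<in> carrier A" for c x y
    using M.smult_r_distr[of c x y] that by simp
  show "(c * d) \<odot>\<^bsub>A\<^esub> x = c \<odot>\<^bsub>A\<^esub> (d \<odot>\<^bsub>A\<^esub> x)" if "x \<in> carrier A" for c d x
    using M.smult_assoc1[of c d x] that by simp
  show "1 \<odot>\<^bsub>A\<^esub> x = x" if "x \<in> carrier A" for x
    using M.smult_one[of x] that by simp
qed (use assms in \<open>auto simp: assoc_algebra_def\<close>)

lemma algebra_isoE: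
  assumes "algebra_iso A B"
  obtains h where "bij_betw h (carrier A) (carrier B)" 
    and "\<And>x y. x \<in> carrier A \<Longrightarrow> y \<in> carrier A \<Longrightarrow> h (x \<otimes>\<^bsub>A\<^esub> y) = h x \<otimes>\<^bsub>B\<^esub> h y"
    and "\<And>x y. x \<in> carrier A \<Longrightarrow> y \<in> carrier A \<Longrightarrow> h (x \<oplus>\<^bsub>A\<^esub> y) = h x \<oplus>\<^bsub>B\<^esub> h y"
    and "h \<one>\<^bsub>A\<^esub> = \<one>\<^bsub>B\<^esub>"
    and "\<And>c x. x \<in> carrier A \<Longrightarrow> h (c \<odot>\<^bsub>A\<^esub> x) = c \<odot>\<^bsub>B\<^esub> h x"
  using assms unfolding algebra_iso_def ring_iso_def ring_hom_def by blast

lemma algebra_isoI: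
  assumes "bij_betw h (carrier A) (carrier B)" 
    and "\<And>x y. x \<in> carrier A \<Longrightarrow> y \<in> carrier A \<Longrightarrow> h (x \<otimes>\<^bsub>A\<^esub> y) = h x \<otimes>\<^bsub>B\<^esub> h y"
    and "\<And>x y. x \<in> carrier A \<Longrightarrow> y \<in> carrier A \<Longrightarrow> h (x \<oplus>\<^bsub>A\<^esub> y) = h x \<oplus>\<^bsub>B\<^esub> h y"
    and "h \<one>\<^bsub>A\<^esub> = \<one>\<^bsub>B\<^esub>"
    and "\<And>c x. x \<in> carrier A \<Longrightarrow> h (c \<odot>\<^bsub>A\<^esub> x) = c \<odot>\<^bsub>B\<^esub> h x"
  shows "algebra_iso A B"
proof -
  have "h \<in> ring_iso A B"
    using assms(1-4) bij_betwE[OF assms(1)] by (auto simp: ring_iso_def ring_hom_def)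
  then show ?thesis
    unfolding algebra_iso_def using assms(5) by blast
qed

lemma algebra_iso_refl: "algebra_iso A A"
  by (rule algebra_isoI[of id]) auto

lemma algebra_iso_sym:
  assumes A: "assoc_algebra A" and iso: "algebra_iso A B"
  shows "algebra_iso B A"
proof -
  obtain h where h: "bij_betw h (carrier A) (carrier B)" 
    "\<And>x y. x \<in> carrier A \<Longrightarrow> y \<in> carrier A \<Longrightarrow> h (x \<otimes>\<^bsub>A\<^esub> y) = h x \<otimes>\<^bsub>B\<^esub> h y"
    "\<And>x y. x \<in> carrier A \<Longrightarrow> y \<in> carrier A \<Longrightarrow> h (x \<oplus>\<^bsub>A\<^esub> y) = h x \<oplus>\<^bsub>B\<^esub> h y"
    "h \<one>\<^bsub>A\<^esub> = \<one>\<^bsub>B\<^esub>"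
    "\<And>c x. x \<in> carrier A \<Longrightarrow> h (c \<odot>\<^bsub>A\<^esub> x) = c \<odot>\<^bsub>B\<^esub> h x"
    using iso by (rule algebra_isoE) blast
  interpret ring A using assoc_algebraD(1)[OF A] .
  define g where "g = inv_into (carrier A) h"
  have g: "bij_betw g (carrier B) (carrier A)"
    unfolding g_def by (rule bij_betw_inv_into[OF h(1)])
  have gc: "g y \<in> carrier A" and hg: "h (g y) = y" if "y \<in> carrier B" for y
    using bij_betwE[OF g] that bij_betw_inv_into_right[OF h(1)] by (auto simp: g_def)
  have eqI: "g y = x" if "y = h x" "x \<in> carrier A" for x y
    using bij_betw_inv_into_left[OF h(1)] that by (simp add: g_def)
  show ?thesis
  proof (rule algebra_isoI[OF g])
    fix x y assume xy: "x \<in> carrier B" "y \<in> carrier B"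
    show "g (x \<otimes>\<^bsub>B\<^esub> y) = g x \<otimes>\<^bsub>A\<^esub> g y"
      by (rule eqI) (use xy gc hg h in auto)
    show "g (x \<oplus>\<^bsub>B\<^esub> y) = g x \<oplus>\<^bsub>A\<^esub> g y"
      by (rule eqI) (use xy gc hg h in auto)
  next
    show "g \<one>\<^bsub>B\<^esub> = \<one>\<^bsub>A\<^esub>" by (rule eqI) (use h in auto)
    fix c x assume x: "x \<in> carrier B"
    show "g (c \<odot>\<^bsub>B\<^esub> x) = c \<odot>\<^bsub>A\<^esub> g x"
      by (rule eqI) (use x gc hg h assoc_algebraD(2)[OF A] in auto)
  qed
qed

lemma algebra_iso_trans:
  assumes "algebra_iso A B" "algebra_iso B C"
  shows "algebra_iso A C"
proof -
  obtain h where h: "bij_betw h (carrier A) (carrier B)" 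
    "\<And>x y. x \<in> carrier A \<Longrightarrow> y \<in> carrier A \<Longrightarrow> h (x \<otimes>\<^bsub>A\<^esub> y) = h x \<otimes>\<^bsub>B\<^esub> h y"
    "\<And>x y. x \<in> carrier A \<Longrightarrow> y \<in> carrier A \<Longrightarrow> h (x \<oplus>\<^bsub>A\<^esub> y) = h x \<oplus>\<^bsub>B\<^esub> h y"
    "h \<one>\<^bsub>A\<^esub> = \<one>\<^bsub>B\<^esub>"
    "\<And>c x. x \<in> carrier A \<Longrightarrow> h (c \<odot>\<^bsub>A\<^esub> x) = c \<odot>\<^bsub>B\<^esub> h x"
    using assms(1) by (rule algebra_isoE) blast
  obtain g where g: "bij_betw g (carrier B) (carrier C)" 
    "\<And>x y. x \<in> carrier B \<Longrightarrow> y \<in> carrier B \<Longrightarrow> g (x \<otimes>\<^bsub>B\<^esub> y) = g x \<otimes>\<^bsub>C\<^esub> g y"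
    "\<And>x y. x \<in> carrier B \<Longrightarrow> y \<in> carrier B \<Longrightarrow> g (x \<oplus>\<^bsub>B\<^esub> y) = g x \<oplus>\<^bsub>C\<^esub> g y"
    "g \<one>\<^bsub>B\<^esub> = \<one>\<^bsub>C\<^esub>"
    "\<And>c x. x \<in> carrier B \<Longrightarrow> g (c \<odot>\<^bsub>B\<^esub> x) = c \<odot>\<^bsub>C\<^esub> g x"
    using assms(2) by (rule algebra_isoE) blast
  have hc: "h x \<in> carrier B" if "x \<in> carrier A" for x
    using h(1) that by (rule bij_betw_apply)
  show ?thesis
    by (rule algebra_isoI[of "g \<circ> h"]) (use bij_betw_trans[OF h(1) g(1)] h g hc in auto)
qed

text \<open>An isomorphism onto an algebra carries the axioms back to its source, for which closure under
  the operations is then the only thing to be checked.\<close>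

lemma assoc_algebra_transfer:
  fixes A :: "('r::comm_ring_1, 'a) module" and B :: "('r, 'b) module"
  assumes B: "assoc_algebra B" and h: "bij_betw h (carrier A) (carrier B)" 
    and hm: "\<And>x y. x \<in> carrier A \<Longrightarrow> y \<in> carrier A \<Longrightarrow> h (x \<otimes>\<^bsub>A\<^esub> y) = h x \<otimes>\<^bsub>B\<^esub> h y"
    and ha: "\<And>x y. x \<in> carrier A \<Longrightarrow> y \<in> carrier A \<Longrightarrow> h (x \<oplus>\<^bsub>A\<^esub> y) = h x \<oplus>\<^bsub>B\<^esub> h y"
    and h1: "h \<one>\<^bsub>A\<^esub> = \<one>\<^bsub>B\<^esub>" and h0: "h \<zero>\<^bsub>A\<^esub> = \<zero>\<^bsub>B\<^esub>"
    and hs: "\<And>c x. x \<in> carrier A \<Longrightarrow> h (c \<odot>\<^bsub>A\<^esub> x) = c \<odot>\<^bsub>B\<^esub> h x"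
    and cm: "\<And>x y. x \<in> carrier A \<Longrightarrow> y \<in> carrier A \<Longrightarrow> x \<otimes>\<^bsub>A\<^esub> y \<in> carrier A"
    and ca: "\<And>x y. x \<in> carrier A \<Longrightarrow> y \<in> carrier A \<Longrightarrow> x \<oplus>\<^bsub>A\<^esub> y \<in> carrier A"
    and cs: "\<And>c x. x \<in> carrier A \<Longrightarrow> c \<odot>\<^bsub>A\<^esub> x \<in> carrier A"
    and c1: "\<one>\<^bsub>A\<^esub> \<in> carrier A" and c0: "\<zero>\<^bsub>A\<^esub> \<in> carrier A"
  shows "assoc_algebra A"
proof -
  interpret R: ring B using assoc_algebraD(1)[OF B] .
  note BD = assoc_algebraD(2-)[OF B]
  have hc: "h x \<in> carrier B" if "x \<in> carrier A" for x
    using h that by (rule bij_betw_apply)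
  have inj: "x = y" if "h x = h y" "x \<in> carrier A" "y \<in> carrier A" for x y
    using h that by (auto simp: bij_betw_def inj_on_def)
  note S = hm ha h1 h0 hs cm ca cs c1 c0 hc BD
  show ?thesis
  proof (rule assoc_algebraI)
    fix x assume x: "x \<in> carrier A"
    obtain y where y: "y \<in> carrier A" "h y = \<ominus>\<^bsub>B\<^esub> h x"
      using h hc[OF x] R.a_inv_closed unfolding bij_betw_def image_iff by (metis imageE)
    have "y \<oplus>\<^bsub>A\<^esub> x = \<zero>\<^bsub>A\<^esub>"
      by (rule inj) (use x y in \<open>simp_all add: S R.l_neg\<close>)
    then show "\<exists>y\<in>carrier A. y \<oplus>\<^bsub>A\<^esub> x = \<zero>\<^bsub>A\<^esub>" using y by blast
  next
    fix x y z assume xyz: "x \<in> carrier A" "y \<in> carrier A" "z \<in> carrier A"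
    show "(x \<oplus>\<^bsub>A\<^esub> y) \<oplus>\<^bsub>A\<^esub> z = x \<oplus>\<^bsub>A\<^esub> (y \<oplus>\<^bsub>A\<^esub> z)"
      by (rule inj) (simp_all add: S xyz R.a_assoc)
    show "(x \<otimes>\<^bsub>A\<^esub> y) \<otimes>\<^bsub>A\<^esub> z = x \<otimes>\<^bsub>A\<^esub> (y \<otimes>\<^bsub>A\<^esub> z)"
      by (rule inj) (simp_all add: S xyz R.m_assoc)
    show "(x \<oplus>\<^bsub>A\<^esub> y) \<otimes>\<^bsub>A\<^esub> z = x \<otimes>\<^bsub>A\<^esub> z \<oplus>\<^bsub>A\<^esub> y \<otimes>\<^bsub>A\<^esub> z"
      by (rule inj) (simp_all add: S xyz R.l_distr)
    show "z \<otimes>\<^bsub>A\<^esub> (x \<oplus>\<^bsub>A\<^esub> y) = z \<otimes>\<^bsub>A\<^esub> x \<oplus>\<^bsub>A\<^esub> z \<otimes>\<^bsub>A\<^esub> y"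
      by (rule inj) (simp_all add: S xyz R.r_distr)
  next
    fix x y assume xy: "x \<in> carrier A" "y \<in> carrier A"
    show "x \<oplus>\<^bsub>A\<^esub> y = y \<oplus>\<^bsub>A\<^esub> x"
      by (rule inj) (simp_all add: S xy R.a_comm)
    fix c
    show "c \<odot>\<^bsub>A\<^esub> (x \<oplus>\<^bsub>A\<^esub> y) = c \<odot>\<^bsub>A\<^esub> x \<oplus>\<^bsub>A\<^esub> c \<odot>\<^bsub>A\<^esub> y"
      by (rule inj) (simp_all add: S xy)
    show "(c \<odot>\<^bsub>A\<^esub> x) \<otimes>\<^bsub>A\<^esub> y = c \<odot>\<^bsub>A\<^esub> (x \<otimes>\<^bsub>A\<^esub> y)"
      by (rule inj) (simp_all add: S xy)
    show "x \<otimes>\<^bsub>A\<^esub> (c \<odot>\<^bsub>A\<^esub> y) = c \<odot>\<^bsub>A\<^esub> (x \<otimes>\<^bsub>A\<^esub> y)"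
      by (rule inj) (simp_all add: S xy)
  next
    fix x assume x: "x \<in> carrier A"
    show "\<zero>\<^bsub>A\<^esub> \<oplus>\<^bsub>A\<^esub> x = x" by (rule inj) (simp_all add: S x)
    show "\<one>\<^bsub>A\<^esub> \<otimes>\<^bsub>A\<^esub> x = x" by (rule inj) (simp_all add: S x)
    show "x \<otimes>\<^bsub>A\<^esub> \<one>\<^bsub>A\<^esub> = x" by (rule inj) (simp_all add: S x)
    show "1 \<odot>\<^bsub>A\<^esub> x = x" by (rule inj) (simp_all add: S x)
    fix c d
    show "(c + d) \<odot>\<^bsub>A\<^esub> x = c \<odot>\<^bsub>A\<^esub> x \<oplus>\<^bsub>A\<^esub> d \<odot>\<^bsub>A\<^esub> x" by (rule inj) (simp_all add: S x)
    show "(c * d) \<odot>\<^bsub>A\<^esub> x = c \<odot>\<^bsub>A\<^esub> (d \<odot>\<^bsub>A\<^esub> x)" by (rule inj) (simp_all add: S x)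
  qed (simp_all add: S)
qed


section \<open>Semisimple rings\<close>

lemma left_ideal_iff:
  assumes "ring R"
  shows "left_ideal L R \<longleftrightarrow> L \<subseteq> carrier R \<and> \<zero>\<^bsub>R\<^esub> \<in> L \<and> (\<forall>x\<in>L. \<forall>y\<in>L. x \<oplus>\<^bsub>R\<^esub> y \<in> L) \<and>
     (\<forall>a\<in>carrier R. \<forall>x\<in>L. a \<otimes>\<^bsub>R\<^esub> x \<in> L)"
proof
  interpret ring R by fact
  show "left_ideal L R \<Longrightarrow> L \<subseteq> carrier R \<and> \<zero>\<^bsub>R\<^esub> \<in> L \<and> (\<forall>x\<in>L. \<forall>y\<in>L. x \<oplus>\<^bsub>R\<^esub> y \<in> L) \<and>
     (\<forall>a\<in>carrier R. \<forall>x\<in>L. a \<otimes>\<^bsub>R\<^esub> x \<in> L)"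
    unfolding left_ideal_def
    by (auto dest: additive_subgroup.a_Hcarr additive_subgroup.zero_closed additive_subgroup.a_closed)
  assume L: "L \<subseteq> carrier R \<and> \<zero>\<^bsub>R\<^esub> \<in> L \<and> (\<forall>x\<in>L. \<forall>y\<in>L. x \<oplus>\<^bsub>R\<^esub> y \<in> L) \<and>
     (\<forall>a\<in>carrier R. \<forall>x\<in>L. a \<otimes>\<^bsub>R\<^esub> x \<in> L)"
  have neg: "\<ominus>\<^bsub>R\<^esub> x \<in> L" if "x \<in> L" for x
  proof -
    have "\<ominus>\<^bsub>R\<^esub> x = (\<ominus>\<^bsub>R\<^esub> \<one>\<^bsub>R\<^esub>) \<otimes>\<^bsub>R\<^esub> x" using that L by (auto simp: l_minus)
    then show ?thesis using L that by simp
  qed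
  have "subgroup L (add_monoid R)"
    by (rule add.subgroupI) (use L neg in \<open>auto simp: a_inv_def\<close>)
  then show "left_ideal L R"
    unfolding left_ideal_def using L by (auto intro: additive_subgroupI)
qed

lemma semisimple_ring_transfer:
  assumes A: "assoc_algebra A" and B: "semisimple_ring B" and iso: "algebra_iso A B"
  shows "semisimple_ring A"
proof -
  obtain h where h: "bij_betw h (carrier A) (carrier B)" 
    "\<And>x y. x \<in> carrier A \<Longrightarrow> y \<in> carrier A \<Longrightarrow> h (x \<otimes>\<^bsub>A\<^esub> y) = h x \<otimes>\<^bsub>B\<^esub> h y"
    "\<And>x y. x \<in> carrier A \<Longrightarrow> y \<in> carrier A \<Longrightarrow> h (x \<oplus>\<^bsub>A\<^esub> y) = h x \<oplus>\<^bsub>B\<^esub> h y"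
    using iso by (rule algebra_isoE) blast
  interpret A: ring A using assoc_algebraD(1)[OF A] .
  interpret B: ring B using B by (simp add: semisimple_ring_def)
  have hc: "h x \<in> carrier B" if "x \<in> carrier A" for x
    using h(1) that by (rule bij_betw_apply)
  have inj: "x = y" if "h x = h y" "x \<in> carrier A" "y \<in> carrier A" for x y
    using h(1) that by (auto simp: bij_betw_def inj_on_def)
  have surj: "\<exists>x\<in>carrier A. y = h x" if "y \<in> carrier B" for y
    using h(1) that by (auto simp: bij_betw_def)
  have h0: "h \<zero>\<^bsub>A\<^esub> = \<zero>\<^bsub>B\<^esub>"
    using h(3)[of "\<zero>\<^bsub>A\<^esub>" "\<zero>\<^bsub>A\<^esub>"] hc[of "\<zero>\<^bsub>A\<^esub>"] B.add.r_cancel_one by auto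
  show ?thesis
    unfolding semisimple_ring_def
  proof (intro conjI allI impI A.ring_axioms)
    fix L assume L: "left_ideal L A"
    note L' = L[unfolded left_ideal_iff[OF A.ring_axioms]]
    have Lc: "x \<in> carrier A" if "x \<in> L" for x using L' that by blast
    have "left_ideal (h ` L) B"
      unfolding left_ideal_iff[OF B.ring_axioms]
    proof (intro conjI ballI)
      show "h ` L \<subseteq> carrier B" using Lc hc by blast
      show "\<zero>\<^bsub>B\<^esub> \<in> h ` L" using L' h0 by (metis imageI)
      show "x \<oplus>\<^bsub>B\<^esub> y \<in> h ` L" if "x \<in> h ` L" "y \<in> h ` L" for x y
        using that L' Lc by (auto simp: h(3)[symmetric])
      show "a \<otimes>\<^bsub>B\<^esub> x \<in> h ` L" if "x \<in> h ` L" "a \<in> carrier B" for a x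
        using that L' Lc surj[of a] by (auto simp: h(2)[symmetric])
    qed
    then obtain K where K: "left_ideal K B" "h ` L \<inter> K = {\<zero>\<^bsub>B\<^esub>}" "h ` L <+>\<^bsub>B\<^esub> K = carrier B"
      using B unfolding semisimple_ring_def by blast
    note K' = K(1)[unfolded left_ideal_iff[OF B.ring_axioms]]
    define L2 where "L2 = {x \<in> carrier A. h x \<in> K}"
    have "left_ideal L2 A"
      unfolding left_ideal_iff[OF A.ring_axioms] using K' h hc h0 by (auto simp: L2_def)
    moreover have "L \<inter> L2 = {\<zero>\<^bsub>A\<^esub>}"
    proof
      show "L \<inter> L2 \<subseteq> {\<zero>\<^bsub>A\<^esub>}"
      proof
        fix x assume x: "x \<in> L \<inter> L2"
        then have "h x \<in> h ` L \<inter> K" by (auto simp: L2_def)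
        then have "h x = \<zero>\<^bsub>B\<^esub>" using K(2) by blast
        then show "x \<in> {\<zero>\<^bsub>A\<^esub>}" using inj[of x "\<zero>\<^bsub>A\<^esub>"] h0 x Lc by auto
      qed
      show "{\<zero>\<^bsub>A\<^esub>} \<subseteq> L \<inter> L2" using L' K' h0 by (auto simp: L2_def)
    qed
    moreover have "L <+>\<^bsub>A\<^esub> L2 = carrier A"
    proof
      show "L <+>\<^bsub>A\<^esub> L2 \<subseteq> carrier A" using Lc by (auto simp: set_add_def' L2_def)
      show "carrier A \<subseteq> L <+>\<^bsub>A\<^esub> L2"
      proof
        fix x assume x: "x \<in> carrier A"
        then have "h x \<in> h ` L <+>\<^bsub>B\<^esub> K" using K(3) hc by simp
        then obtain l k where lk: "l \<in> L" "k \<in> K" "h x = h l \<oplus>\<^bsub>B\<^esub> k"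
          by (auto simp: set_add_def')
        obtain k' where k': "k' \<in> carrier A" "k = h k'" using surj[of k] lk K' by blast
        then have "x = l \<oplus>\<^bsub>A\<^esub> k'" using lk x Lc by (intro inj) (auto simp: h)
        then show "x \<in> L <+>\<^bsub>A\<^esub> L2" using lk k' by (auto simp: set_add_def' L2_def)
      qed
    qed
    ultimately show "\<exists>L'. left_ideal L' A \<and> L \<inter> L' = {\<zero>\<^bsub>A\<^esub>} \<and> L <+>\<^bsub>A\<^esub> L' = carrier A" by blast
  qed
qed


section \<open>Quotients\<close>

text \<open>The first isomorphism theorem.  The ring axioms are asked of the target only: the source
  needs no more than an additive group on which the operations are defined, and this is what makes
  the lemma applicable to the free abelian group that presents a tensor product.\<close>

lemma quotient_algebra_first_iso:
  fixes B :: "('r::comm_ring_1, 'a) module" and N :: "('r, 'b) module"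
  assumes N: "assoc_algebra N" and B: "abelian_group B"
    and cm: "\<And>x y. x \<in> carrier B \<Longrightarrow> y \<in> carrier B \<Longrightarrow> x \<otimes>\<^bsub>B\<^esub> y \<in> carrier B"
    and c1: "\<one>\<^bsub>B\<^esub> \<in> carrier B"
    and cs: "\<And>c x. x \<in> carrier B \<Longrightarrow> c \<odot>\<^bsub>B\<^esub> x \<in> carrier B"
    and surj: "\<Phi> ` carrier B = carrier N"
    and \<Phi>m: "\<And>x y. x \<in> carrier B \<Longrightarrow> y \<in> carrier B \<Longrightarrow> \<Phi> (x \<otimes>\<^bsub>B\<^esub> y) = \<Phi> x \<otimes>\<^bsub>N\<^esub> \<Phi> y"
    and \<Phi>a: "\<And>x y. x \<in> carrier B \<Longrightarrow> y \<in> carrier B \<Longrightarrow> \<Phi> (x \<oplus>\<^bsub>B\<^esub> y) = \<Phi> x \<oplus>\<^bsub>N\<^esub> \<Phi> y"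
    and \<Phi>1: "\<Phi> \<one>\<^bsub>B\<^esub> = \<one>\<^bsub>N\<^esub>"
    and \<Phi>s: "\<And>c x. x \<in> carrier B \<Longrightarrow> \<Phi> (c \<odot>\<^bsub>B\<^esub> x) = c \<odot>\<^bsub>N\<^esub> \<Phi> x"
    and ker: "I = {x \<in> carrier B. \<Phi> x = \<zero>\<^bsub>N\<^esub>}"
  shows "assoc_algebra (quotient_algebra B I)" and "algebra_iso (quotient_algebra B I) N"
proof -
  interpret B: abelian_group B by fact
  interpret N: ring N using assoc_algebraD(1)[OF N] .
  let ?Q = "quotient_algebra B I"
  have \<Phi>c: "\<Phi> x \<in> carrier N" if "x \<in> carrier B" for x using surj that by blast
  have \<Phi>0: "\<Phi> \<zero>\<^bsub>B\<^esub> = \<zero>\<^bsub>N\<^esub>"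
    using \<Phi>a[of "\<zero>\<^bsub>B\<^esub>" "\<zero>\<^bsub>B\<^esub>"] \<Phi>c[of "\<zero>\<^bsub>B\<^esub>"] N.add.r_cancel_one by auto
  have \<Phi>n: "\<Phi> (\<ominus>\<^bsub>B\<^esub> x) = \<ominus>\<^bsub>N\<^esub> \<Phi> x" if "x \<in> carrier B" for x
    using that \<Phi>a[of "\<ominus>\<^bsub>B\<^esub> x" x] \<Phi>0 \<Phi>c by (simp add: B.l_neg N.minus_equality)
  define fib where "fib = (\<lambda>a. {x \<in> carrier B. \<Phi> x = \<Phi> a})"
  have coset: "I +>\<^bsub>B\<^esub> a = fib a" if a: "a \<in> carrier B" for a
  proof
    show "I +>\<^bsub>B\<^esub> a \<subseteq> fib a"
      using a \<Phi>c by (auto simp: a_r_coset_def' ker fib_def \<Phi>a)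
    show "fib a \<subseteq> I +>\<^bsub>B\<^esub> a"
    proof
      fix x assume "x \<in> fib a"
      then have x: "x \<in> carrier B" "\<Phi> x = \<Phi> a" by (auto simp: fib_def)
      have "x \<oplus>\<^bsub>B\<^esub> (\<ominus>\<^bsub>B\<^esub> a) \<in> I"
        using x a \<Phi>c by (simp add: ker \<Phi>a \<Phi>n N.r_neg)
      moreover have "x = (x \<oplus>\<^bsub>B\<^esub> (\<ominus>\<^bsub>B\<^esub> a)) \<oplus>\<^bsub>B\<^esub> a"
        using x a by (simp add: B.a_assoc B.l_neg)
      ultimately show "x \<in> I +>\<^bsub>B\<^esub> a" by (auto simp: a_r_coset_def')
    qed
  qed
  have fibself: "a \<in> fib a" if "a \<in> carrier B" for a using that by (simp add: fib_def)
  have fibD: "x \<in> carrier B" "\<Phi> x = \<Phi> a" if "x \<in> fib a" for x a using that by (auto simp: fib_def)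
  have fibcong: "fib a = fib b" if "\<Phi> a = \<Phi> b" for a b using that by (auto simp: fib_def)
  have Qc: "carrier ?Q = fib ` carrier B"
    by (auto simp: quotient_algebra_def with_smult_def FactRing_def A_RCOSETS_def' coset)
  have Q0: "\<zero>\<^bsub>?Q\<^esub> = fib \<zero>\<^bsub>B\<^esub>"
    by (simp add: quotient_algebra_def with_smult_def FactRing_def fib_def ker \<Phi>0)
  have Q1: "\<one>\<^bsub>?Q\<^esub> = fib \<one>\<^bsub>B\<^esub>"
    by (simp add: quotient_algebra_def with_smult_def FactRing_def coset c1)
  have Qa: "fib a \<oplus>\<^bsub>?Q\<^esub> fib b = fib (a \<oplus>\<^bsub>B\<^esub> b)" if ab: "a \<in> carrier B" "b \<in> carrier B" for a b
  proof -
    have "\<exists>y\<in>fib a. \<exists>z\<in>fib b. x = y \<oplus>\<^bsub>B\<^esub> z" if "x \<in> fib (a \<oplus>\<^bsub>B\<^esub> b)" for x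
    proof (intro bexI)
      note x = fibD[OF that]
      show "x = a \<oplus>\<^bsub>B\<^esub> (\<ominus>\<^bsub>B\<^esub> a \<oplus>\<^bsub>B\<^esub> x)"
        using x ab by (simp add: B.a_assoc[symmetric] B.r_neg)
      show "\<ominus>\<^bsub>B\<^esub> a \<oplus>\<^bsub>B\<^esub> x \<in> fib b"
        using x ab \<Phi>c by (simp add: fib_def \<Phi>a \<Phi>n N.a_assoc[symmetric] N.l_neg)
      show "a \<in> fib a" using ab fibself by blast
    qed
    moreover have "y \<oplus>\<^bsub>B\<^esub> z \<in> fib (a \<oplus>\<^bsub>B\<^esub> b)" if "y \<in> fib a" "z \<in> fib b" for y z
      using fibD[OF that(1)] fibD[OF that(2)] ab by (simp add: fib_def \<Phi>a)
    ultimately have "fib a <+>\<^bsub>B\<^esub> fib b = fib (a \<oplus>\<^bsub>B\<^esub> b)"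
      unfolding set_add_def' by blast
    then show ?thesis by (simp add: quotient_algebra_def with_smult_def FactRing_def)
  qed
  have Qm: "fib a \<otimes>\<^bsub>?Q\<^esub> fib b = fib (a \<otimes>\<^bsub>B\<^esub> b)" if ab: "a \<in> carrier B" "b \<in> carrier B" for a b
  proof -
    have "I +>\<^bsub>B\<^esub> (y \<otimes>\<^bsub>B\<^esub> z) = fib (a \<otimes>\<^bsub>B\<^esub> b)" if "y \<in> fib a" "z \<in> fib b" for y z
      using fibD[OF that(1)] fibD[OF that(2)] ab fibcong[of "y \<otimes>\<^bsub>B\<^esub> z" "a \<otimes>\<^bsub>B\<^esub> b"]
      by (simp add: coset cm \<Phi>m)
    then have "(\<Union>y\<in>fib a. \<Union>z\<in>fib b. I +>\<^bsub>B\<^esub> (y \<otimes>\<^bsub>B\<^esub> z)) = fib (a \<otimes>\<^bsub>B\<^esub> b)"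
      using fibself ab by blast
    then show ?thesis by (simp add: quotient_algebra_def with_smult_def FactRing_def rcoset_mult_def)
  qed
  have Qs: "c \<odot>\<^bsub>?Q\<^esub> fib a = fib (c \<odot>\<^bsub>B\<^esub> a)" if a: "a \<in> carrier B" for c a
  proof -
    have "I +>\<^bsub>B\<^esub> (c \<odot>\<^bsub>B\<^esub> y) = fib (c \<odot>\<^bsub>B\<^esub> a)" if "y \<in> fib a" for y
      using fibD[OF that] a fibcong[of "c \<odot>\<^bsub>B\<^esub> y" "c \<odot>\<^bsub>B\<^esub> a"]
      by (simp add: coset cs \<Phi>s)
    then have "(\<Union>y\<in>fib a. I +>\<^bsub>B\<^esub> (c \<odot>\<^bsub>B\<^esub> y)) = fib (c \<odot>\<^bsub>B\<^esub> a)"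
      using fibself a by blast
    then show ?thesis by (simp add: quotient_algebra_def with_smult_def)
  qed
  define h where "h = (\<lambda>C. the_elem (\<Phi> ` C))"
  have h: "h (fib a) = \<Phi> a" if a: "a \<in> carrier B" for a
  proof -
    have "\<Phi> ` fib a = {\<Phi> a}" using fibself[OF a] by (auto simp: fib_def)
    then show ?thesis by (simp add: h_def)
  qed
  have bij: "bij_betw h (carrier ?Q) (carrier N)"
    unfolding bij_betw_def
  proof
    show "inj_on h (carrier ?Q)"
    proof (rule inj_onI)
      fix C D assume "C \<in> carrier ?Q" "D \<in> carrier ?Q" "h C = h D"
      then obtain a b where "a \<in> carrier B" "b \<in> carrier B" "C = fib a" "D = fib b"
        unfolding Qc by blast
      then show "C = D" using \<open>h C = h D\<close> fibcong[of a b] by (simp add: h)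
    qed
    have "h ` carrier ?Q = \<Phi> ` carrier B"
      unfolding Qc image_image by (rule image_cong) (simp_all add: h)
    then show "h ` carrier ?Q = carrier N" using surj by simp
  qed
  note S = Qc Q0 Q1 Qa Qm Qs h cm c1 cs \<Phi>m \<Phi>a \<Phi>1 \<Phi>s \<Phi>0
  show "assoc_algebra ?Q"
    by (rule assoc_algebra_transfer[OF N bij]) (auto simp: S)
  show "algebra_iso ?Q N"
    by (rule algebra_isoI[OF bij]) (auto simp: S)
qed


section \<open>Linear extension from a monoid\<close>

text \<open>Algebras whose addition is that of their type, so that finite sums can be written with
  \<^const>\<open>sum\<close>; their carrier may be a proper subset of the type.\<close>

locale typed_algebra =
  fixes N :: "('r::comm_ring_1, 'b::ab_group_add) module" (structure)
  assumes assoc: "assoc_algebra N" and add_eq: "add N = (+)" and zero_eq: "ring.zero N = 0"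
begin

sublocale ring N using assoc_algebraD(1)[OF assoc] .

lemmas smult_closed = assoc_algebraD(2)[OF assoc]
  and smult_l_distr = assoc_algebraD(3)[OF assoc, unfolded add_eq]
  and smult_r_distr = assoc_algebraD(4)[OF assoc, unfolded add_eq]
  and smult_assoc = assoc_algebraD(5)[OF assoc]
  and smult_one = assoc_algebraD(6)[OF assoc]
  and smult_mult_l = assoc_algebraD(7)[OF assoc]
  and smult_mult_r = assoc_algebraD(8)[OF assoc]

lemma plus_closed: "x \<in> carrier N \<Longrightarrow> y \<in> carrier N \<Longrightarrow> x + y \<in> carrier N"
  using a_closed[of x y] by (simp add: add_eq)

lemma zero_in_carrier: "0 \<in> carrier N"
  using zero_closed by (simp add: zero_eq)

lemma smult_zero_left: "x \<in> carrier N \<Longrightarrow> 0 \<odot> x = 0"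
  using smult_l_distr[of x 0 0] by simp

lemma smult_zero_right: "c \<odot> 0 = 0"
  using smult_r_distr[of 0 0 c] zero_in_carrier by simp

lemma sum_closed: "(\<And>i. i \<in> A \<Longrightarrow> f i \<in> carrier N) \<Longrightarrow> sum f A \<in> carrier N"
  by (induction A rule: infinite_finite_induct) (auto simp: zero_in_carrier plus_closed)

lemma smult_sum: "(\<And>i. i \<in> A \<Longrightarrow> f i \<in> carrier N) \<Longrightarrow> c \<odot> sum f A = (\<Sum>i\<in>A. c \<odot> f i)"
  by (induction A rule: infinite_finite_induct) (auto simp: smult_zero_right smult_r_distr sum_closed)

lemma mult_zero_left: "x \<in> carrier N \<Longrightarrow> 0 \<otimes> x = 0"
  using l_null by (simp add: zero_eq)

lemma mult_zero_right: "x \<in> carrier N \<Longrightarrow> x \<otimes> 0 = 0"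
  using r_null by (simp add: zero_eq)

lemma sum_mult_left:
  "(\<And>i. i \<in> A \<Longrightarrow> f i \<in> carrier N) \<Longrightarrow> y \<in> carrier N \<Longrightarrow> sum f A \<otimes> y = (\<Sum>i\<in>A. f i \<otimes> y)"
  by (induction A rule: infinite_finite_induct)
    (auto simp: mult_zero_left sum_closed l_distr[unfolded add_eq])

lemma sum_mult_right:
  "(\<And>i. i \<in> A \<Longrightarrow> f i \<in> carrier N) \<Longrightarrow> y \<in> carrier N \<Longrightarrow> y \<otimes> sum f A = (\<Sum>i\<in>A. y \<otimes> f i)"
  by (induction A rule: infinite_finite_induct)
    (auto simp: mult_zero_right sum_closed r_distr[unfolded add_eq])

text \<open>The map out of a monoid algebra given by its universal property.  It is used twice: for the
  group algebra, and, with integral coefficients, for the free abelian group that presents a tensor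
  product.\<close>

definition lin_ext :: "('g \<Rightarrow> 'b) \<Rightarrow> ('g \<Rightarrow>\<^sub>0 'r) \<Rightarrow> 'b" where
  "lin_ext e f = (\<Sum>g\<in>Poly_Mapping.keys f. Poly_Mapping.lookup f g \<odot> e g)"

lemma lin_ext_superset:
  assumes "finite A" "Poly_Mapping.keys f \<subseteq> A" "\<And>g. g \<in> A \<Longrightarrow> e g \<in> carrier N"
  shows "lin_ext e f = (\<Sum>g\<in>A. Poly_Mapping.lookup f g \<odot> e g)"
  unfolding lin_ext_def
  by (rule sum.mono_neutral_left) (use assms in \<open>auto simp: in_keys_iff smult_zero_left\<close>)

lemma lin_ext_closed:
  assumes "\<And>g. g \<in> Poly_Mapping.keys f \<Longrightarrow> e g \<in> carrier N"
  shows "lin_ext e f \<in> carrier N"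
  unfolding lin_ext_def by (rule sum_closed) (simp add: smult_closed assms)

lemma lin_ext_zero: "lin_ext e 0 = 0"
  by (simp add: lin_ext_def)

lemma lin_ext_single: "e g \<in> carrier N \<Longrightarrow> lin_ext e (Poly_Mapping.single g c) = c \<odot> e g"
  by (simp add: lin_ext_def smult_zero_left)

lemma lin_ext_add:
  assumes "\<And>g. g \<in> Poly_Mapping.keys f \<Longrightarrow> e g \<in> carrier N"
    and "\<And>g. g \<in> Poly_Mapping.keys f' \<Longrightarrow> e g \<in> carrier N"
  shows "lin_ext e (f + f') = lin_ext e f + lin_ext e f'"
proof -
  let ?A = "Poly_Mapping.keys f \<union> Poly_Mapping.keys f'"
  have eA: "e g \<in> carrier N" if "g \<in> ?A" for g using that assms by auto
  have "lin_ext e h = (\<Sum>g\<in>?A. Poly_Mapping.lookup h g \<odot> e g)" if "Poly_Mapping.keys h \<subseteq> ?A" for h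
    by (rule lin_ext_superset) (use that eA in auto)
  then show ?thesis
    using eA Poly_Mapping.keys_add[of f f']
    by (simp add: lookup_add smult_l_distr sum.distrib)
qed

lemma lin_ext_sum:
  assumes "\<And>i g. i \<in> A \<Longrightarrow> g \<in> Poly_Mapping.keys (F i) \<Longrightarrow> e g \<in> carrier N"
  shows "lin_ext e (sum F A) = (\<Sum>i\<in>A. lin_ext e (F i))"
  using assms
proof (induction A rule: infinite_finite_induct)
  case (insert i A)
  have "e g \<in> carrier N" if "g \<in> Poly_Mapping.keys (sum F A)" for g
    using that insert.prems Poly_Mapping.keys_sum[of F A] by fastforce
  then have "lin_ext e (F i + sum F A) = lin_ext e (F i) + lin_ext e (sum F A)"
    by (intro lin_ext_add) (use insert.prems in auto)
  moreover have "lin_ext e (sum F A) = (\<Sum>i\<in>A. lin_ext e (F i))"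
    using insert by blast
  ultimately show ?case using insert.hyps by simp
qed (auto simp: lin_ext_zero)

lemma lin_ext_mult:
  assumes G: "\<And>g g'. g \<in> carrier G \<Longrightarrow> g' \<in> carrier G \<Longrightarrow> g \<otimes>\<^bsub>G\<^esub> g' \<in> carrier G"
    and e: "\<And>g. g \<in> carrier G \<Longrightarrow> e g \<in> carrier N"
    and em: "\<And>g g'. g \<in> carrier G \<Longrightarrow> g' \<in> carrier G \<Longrightarrow> e (g \<otimes>\<^bsub>G\<^esub> g') = e g \<otimes> e g'"
    and f: "Poly_Mapping.keys f \<subseteq> carrier G" "Poly_Mapping.keys f' \<subseteq> carrier G"
  shows "lin_ext e (f \<otimes>\<^bsub>group_algebra G\<^esub> f') = lin_ext e f \<otimes> lin_ext e f'"
proof -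
  let ?F = "\<lambda>g g'. Poly_Mapping.single (g \<otimes>\<^bsub>G\<^esub> g') (Poly_Mapping.lookup f g * Poly_Mapping.lookup f' g')"
  have k: "g \<in> carrier G" if "g \<in> Poly_Mapping.keys f" for g using that f by blast
  have k': "g \<in> carrier G" if "g \<in> Poly_Mapping.keys f'" for g using that f by blast
  have "lin_ext e (f \<otimes>\<^bsub>group_algebra G\<^esub> f') =
      (\<Sum>g\<in>Poly_Mapping.keys f. lin_ext e (\<Sum>g'\<in>Poly_Mapping.keys f'. ?F g g'))"
    unfolding group_algebra_def
  proof (simp, rule lin_ext_sum)
    fix g x assume g: "g \<in> Poly_Mapping.keys f"
      and "x \<in> Poly_Mapping.keys (\<Sum>g'\<in>Poly_Mapping.keys f'. ?F g g')"
    then obtain g' where "g' \<in> Poly_Mapping.keys f'" "x \<in> Poly_Mapping.keys (?F g g')"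
      using Poly_Mapping.keys_sum[of "?F g" "Poly_Mapping.keys f'"] by blast
    then show "e x \<in> carrier N" using g k k' G e by (auto split: if_splits)
  qed
  also have "\<dots> = (\<Sum>g\<in>Poly_Mapping.keys f. \<Sum>g'\<in>Poly_Mapping.keys f'. lin_ext e (?F g g'))"
    by (intro sum.cong refl lin_ext_sum) (use k k' G e in \<open>auto split: if_splits\<close>)
  also have "\<dots> = (\<Sum>g\<in>Poly_Mapping.keys f. \<Sum>g'\<in>Poly_Mapping.keys f'.
      (Poly_Mapping.lookup f g \<odot> e g) \<otimes> (Poly_Mapping.lookup f' g' \<odot> e g'))"
    by (intro sum.cong refl)
      (simp add: lin_ext_single k k' G e em smult_mult_l smult_mult_r smult_assoc[symmetric]
        smult_closed mult.commute)
  also have "\<dots> = lin_ext e f \<otimes> lin_ext e f'"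
    by (simp add: lin_ext_def sum_mult_left sum_mult_right sum_closed smult_closed e k k')
      (rule sum.swap)
  finally show ?thesis .
qed

end

lemma assoc_algebra_restrict_scalars:
  fixes N :: "('s::comm_ring_1, 'b) module" and \<psi> :: "'r::comm_ring_1 \<Rightarrow> 's"
  assumes N: "assoc_algebra N" and \<psi>: "\<psi> 1 = 1" "\<And>a b. \<psi> (a + b) = \<psi> a + \<psi> b"
    "\<And>a b. \<psi> (a * b) = \<psi> a * \<psi> b"
  shows "assoc_algebra (restrict_scalars \<psi> N)"
proof -
  interpret ring N by (rule assoc_algebraD(1)[OF N])
  let ?N = "restrict_scalars \<psi> N"
  have [simp]: "carrier ?N = carrier N" "monoid.mult ?N = monoid.mult N" "add ?N = add N"
    "\<zero>\<^bsub>?N\<^esub> = \<zero>\<^bsub>N\<^esub>" "\<one>\<^bsub>?N\<^esub> = \<one>\<^bsub>N\<^esub>" "module.smult ?N = (\<lambda>c. module.smult N (\<psi> c))"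
    by (simp_all add: restrict_scalars_def with_smult_def)
  have "\<exists>y\<in>carrier N. y \<oplus>\<^bsub>N\<^esub> x = \<zero>\<^bsub>N\<^esub>" if "x \<in> carrier N" for x
    using l_neg[OF that] a_inv_closed[OF that] by blast
  then show ?thesis
    by (intro assoc_algebraI; simp add: assoc_algebraD(2-)[OF N] \<psi> a_assoc m_assoc l_distr r_distr)
      (rule a_comm)
qed

lemma typed_algebra_of_int:
  assumes "typed_algebra N"
  shows "typed_algebra (restrict_scalars (of_int :: int \<Rightarrow> 'r::comm_ring_1) N)"
proof -
  interpret typed_algebra N by fact
  show ?thesis
    by unfold_locales
      (rule assoc_algebra_restrict_scalars[OF assoc],
        simp_all add: restrict_scalars_def with_smult_def add_eq zero_eq)
qed

lemma group_algebra_mult_closed: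
  fixes f f' :: "'g \<Rightarrow>\<^sub>0 'r::comm_ring_1"
  assumes G: "\<And>g g'. g \<in> carrier G \<Longrightarrow> g' \<in> carrier G \<Longrightarrow> g \<otimes>\<^bsub>G\<^esub> g' \<in> carrier G"
    and f: "Poly_Mapping.keys f \<subseteq> carrier G" "Poly_Mapping.keys f' \<subseteq> carrier G"
  shows "Poly_Mapping.keys (f \<otimes>\<^bsub>group_algebra G\<^esub> f') \<subseteq> carrier G"
proof -
  let ?F = "\<lambda>g g'. Poly_Mapping.single (g \<otimes>\<^bsub>G\<^esub> g') (Poly_Mapping.lookup f g * Poly_Mapping.lookup f' g')"
  have sum: "Poly_Mapping.keys (sum F A) \<subseteq> carrier G"
    if "\<And>i. i \<in> A \<Longrightarrow> Poly_Mapping.keys (F i) \<subseteq> carrier G" for A and F :: "'g \<Rightarrow> 'g \<Rightarrow>\<^sub>0 'r"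
    using that Poly_Mapping.keys_sum[of F A] by blast
  have "Poly_Mapping.keys (?F g g') \<subseteq> carrier G"
    if "g \<in> Poly_Mapping.keys f" "g' \<in> Poly_Mapping.keys f'" for g g'
    using that f G by (simp add: subset_iff)
  then have "Poly_Mapping.keys (\<Sum>g\<in>Poly_Mapping.keys f. \<Sum>g'\<in>Poly_Mapping.keys f'. ?F g g') \<subseteq> carrier G"
    by (intro sum) auto
  then show ?thesis by (simp add: group_algebra_def)
qed


section \<open>Extension of scalars of a free algebra\<close>

text \<open>Stated as an induction principle, so that generation carries over along maps without
  manipulating linear combinations.\<close>

definition spans :: "('r, 'a) module \<Rightarrow> 'i set \<Rightarrow> ('i \<Rightarrow> 'a) \<Rightarrow> bool" where
  "spans M I e \<longleftrightarrow>
     (\<forall>U. (\<forall>i\<in>I. \<forall>c. c \<odot>\<^bsub>M\<^esub> e i \<in> U) \<and>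
          (\<forall>x\<in>U \<inter> carrier M. \<forall>y\<in>U \<inter> carrier M. x \<oplus>\<^bsub>M\<^esub> y \<in> U) \<longrightarrow> carrier M \<subseteq> U)"

lemma spans_induct [consumes 2, case_names smult add]:
  assumes "spans M I e" and "x \<in> carrier M"
    and "\<And>c i. i \<in> I \<Longrightarrow> P (c \<odot>\<^bsub>M\<^esub> e i)"
    and "\<And>x y. x \<in> carrier M \<Longrightarrow> y \<in> carrier M \<Longrightarrow> P x \<Longrightarrow> P y \<Longrightarrow> P (x \<oplus>\<^bsub>M\<^esub> y)"
  shows "P x"
  using assms(1)[unfolded spans_def, rule_format, of "Collect P"] assms(2-4) by auto

lemma spans_transfer:
  assumes A: "assoc_algebra A" and h: "bij_betw h (carrier A) (carrier B)"
    and ha: "\<And>x y. x \<in> carrier A \<Longrightarrow> y \<in> carrier A \<Longrightarrow> h (x \<oplus>\<^bsub>A\<^esub> y) = h x \<oplus>\<^bsub>B\<^esub> h y"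
    and hs: "\<And>c x. x \<in> carrier A \<Longrightarrow> h (c \<odot>\<^bsub>A\<^esub> x) = c \<odot>\<^bsub>B\<^esub> h x"
    and e: "\<And>i. i \<in> I \<Longrightarrow> e i \<in> carrier A" and span: "spans B I (\<lambda>i. h (e i))"
  shows "spans A I e"
  unfolding spans_def
proof (intro allI impI subsetI)
  note As = assoc_algebraD(2)[OF A] ring.ring_simprules(1)[OF assoc_algebraD(1)[OF A]]
  fix U x assume U: "(\<forall>i\<in>I. \<forall>c. c \<odot>\<^bsub>A\<^esub> e i \<in> U) \<and>
      (\<forall>x\<in>U \<inter> carrier A. \<forall>y\<in>U \<inter> carrier A. x \<oplus>\<^bsub>A\<^esub> y \<in> U)" and x: "x \<in> carrier A"
  have "h x \<in> carrier B" using h x by (rule bij_betw_apply)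
  with span have "\<exists>x'\<in>U \<inter> carrier A. h x = h x'"
  proof (induction rule: spans_induct)
    case (smult c i)
    then have "c \<odot>\<^bsub>B\<^esub> h (e i) = h (c \<odot>\<^bsub>A\<^esub> e i)" by (simp add: hs e)
    then show ?case using U smult e As(1) by blast
  next
    case (add z w)
    then obtain z' w' where "z' \<in> U \<inter> carrier A" "z = h z'" "w' \<in> U \<inter> carrier A" "w = h w'" by blast
    moreover from this have "z \<oplus>\<^bsub>B\<^esub> w = h (z' \<oplus>\<^bsub>A\<^esub> w')" by (simp add: ha)
    ultimately show ?case using U As(2) by blast
  qed
  then show "x \<in> U" using x h by (auto simp: bij_betw_def inj_on_def)
qed

lemma spans_finite_dimensional:
  fixes A :: "('r::field, 'a) module"
  assumes A: "assoc_algebra A" and I: "finite I" and e: "\<And>i. i \<in> I \<Longrightarrow> e i \<in> carrier A"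
    and span: "spans A I e"
  shows "finite_dimensional_algebra A"
proof -
  interpret ring A by (rule assoc_algebraD(1)[OF A])
  note As = assoc_algebraD(2-)[OF A]
  let ?S = "e ` I"
  have S: "finite ?S" "?S \<subseteq> carrier A" using I e by auto
  have zero: "0 \<odot>\<^bsub>A\<^esub> x = \<zero>\<^bsub>A\<^esub>" if "x \<in> carrier A" for x
    using As(2)[of x 0 0] As(1)[of x 0] that by (simp add: add.r_cancel_one)
  have "\<exists>c. a = (\<Oplus>\<^bsub>A\<^esub>x\<in>?S. c x \<odot>\<^bsub>A\<^esub> x)" if "a \<in> carrier A" for a
    using span that
  proof (induction rule: spans_induct)
    case (smult c i)
    have "(\<Oplus>\<^bsub>A\<^esub>x\<in>?S. (if x = e i then c else 0) \<odot>\<^bsub>A\<^esub> x) =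
        (\<Oplus>\<^bsub>A\<^esub>x\<in>?S. if e i = x then c \<odot>\<^bsub>A\<^esub> x else \<zero>\<^bsub>A\<^esub>)"
      by (rule finsum_cong') (use S zero As(1) in auto)
    also have "\<dots> = c \<odot>\<^bsub>A\<^esub> e i"
      by (rule finsum_singleton) (use S smult As(1) in auto)
    finally show ?case by metis
  next
    case (add x y)
    then obtain c d where "x = (\<Oplus>\<^bsub>A\<^esub>x\<in>?S. c x \<odot>\<^bsub>A\<^esub> x)" "y = (\<Oplus>\<^bsub>A\<^esub>x\<in>?S. d x \<odot>\<^bsub>A\<^esub> x)" by blast
    then have "x \<oplus>\<^bsub>A\<^esub> y = (\<Oplus>\<^bsub>A\<^esub>x\<in>?S. c x \<odot>\<^bsub>A\<^esub> x \<oplus>\<^bsub>A\<^esub> d x \<odot>\<^bsub>A\<^esub> x)"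
      using S As(1) by (subst finsum_addf) auto
    also have "\<dots> = (\<Oplus>\<^bsub>A\<^esub>x\<in>?S. (c x + d x) \<odot>\<^bsub>A\<^esub> x)"
      by (rule finsum_cong') (use S As(1,2) in auto)
    finally show ?case by (rule exI[of _ "\<lambda>x. c x + d x"])
  qed
  then show ?thesis unfolding finite_dimensional_algebra_def using S by blast
qed

lemma free_tensor_simps:
  fixes M :: "('r, 'a) module"
  defines "T \<equiv> free_tensor M :: ('s::comm_ring_1, _) module"
  shows "carrier T = {f. Poly_Mapping.keys f \<subseteq> UNIV \<times> carrier M}"
    and "monoid.mult T = monoid.mult (group_algebra ((ring_of_type_algebra :: 's ring) \<times>\<times> M))"
    and "\<one>\<^bsub>T\<^esub> = frag_of (1, \<one>\<^bsub>M\<^esub>)"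
    and "\<zero>\<^bsub>T\<^esub> = 0" and "add T = (+)"
    and "module.smult T = (\<lambda>c. frag_extend (\<lambda>(s, x). frag_of (c * s, x)))"
  by (simp_all add: T_def free_tensor_def with_smult_def group_algebra_def ring_of_type_algebra_def)

lemma free_tensor_abelian_group:
  fixes M :: "('r, 'a) module"
  shows "abelian_group (free_tensor M :: ('s::comm_ring_1, 's \<times> 'a \<Rightarrow>\<^sub>0 int) module)"
proof (rule abelian_groupI, unfold free_tensor_simps)
  show "\<exists>y\<in>{f. Poly_Mapping.keys f \<subseteq> UNIV \<times> carrier M}. y + x = 0"
    if "x \<in> {f. Poly_Mapping.keys f \<subseteq> UNIV \<times> carrier M}" for x :: "'s \<times> 'a \<Rightarrow>\<^sub>0 int"
    using that by (intro bexI[of _ "- x"]) auto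
  show "x + y \<in> {f. Poly_Mapping.keys f \<subseteq> UNIV \<times> carrier M}"
    if "x \<in> {f. Poly_Mapping.keys f \<subseteq> UNIV \<times> carrier M}"
      "y \<in> {f. Poly_Mapping.keys f \<subseteq> UNIV \<times> carrier M}" for x y :: "'s \<times> 'a \<Rightarrow>\<^sub>0 int"
    using that Poly_Mapping.keys_add[of x y] by blast
qed (auto simp: algebra_simps)

text \<open>Let \<open>M\<close> be an \<open>R\<close>-algebra spanned by a finite family \<open>e\<close>, and \<open>j : M \<rightarrow> N\<close> a homomorphism
  over \<open>\<phi> : R \<rightarrow> S\<close> that carries \<open>e\<close> to a basis of the \<open>S\<close>-algebra \<open>N\<close>, with coordinates \<open>\<kappa>\<close>.
  The map \<open>s \<otimes> x \<mapsto> s \<odot> j x\<close> is onto because its image contains the multiples of the basis.  Its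
  kernel is no larger than the relations: every formal sum is congruent to
  \<open>\<Sum>\<^sub>i \<kappa>\<^sub>i(y) \<otimes> e\<^sub>i\<close>, where \<open>y\<close> is its image, so that it is trivial when \<open>y = 0\<close>.\<close>

theorem extend_scalars_free:
  fixes M :: "('r::comm_ring_1, 'a) module" and N :: "('s::comm_ring_1, 'b::ab_group_add) module"
    and \<phi> :: "'r \<Rightarrow> 's" and e :: "'i \<Rightarrow> 'a"
  assumes M: "assoc_algebra M" and N: "typed_algebra N"
    and jc: "\<And>x. x \<in> carrier M \<Longrightarrow> j x \<in> carrier N"
    and ja: "\<And>x y. x \<in> carrier M \<Longrightarrow> y \<in> carrier M \<Longrightarrow> j (x \<oplus>\<^bsub>M\<^esub> y) = j x + j y"
    and jm: "\<And>x y. x \<in> carrier M \<Longrightarrow> y \<in> carrier M \<Longrightarrow> j (x \<otimes>\<^bsub>M\<^esub> y) = j x \<otimes>\<^bsub>N\<^esub> j y"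
    and j1: "j \<one>\<^bsub>M\<^esub> = \<one>\<^bsub>N\<^esub>"
    and js: "\<And>r x. x \<in> carrier M \<Longrightarrow> j (r \<odot>\<^bsub>M\<^esub> x) = \<phi> r \<odot>\<^bsub>N\<^esub> j x"
    and I: "finite I" and e: "\<And>i. i \<in> I \<Longrightarrow> e i \<in> carrier M" and Mspan: "spans M I e"
    and Nspan: "spans N I (\<lambda>i. j (e i))"
    and \<kappa>a: "\<And>i x y. i \<in> I \<Longrightarrow> x \<in> carrier N \<Longrightarrow> y \<in> carrier N \<Longrightarrow> \<kappa> i (x + y) = \<kappa> i x + \<kappa> i y"
    and \<kappa>e: "\<And>i k c. i \<in> I \<Longrightarrow> k \<in> I \<Longrightarrow> \<kappa> i (c \<odot>\<^bsub>N\<^esub> j (e k)) = (if i = k then c else 0)"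
  shows "assoc_algebra (extend_scalars \<phi> M)" and "algebra_iso (extend_scalars \<phi> M) N"
proof -
  interpret N: typed_algebra N by fact
  let ?Z = "restrict_scalars (of_int :: int \<Rightarrow> 's) N"
  interpret Z: typed_algebra ?Z by (rule typed_algebra_of_int[OF N])
  interpret M: ring M by (rule assoc_algebraD(1)[OF M])
  note Ms = assoc_algebraD(2-)[OF M]
  define T where "T = (free_tensor M :: ('s, 's \<times> 'a \<Rightarrow>\<^sub>0 int) module)"
  have Tsimps: "carrier T = {f. Poly_Mapping.keys f \<subseteq> UNIV \<times> carrier M}"
    "monoid.mult T = monoid.mult (group_algebra ((ring_of_type_algebra :: 's ring) \<times>\<times> M))"
    "\<one>\<^bsub>T\<^esub> = frag_of (1, \<one>\<^bsub>M\<^esub>)" "\<zero>\<^bsub>T\<^esub> = 0" "add T = (+)"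
    "module.smult T = (\<lambda>c. frag_extend (\<lambda>(s, x). frag_of (c * s, x)))"
    unfolding T_def by (rule free_tensor_simps)+
  interpret T: abelian_group T
    unfolding T_def by (rule free_tensor_abelian_group)
  have [simp]: "carrier ?Z = carrier N" "monoid.mult ?Z = monoid.mult N" "\<one>\<^bsub>?Z\<^esub> = \<one>\<^bsub>N\<^esub>"
    "module.smult ?Z = (\<lambda>c. module.smult N (of_int c))"
    by (simp_all add: restrict_scalars_def with_smult_def)
  define \<epsilon> where "\<epsilon> = (\<lambda>(s, x). s \<odot>\<^bsub>N\<^esub> j x)"
  define \<Phi> where "\<Phi> = Z.lin_ext \<epsilon>"
  define rel where "rel = generate (add_monoid T) (tensor_relations \<phi> M)"
  have \<epsilon>c: "\<epsilon> z \<in> carrier N" if "snd z \<in> carrier M" for z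
    using that by (cases z) (simp add: \<epsilon>_def N.smult_closed jc)
  have Tc: "snd g \<in> carrier M" if "f \<in> carrier T" "g \<in> Poly_Mapping.keys f" for f g
    using that unfolding Tsimps by auto
  have Tof: "frag_of (s, x) \<in> carrier T" if "x \<in> carrier M" for s x
    using that by (simp add: Tsimps)
  have Tadd: "f + f' \<in> carrier T" if "f \<in> carrier T" "f' \<in> carrier T" for f f'
    using T.a_closed[OF that] by (simp add: Tsimps(5))
  have Tneg: "- f \<in> carrier T" if "f \<in> carrier T" for f
    using that by (simp add: Tsimps)
  have Tdiff: "f - f' \<in> carrier T" if "f \<in> carrier T" "f' \<in> carrier T" for f f'
    using Tadd[OF that(1) Tneg[OF that(2)]] by simp
  have Tinv: "inv\<^bsub>add_monoid T\<^esub> f = - f" if "f \<in> carrier T" for f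
    using T.minus_equality[of "- f" f] that Tneg[OF that] by (simp add: Tsimps(4,5) a_inv_def)
  have Tind [consumes 1, case_names zero generator diff]: "P f" if f: "f \<in> carrier T"
    and "P 0" "\<And>s x. x \<in> carrier M \<Longrightarrow> P (frag_of (s, x))"
    and "\<And>f f'. f \<in> carrier T \<Longrightarrow> f' \<in> carrier T \<Longrightarrow> P f \<Longrightarrow> P f' \<Longrightarrow> P (f - f')" for P f
  proof -
    have "Poly_Mapping.keys f \<subseteq> UNIV \<times> carrier M" using f by (simp add: Tsimps)
    then have "f \<in> carrier T \<and> P f"
      by (induction f rule: frag_induction) (use that Tof Tdiff in \<open>auto simp: Tsimps(1)\<close>)
    then show ?thesis ..
  qed
  have \<Phi>a: "\<Phi> (f + f') = \<Phi> f + \<Phi> f'" if "f \<in> carrier T" "f' \<in> carrier T" for f f'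
    unfolding \<Phi>_def by (rule Z.lin_ext_add) (use that Tc \<epsilon>c in auto)
  have \<Phi>0: "\<Phi> 0 = 0" by (simp add: \<Phi>_def Z.lin_ext_zero)
  have \<Phi>n: "\<Phi> (- f) = - \<Phi> f" if "f \<in> carrier T" for f
    using \<Phi>a[of f "- f"] that Tneg \<Phi>0 by (simp add: minus_unique)
  have \<Phi>d: "\<Phi> (f - f') = \<Phi> f - \<Phi> f'" if "f \<in> carrier T" "f' \<in> carrier T" for f f'
    using \<Phi>a[of f "- f'"] \<Phi>n that Tneg by simp
  have \<Phi>of: "\<Phi> (frag_of (s, x)) = s \<odot>\<^bsub>N\<^esub> j x" if "x \<in> carrier M" for s x
    using Z.lin_ext_single[of \<epsilon> "(s, x)" 1] \<epsilon>c[of "(s, x)"] that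
    by (simp add: \<Phi>_def \<epsilon>_def N.smult_one)
  have \<Phi>c: "\<Phi> f \<in> carrier N" if "f \<in> carrier T" for f
    using Z.lin_ext_closed[of f \<epsilon>] that Tc \<epsilon>c by (simp add: \<Phi>_def)

  have relc: "f \<in> carrier T \<and> \<Phi> f = 0" if "f \<in> tensor_relations \<phi> M" for f
  proof -
    have "f \<in> carrier T \<and> \<Phi> f = 0"
      if "f = frag_of (s + s', x) - frag_of (s, x) - frag_of (s', x)" "x \<in> carrier M" for s s' x
      using that by (simp add: Tof Tdiff \<Phi>d \<Phi>of jc N.smult_l_distr)
    moreover have "f \<in> carrier T \<and> \<Phi> f = 0"
      if "f = frag_of (s, x \<oplus>\<^bsub>M\<^esub> x') - frag_of (s, x) - frag_of (s, x')"
        "x \<in> carrier M" "x' \<in> carrier M" for s x x'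
      using that by (simp add: Tof Tdiff \<Phi>d \<Phi>of jc ja N.smult_r_distr)
    moreover have "f \<in> carrier T \<and> \<Phi> f = 0"
      if "f = frag_of (s * \<phi> r, x) - frag_of (s, r \<odot>\<^bsub>M\<^esub> x)" "x \<in> carrier M" for s r x
      using that by (simp add: Tof Tdiff \<Phi>d \<Phi>of jc js Ms(1) N.smult_assoc)
    ultimately show ?thesis using that unfolding tensor_relations_def by blast
  qed
  have rel0: "0 \<in> rel"
    using generate.one[of "add_monoid T" "tensor_relations \<phi> M"] by (simp add: rel_def Tsimps)
  have reladd: "f + f' \<in> rel" if "f \<in> rel" "f' \<in> rel" for f f'
    using generate.eng[of f "add_monoid T" _ f'] that by (simp add: rel_def Tsimps)
  have relneg: "- f \<in> rel" if "f \<in> rel" for f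
    using that unfolding rel_def
  proof (induction rule: generate.induct)
    case one
    then show ?case using generate.one[of "add_monoid T" "tensor_relations \<phi> M"] by (simp add: Tsimps)
  next
    case (incl h)
    from generate.inv[OF this, of "add_monoid T"] show ?case using Tinv[of h] relc[OF incl] by simp
  next
    case (inv h)
    from generate.incl[OF this, of "add_monoid T"] show ?case using Tinv[of h] relc[OF inv] by simp
  next
    case (eng h1 h2)
    then show ?case
      using generate.eng[OF eng(3,4)] by (simp add: Tsimps)
  qed
  have reldiff: "f - f' \<in> rel" if "f \<in> rel" "f' \<in> rel" for f f'
    using reladd[OF that(1) relneg[OF that(2)]] by simp
  have relincl: "f \<in> rel" if "f \<in> tensor_relations \<phi> M" for f
    using generate.incl[OF that] by (simp add: rel_def)
  have relsum: "sum F A \<in> rel" if "\<And>i. i \<in> A \<Longrightarrow> F i \<in> rel" for F and A :: "'i set"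
    using that by (induction A rule: infinite_finite_induct) (auto simp: rel0 reladd)
  have rel_l: "frag_of (s + s', x) - frag_of (s, x) - frag_of (s', x) \<in> rel"
    if "x \<in> carrier M" for s s' x
    by (rule relincl) (use that in \<open>auto simp: tensor_relations_def\<close>)
  have rel_r: "frag_of (s, x \<oplus>\<^bsub>M\<^esub> x') - frag_of (s, x) - frag_of (s, x') \<in> rel"
    if "x \<in> carrier M" "x' \<in> carrier M" for s x x'
    by (rule relincl) (use that in \<open>auto simp: tensor_relations_def\<close>)
  have rel_b: "frag_of (s * \<phi> r, x) - frag_of (s, r \<odot>\<^bsub>M\<^esub> x) \<in> rel"
    if "x \<in> carrier M" for s r x
    by (rule relincl) (use that in \<open>auto simp: tensor_relations_def\<close>)
  have rel_z: "frag_of (0, x) \<in> rel" if "x \<in> carrier M" for x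
    using relneg[OF rel_l[OF that, of 0 0]] by simp
  have rel_sub: "rel \<subseteq> {f \<in> carrier T. \<Phi> f = 0}"
  proof
    fix f assume "f \<in> rel"
    then show "f \<in> {f \<in> carrier T. \<Phi> f = 0}"
      unfolding rel_def
    proof (induction rule: generate.induct)
      case one
      then show ?case using T.zero_closed by (simp add: \<Phi>0 Tsimps(4))
    next
      case (incl h)
      then show ?case using relc by simp
    next
      case (inv h)
      then show ?case using relc[OF inv] Tinv[of h] by (simp add: Tneg \<Phi>n)
    next
      case (eng h1 h2)
      then show ?case by (simp add: Tsimps(5) Tadd \<Phi>a)
    qed
  qed

  \<comment> \<open>Modulo the relations, \<open>\<Psi>\<close> is a left inverse of \<open>\<Phi>\<close>.\<close>
  define \<Psi> where "\<Psi> = (\<lambda>y. \<Sum>i\<in>I. frag_of (\<kappa> i y, e i))"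
  have \<Psi>a: "\<Psi> (x + y) - \<Psi> x - \<Psi> y \<in> rel" if xy: "x \<in> carrier N" "y \<in> carrier N" for x y
  proof -
    have "\<Psi> (x + y) - \<Psi> x - \<Psi> y =
        (\<Sum>i\<in>I. frag_of (\<kappa> i x + \<kappa> i y, e i) - frag_of (\<kappa> i x, e i) - frag_of (\<kappa> i y, e i))"
      using xy by (simp add: \<Psi>_def \<kappa>a sum_subtractf)
    then show ?thesis using relsum rel_l e by simp
  qed
  have \<Psi>e: "\<Psi> (c \<odot>\<^bsub>N\<^esub> j (e k)) - frag_of (c, e k) \<in> rel" if k: "k \<in> I" for c k
  proof -
    have "\<Psi> (c \<odot>\<^bsub>N\<^esub> j (e k)) = frag_of (c, e k) + (\<Sum>i\<in>I - {k}. frag_of (0, e i))"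
      using k by (simp add: \<Psi>_def \<kappa>e sum.remove[OF I k])
    then show ?thesis using relsum[of "I - {k}"] rel_z e by simp
  qed
  have \<Psi>\<Phi>of: "\<Psi> (s \<odot>\<^bsub>N\<^esub> j x) - frag_of (s, x) \<in> rel" if "x \<in> carrier M" for s x
    using Mspan that
  proof (induction rule: spans_induct)
    case (smult c i)
    have "\<Psi> (s \<odot>\<^bsub>N\<^esub> j (c \<odot>\<^bsub>M\<^esub> e i)) - frag_of (s * \<phi> c, e i) \<in> rel"
      using \<Psi>e[OF smult, of "s * \<phi> c"] e[OF smult] by (simp add: js jc N.smult_assoc)
    from reladd[OF this rel_b[OF e[OF smult], of s c]] show ?case by simp
  next
    case (add x y)
    let ?x = "s \<odot>\<^bsub>N\<^esub> j x" and ?y = "s \<odot>\<^bsub>N\<^esub> j y"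
    have "s \<odot>\<^bsub>N\<^esub> j (x \<oplus>\<^bsub>M\<^esub> y) = ?x + ?y"
      using add by (simp add: ja jc N.smult_r_distr)
    moreover have "\<Psi> (?x + ?y) - \<Psi> ?x - \<Psi> ?y \<in> rel"
      by (rule \<Psi>a) (use add in \<open>simp_all add: N.smult_closed jc\<close>)
    moreover have "\<Psi> ?x - frag_of (s, x) \<in> rel" "\<Psi> ?y - frag_of (s, y) \<in> rel" using add by auto
    moreover have "frag_of (s, x \<oplus>\<^bsub>M\<^esub> y) - frag_of (s, x) - frag_of (s, y) \<in> rel"
      by (rule rel_r) (use add in auto)
    ultimately have "(\<Psi> (?x + ?y) - \<Psi> ?x - \<Psi> ?y) + (\<Psi> ?x - frag_of (s, x)) + (\<Psi> ?y - frag_of (s, y))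
        - (frag_of (s, x \<oplus>\<^bsub>M\<^esub> y) - frag_of (s, x) - frag_of (s, y)) \<in> rel"
      by (metis reladd reldiff)
    then show ?case using \<open>s \<odot>\<^bsub>N\<^esub> j (x \<oplus>\<^bsub>M\<^esub> y) = ?x + ?y\<close> by simp
  qed
  have \<Psi>0: "\<Psi> 0 \<in> rel"
    using relneg[OF \<Psi>a[of 0 0]] N.zero_in_carrier by simp
  have \<Psi>\<Phi>: "\<Psi> (\<Phi> f) - f \<in> rel" if "f \<in> carrier T" for f
    using that
  proof (induction rule: Tind)
    case (diff f f')
    have "\<Psi> (\<Phi> f' + (\<Phi> f - \<Phi> f')) - \<Psi> (\<Phi> f') - \<Psi> (\<Phi> f - \<Phi> f') \<in> rel"
      using diff \<Phi>c Tdiff[of f f'] by (intro \<Psi>a) (auto simp: \<Phi>d[symmetric])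
    then have "\<Psi> (\<Phi> f) - \<Psi> (\<Phi> f') - \<Psi> (\<Phi> f - \<Phi> f') \<in> rel" by simp
    moreover have "\<Psi> (\<Phi> f) - f \<in> rel" "\<Psi> (\<Phi> f') - f' \<in> rel" using diff by auto
    ultimately have "(\<Psi> (\<Phi> f) - f) - (\<Psi> (\<Phi> f') - f') - (\<Psi> (\<Phi> f) - \<Psi> (\<Phi> f') - \<Psi> (\<Phi> f - \<Phi> f')) \<in> rel"
      by (metis reldiff)
    then show ?case using diff by (simp add: \<Phi>d algebra_simps)
  qed (use \<Psi>\<Phi>of in \<open>auto simp: \<Phi>0 \<Psi>0 \<Phi>of\<close>)
  have ker: "rel = {f \<in> carrier T. \<Phi> f = \<zero>\<^bsub>N\<^esub>}"
  proof (intro equalityI subsetI)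
    fix f assume "f \<in> {f \<in> carrier T. \<Phi> f = \<zero>\<^bsub>N\<^esub>}"
    then have "\<Psi> 0 - f \<in> rel" using \<Psi>\<Phi>[of f] by (simp add: N.zero_eq)
    from reldiff[OF \<Psi>0 this] show "f \<in> rel" by simp
  qed (use rel_sub in \<open>auto simp: N.zero_eq\<close>)

  have cl: "f \<otimes>\<^bsub>T\<^esub> f' \<in> carrier T" if "f \<in> carrier T" "f' \<in> carrier T" for f f'
    using group_algebra_mult_closed[of "(ring_of_type_algebra :: 's ring) \<times>\<times> M" f f'] that M.m_closed
    by (auto simp: Tsimps(1,2) ring_of_type_algebra_def)
  have sm: "c \<odot>\<^bsub>T\<^esub> f \<in> carrier T \<and> \<Phi> (c \<odot>\<^bsub>T\<^esub> f) = c \<odot>\<^bsub>N\<^esub> \<Phi> f" if "f \<in> carrier T" for c f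
    using that
  proof (induction rule: Tind)
    case (diff f f')
    have "c \<odot>\<^bsub>N\<^esub> \<Phi> f = c \<odot>\<^bsub>N\<^esub> (\<Phi> f - \<Phi> f') + c \<odot>\<^bsub>N\<^esub> \<Phi> f'"
      using N.smult_r_distr[of "\<Phi> f - \<Phi> f'" "\<Phi> f'" c] \<Phi>c[of "f - f'"] \<Phi>c[of f'] diff Tdiff[of f f']
      by (simp add: \<Phi>d)
    then show ?case
      using diff by (simp add: Tsimps(6) frag_extend_diff Tdiff \<Phi>d)
  qed (use T.zero_closed Tof in \<open>auto simp: Tsimps(4,6) \<Phi>0 N.smult_zero_right \<Phi>of N.smult_assoc jc\<close>)
  have surj: "\<Phi> ` carrier T = carrier N"
  proof
    show "carrier N \<subseteq> \<Phi> ` carrier T"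
    proof
      fix y assume "y \<in> carrier N"
      with Nspan show "y \<in> \<Phi> ` carrier T"
      proof (induction rule: spans_induct)
        case (smult c i)
        then show ?case using \<Phi>of[OF e[OF smult], of c] Tof[OF e[OF smult], of c] by (metis imageI)
      next
        case (add x y)
        then obtain f f' where f: "f \<in> carrier T" "x = \<Phi> f" "f' \<in> carrier T" "y = \<Phi> f'" by blast
        then have "x \<oplus>\<^bsub>N\<^esub> y = \<Phi> (f + f')" by (simp add: N.add_eq \<Phi>a)
        then show ?case using Tadd f by blast
      qed
    qed
  qed (use \<Phi>c in auto)
  have mult: "\<Phi> (f \<otimes>\<^bsub>T\<^esub> f') = \<Phi> f \<otimes>\<^bsub>N\<^esub> \<Phi> f'" if "f \<in> carrier T" "f' \<in> carrier T" for f f'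
    using Z.lin_ext_mult[of "(ring_of_type_algebra :: 's ring) \<times>\<times> M" \<epsilon> f f'] that M.m_closed \<epsilon>c
    by (auto simp: \<Phi>_def Tsimps(1,2) ring_of_type_algebra_def \<epsilon>_def jm jc N.smult_mult_l
        N.smult_mult_r N.smult_assoc[symmetric] N.smult_closed mult.commute)
  have 1: "assoc_algebra (quotient_algebra T rel)"
    by (rule quotient_algebra_first_iso(1)[where \<Phi> = \<Phi>, OF N.assoc T.abelian_group_axioms])
      (use cl sm surj mult ker Tof \<Phi>of in \<open>auto simp: Tsimps(3,5) N.add_eq \<Phi>a j1 N.smult_one\<close>)
  have 2: "algebra_iso (quotient_algebra T rel) N"
    by (rule quotient_algebra_first_iso(2)[where \<Phi> = \<Phi>, OF N.assoc T.abelian_group_axioms])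
      (use cl sm surj mult ker Tof \<Phi>of in \<open>auto simp: Tsimps(3,5) N.add_eq \<Phi>a j1 N.smult_one\<close>)
  show "assoc_algebra (extend_scalars \<phi> M)" "algebra_iso (extend_scalars \<phi> M) N"
    using 1 2 by (simp_all add: extend_scalars_def T_def rel_def)
qed


section \<open>The defining polynomials\<close>

lemma pcompose_diff_dvd:
  fixes a b p :: "'r::comm_ring_1 poly"
  shows "(a - b) dvd (pcompose p a - pcompose p b)"
proof (induction p)
  case (pCons c p)
  have "pcompose (pCons c p) a - pcompose (pCons c p) b =
      (a - b) * pcompose p a + b * (pcompose p a - pcompose p b)"
    by (simp add: pcompose_pCons algebra_simps)
  then show ?case using pCons by simp
qed simp

lemma pcompose_power: "pcompose (p ^ n) (q :: 'r::comm_ring_1 poly) = pcompose p q ^ n"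
  by (induction n) (simp_all add: pcompose_mult pcompose_1)

lemma pcompose_X: "pcompose [:0, 1:] (q :: 'r::comm_ring_1 poly) = q"
  by (simp add: pcompose_pCons)

text \<open>The constant term is the one for which \<open>u\<close> is a fixed point.  A translation would move that
  point to \<open>0\<close> at the price of an unwieldy polynomial.\<close>

definition twist :: "nat \<Rightarrow> 'r::idom \<Rightarrow> 'r poly" where
  "twist s u = [:0, 1:] ^ s + [:u - u ^ s:]"

abbreviation tw_hom :: "nat \<Rightarrow> 'r::idom \<Rightarrow> 'r poly \<Rightarrow> 'r poly" where
  "tw_hom s u p \<equiv> pcompose p (twist s u)"

text \<open>The second iterate of the twist minus \<open>X\<close>, divided by \<open>X - u\<close>.\<close>

definition modulus :: "nat \<Rightarrow> 'r::idom \<Rightarrow> 'r poly" where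
  "modulus s u = synthetic_div (tw_hom s u (twist s u) - [:0, 1:]) u"

text \<open>The quotient of the second iterate minus \<open>X\<close> by the first iterate minus \<open>X\<close>, in a form in
  which no division occurs.  Those of its roots that the twist does not fix are the points of period
  exactly two.\<close>

definition cofactor :: "nat \<Rightarrow> 'r::idom \<Rightarrow> 'r poly" where
  "cofactor s u = 1 + (\<Sum>i<s. twist s u ^ i * [:0, 1:] ^ (s - 1 - i))"

lemma tw_hom_twist: "tw_hom s u (twist s u) = twist s u ^ s + [:u - u ^ s:]"
  by (simp add: twist_def pcompose_add pcompose_power pcompose_X)

lemma poly_twist: "poly (twist s u) x = x ^ s + (u - u ^ s)"
  by (simp add: twist_def)

lemma modulus_eq: "[:- u, 1:] * modulus s u = tw_hom s u (twist s u) - [:0, 1:]"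
  using synthetic_div_correct'[of u "tw_hom s u (twist s u) - [:0, 1:]"]
  by (simp add: modulus_def poly_pcompose poly_twist)

lemma modulus_dvd: "modulus s u dvd tw_hom s u (twist s u) - [:0, 1:]"
  using modulus_eq[of u s] by (metis dvd_triv_right)

lemma cofactor_eq: "(twist s u - [:0, 1:]) * cofactor s u = tw_hom s u (twist s u) - [:0, 1:]"
proof (cases "s = 0")
  case False
  have "twist s u ^ s - [:0, 1:] ^ s =
      (twist s u - [:0, 1:]) * (\<Sum>i<s. twist s u ^ i * [:0, 1:] ^ (s - 1 - i))"
    using power_diff_sumr2[of "twist s u" s "[:0, 1:]"] by (simp add: mult.commute)
  then have "(twist s u - [:0, 1:]) * cofactor s u = twist s u - [:0, 1:] + (twist s u ^ s - [:0, 1:] ^ s)"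
    by (simp add: cofactor_def distrib_left)
  also have "\<dots> = tw_hom s u (twist s u) - [:0, 1:]"
    unfolding tw_hom_twist by (simp add: twist_def)
  finally show ?thesis .
qed (simp add: cofactor_def tw_hom_twist twist_def one_pCons)

text \<open>Substituting \<open>f \<circ> f\<close> and substituting \<open>X\<close> agree modulo \<open>f \<circ> f - X\<close>.\<close>

lemma tw_hom_tw_hom: "modulus s u dvd tw_hom s u (tw_hom s u p) - p"
proof -
  have "tw_hom s u (tw_hom s u p) - p = pcompose p (tw_hom s u (twist s u)) - pcompose p [:0, 1:]"
    by (simp add: pcompose_assoc)
  then show ?thesis using pcompose_diff_dvd modulus_dvd dvd_trans by metis
qed

lemma cofactor_tw_hom: "modulus s u dvd cofactor s u * (tw_hom s u p - p)"
proof -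
  have "(twist s u - [:0, 1:]) dvd tw_hom s u p - p"
    using pcompose_diff_dvd[of "twist s u" "[:0, 1:]" p] by simp
  then have "(twist s u - [:0, 1:]) * cofactor s u dvd cofactor s u * (tw_hom s u p - p)"
    by (simp add: mult.commute mult_dvd_mono)
  then show ?thesis
    unfolding cofactor_eq using modulus_dvd dvd_trans by blast
qed

text \<open>Modulo \<open>\<pi>\<close> the twist exchanges \<open>X\<close> and \<open>f\<close>, and the cofactor is symmetric in them.\<close>

lemma tw_hom_cofactor: "modulus s u dvd tw_hom s u (cofactor s u) - cofactor s u"
proof -
  let ?X = "[:0, 1:] :: 'a poly" and ?f = "twist s u"
  let ?g = "tw_hom s u ?f"
  have "cofactor s u = 1 + (\<Sum>i<s. ?f ^ (s - 1 - i) * ?X ^ i)"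
    unfolding cofactor_def
    by (subst sum.nat_diff_reindex[symmetric]) (auto intro!: sum.cong)
  moreover have "tw_hom s u (cofactor s u) = 1 + (\<Sum>i<s. ?g ^ i * ?f ^ (s - 1 - i))"
    by (simp add: cofactor_def pcompose_add pcompose_sum pcompose_mult pcompose_power pcompose_1 pcompose_X)
  ultimately have "tw_hom s u (cofactor s u) - cofactor s u =
      (\<Sum>i<s. (?g ^ i - ?X ^ i) * ?f ^ (s - 1 - i))"
    by (simp add: sum_subtractf[symmetric] algebra_simps)
  moreover have "modulus s u dvd ?g ^ i - ?X ^ i" for i
  proof -
    have "?g - ?X dvd ?g ^ i - ?X ^ i"
      using pcompose_diff_dvd[of ?g ?X "?X ^ i"] by (simp add: pcompose_power pcompose_X)
    then show ?thesis using modulus_dvd dvd_trans by blast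
  qed
  ultimately show ?thesis by (auto intro: dvd_sum)
qed

text \<open>The twist maps \<open>f \<circ> f - X = (X - u) \<pi>\<close> to a multiple of itself, but to conclude the same
  for \<open>\<pi>\<close> the factor \<open>X - u\<close> has to be cancelled.  Its image is \<open>(X - u) k\<close>, and applying the twist
  once more shows \<open>k \<eta>(k) = 1 + \<pi>\<close>, so that \<open>k\<close> is a unit modulo \<open>\<pi>\<close>.\<close>

lemma modulus_dvd_tw_hom:
  assumes "modulus s u dvd p"
  shows "modulus s u dvd tw_hom s u p"
proof -
  let ?X = "[:0, 1:] :: 'a poly" and ?f = "twist s u" and ?\<pi> = "modulus s u"
  let ?l = "[:- u, 1:] :: 'a poly"
  define g where "g = tw_hom s u ?f"
  have fu: "poly ?f u = u" by (simp add: poly_twist)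
  obtain k where k: "?f - [:u:] = ?l * k"
    using fu by (metis diff_self poly_diff dvdE poly_eq_0_iff_dvd poly_pCons poly_0 mult_zero_right add_0_right)
  have lf: "tw_hom s u ?l = ?l * k"
    unfolding k[symmetric] by (simp add: pcompose_pCons)
  have lne: "?l \<noteq> 0" by simp
  have "?l * k * tw_hom s u k = tw_hom s u (?l * k)"
    by (simp only: pcompose_mult lf)
  also have "\<dots> = g - [:u:]"
    by (simp only: k[symmetric] pcompose_diff g_def pcompose_const)
  also have "\<dots> = ?l + ?l * ?\<pi>"
    unfolding modulus_eq g_def by simp
  finally have "?l * (k * tw_hom s u k) = ?l * (1 + ?\<pi>)"
    by (simp only: mult.assoc distrib_left mult_1_right)
  then have kk: "k * tw_hom s u k = 1 + ?\<pi>" using lne by (metis mult_left_cancel)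
  have "?\<pi> dvd k * tw_hom s u ?\<pi>"
  proof -
    have "?l * (k * tw_hom s u ?\<pi>) = tw_hom s u (?l * ?\<pi>)"
      by (simp only: pcompose_mult lf mult.assoc)
    also have "\<dots> = pcompose (tw_hom s u ?f) ?f - ?f"
      unfolding modulus_eq by (simp add: pcompose_diff pcompose_X)
    also have "\<dots> = pcompose ?f g - pcompose ?f ?X"
      by (simp add: g_def pcompose_assoc)
    finally have "g - ?X dvd ?l * (k * tw_hom s u ?\<pi>)"
      using pcompose_diff_dvd by metis
    then have "?l * ?\<pi> dvd ?l * (k * tw_hom s u ?\<pi>)"
      unfolding modulus_eq g_def .
    then show ?thesis using lne by (metis dvd_mult_cancel_left)
  qed
  then have "?\<pi> dvd tw_hom s u k * (k * tw_hom s u ?\<pi>)" by simp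
  moreover have "tw_hom s u k * (k * tw_hom s u ?\<pi>) = tw_hom s u ?\<pi> + ?\<pi> * tw_hom s u ?\<pi>"
    using kk by (simp add: mult.assoc[symmetric] mult.commute[of "tw_hom s u k"] distrib_right)
  ultimately have "?\<pi> dvd tw_hom s u ?\<pi>" by (simp add: dvd_add_left_iff)
  then show ?thesis using assms by (auto simp: dvd_def pcompose_mult)
qed

lemma twist_degree:
  assumes "s > 1"
  shows "degree (twist s u) = s" "lead_coeff (twist s u) = 1"
proof -
  have *: "degree ([:0, 1:] ^ s :: 'a poly) = s" by (simp add: degree_power_eq)
  show 1: "degree (twist s u) = s"
    unfolding twist_def using assms by (subst degree_add_eq_left) (simp_all add: *)
  have "lead_coeff ([:0, 1:] ^ s :: 'a poly) = 1" by (simp add: lead_coeff_power)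
  then show "lead_coeff (twist s u) = 1"
    unfolding 1 using assms * by (simp add: twist_def coeff_pCons split: nat.splits)
qed

lemma modulus_monic:
  assumes s: "s > 1"
  shows "degree (modulus s u) = s\<^sup>2 - 1" "lead_coeff (modulus s u) = 1"
proof -
  let ?F = "tw_hom s u (twist s u) - [:0, 1:]"
  have fne: "twist s u \<noteq> 0" using twist_degree[OF s, of u] s by auto
  have d: "degree (twist s u ^ s) = s\<^sup>2"
    using fne twist_degree[OF s, of u] by (simp add: degree_power_eq power2_eq_square)
  have l: "lead_coeff (twist s u ^ s) = 1"
    using twist_degree[OF s, of u] by (simp add: lead_coeff_power)
  have s2: "s\<^sup>2 > 1" using s power_mono[of 2 s 2] by simp
  have F: "?F = twist s u ^ s + [:u - u ^ s, - 1:]" by (simp add: tw_hom_twist)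
  have dF: "degree ?F = s\<^sup>2"
    unfolding F using s2 by (subst degree_add_eq_left) (simp_all add: d)
  have lF: "lead_coeff ?F = 1"
    unfolding dF unfolding F using l s s2 by (simp add: d coeff_pCons split: nat.splits)
  have ne: "modulus s u \<noteq> 0" using modulus_eq[of u s] dF s2 by auto
  have "degree ?F = 1 + degree (modulus s u)"
    unfolding modulus_eq[symmetric] using ne by (subst degree_mult_eq) auto
  then show "degree (modulus s u) = s\<^sup>2 - 1" using dF by simp
  show "lead_coeff (modulus s u) = 1"
    using lF unfolding modulus_eq[symmetric] lead_coeff_mult by simp
qed


section \<open>Reduction modulo the defining polynomial\<close>

text \<open>The modulus is monic, so that pseudo-division is division with remainder, over any integral
  domain.\<close>

definition red :: "nat \<Rightarrow> 'r::idom \<Rightarrow> 'r poly \<Rightarrow> 'r poly" where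
  "red s u p = pseudo_mod p (modulus s u)"

context
  fixes s :: nat
  assumes s: "s > 1"
begin

lemma s2_gt: "s\<^sup>2 - 1 > (1::nat)"
  using s power_mono[of 2 s 2] by simp

lemma modulus_nonzero: "modulus s (u :: 'r::idom) \<noteq> 0"
  using modulus_monic[OF s, of u] by auto

lemma red_dvd: "modulus s u dvd p - red s u p"
proof -
  obtain q r where qr: "pseudo_divmod p (modulus s u) = (q, r)" by fastforce
  from pseudo_divmod(1)[OF modulus_nonzero qr] have "p = modulus s u * q + r"
    using modulus_monic[OF s, of u] by simp
  then show ?thesis using qr by (simp add: red_def pseudo_mod_def)
qed

lemma degree_red: "degree (red s u p) < s\<^sup>2 - 1"
  using pseudo_mod(2)[OF modulus_nonzero, of p u] modulus_monic[OF s, of u] s2_gt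
  by (auto simp: red_def)

lemma reduced_unique:
  assumes "modulus s u dvd p - q" "degree p < s\<^sup>2 - 1" "degree q < s\<^sup>2 - 1"
  shows "p = q"
proof (rule ccontr)
  assume "p \<noteq> q"
  then have "degree (modulus s u) \<le> degree (p - q)" using assms(1) by (simp add: dvd_imp_degree_le)
  then show False
    using degree_diff_less[of p "s\<^sup>2 - 1" q] assms modulus_monic[OF s, of u] by simp
qed

lemma red_cong: "modulus s u dvd p - q \<Longrightarrow> red s u p = red s u q"
proof (rule reduced_unique)
  assume "modulus s u dvd p - q"
  moreover have "red s u p - red s u q = (p - q) - (p - red s u p) + (q - red s u q)" by simp
  ultimately show "modulus s u dvd red s u p - red s u q" using red_dvd by (metis dvd_add dvd_diff)
qed (rule degree_red)+

lemma red_id: "degree p < s\<^sup>2 - 1 \<Longrightarrow> red s u p = p"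
  using reduced_unique[of u p "red s u p"] red_dvd degree_red by metis

lemma red_add: "red s u (p + q) = red s u p + red s u q"
proof (rule reduced_unique)
  have "red s u (p + q) - (red s u p + red s u q) =
      (p - red s u p) + (q - red s u q) - (p + q - red s u (p + q))" by simp
  then show "modulus s u dvd red s u (p + q) - (red s u p + red s u q)"
    using red_dvd by (metis dvd_add dvd_diff)
qed (rule degree_red, intro degree_add_less degree_red)

lemma red_smult: "red s u (smult c p) = smult c (red s u p)"
proof (rule reduced_unique)
  have "red s u (smult c p) - smult c (red s u p) =
      smult c (p - red s u p) - (smult c p - red s u (smult c p))" by (simp add: smult_diff_right)
  then show "modulus s u dvd red s u (smult c p) - smult c (red s u p)"
    using red_dvd by (metis dvd_diff dvd_smult)
  show "degree (smult c (red s u p)) < s\<^sup>2 - 1"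
    using degree_red degree_smult_le le_less_trans by blast
qed (rule degree_red)

end


section \<open>A family of twisted algebras\<close>

text \<open>A pair \<open>(p, q)\<close> stands for \<open>p + q y\<close>, where \<open>y p = \<eta>(p) y\<close> and \<open>y\<^sup>2 = 1 + b y\<close> with
  \<open>b = u h\<close>.  This product of unreduced pairs is associative only modulo the modulus.\<close>

definition pre_mult ::
  "nat \<Rightarrow> 'r::idom \<Rightarrow> 'r poly \<times> 'r poly \<Rightarrow> 'r poly \<times> 'r poly \<Rightarrow> 'r poly \<times> 'r poly" where
  "pre_mult s u = (\<lambda>(p, q) (p', q').
     (p * p' + q * tw_hom s u q',
      p * q' + q * tw_hom s u p' + smult u (cofactor s u) * q * tw_hom s u q'))"

definition red2 :: "nat \<Rightarrow> 'r::idom \<Rightarrow> 'r poly \<times> 'r poly \<Rightarrow> 'r poly \<times> 'r poly" where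
  "red2 s u = map_prod (red s u) (red s u)"

definition twisted_algebra :: "nat \<Rightarrow> 'r::idom \<Rightarrow> ('r, 'r poly \<times> 'r poly) module" where
  "twisted_algebra s u =
     \<lparr>carrier = {p. degree p < s\<^sup>2 - 1} \<times> {p. degree p < s\<^sup>2 - 1},
      monoid.mult = (\<lambda>z w. red2 s u (pre_mult s u z w)),
      monoid.one = (1, 0), ring.zero = 0, add = (+),
      module.smult = (\<lambda>c. map_prod (smult c) (smult c))\<rparr>"

definition cong2 :: "nat \<Rightarrow> 'r::idom \<Rightarrow> 'r poly \<times> 'r poly \<Rightarrow> 'r poly \<times> 'r poly \<Rightarrow> bool" where
  "cong2 s u z w \<longleftrightarrow> modulus s u dvd fst z - fst w \<and> modulus s u dvd snd z - snd w"

lemma dvd_mult_diff: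
  fixes m :: "'r::comm_ring_1"
  assumes "m dvd a - a'" "m dvd b - b'"
  shows "m dvd a * b - a' * b'"
proof -
  have "a * b - a' * b' = (a - a') * b + a' * (b - b')" by (simp add: algebra_simps)
  then show ?thesis using assms by simp
qed

lemma dvd_add_diff:
  fixes m :: "'r::comm_ring_1"
  assumes "m dvd a - a'" "m dvd b - b'"
  shows "m dvd a + b - (a' + b')"
proof -
  have "a + b - (a' + b') = (a - a') + (b - b')" by (simp add: algebra_simps)
  then show ?thesis using dvd_add[OF assms] by metis
qed

lemma tw_hom_cong:
  "modulus s u dvd p - q \<Longrightarrow> modulus s u dvd tw_hom s u p - tw_hom s u q"
  using modulus_dvd_tw_hom[of s u "p - q"] by (simp add: pcompose_diff)

lemma pre_mult_cong:
  assumes "cong2 s u z z'" "cong2 s u w w'"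
  shows "cong2 s u (pre_mult s u z w) (pre_mult s u z' w')"
  using assms
  by (auto simp: cong2_def pre_mult_def simp del: mult_smult_left mult_smult_right
      split: prod.splits intro!: dvd_add_diff dvd_mult_diff tw_hom_cong)

text \<open>The two bracketings differ only in terms in which \<open>y\<close> has passed twice, or past \<open>b\<close>.  Modulo
  the defining polynomial these differences vanish, because there the twist is an involution that
  fixes \<open>b\<close> and \<open>b \<eta>(p) = b p\<close>.\<close>

lemma pre_mult_assoc:
  "cong2 s u (pre_mult s u (pre_mult s u x y) z) (pre_mult s u x (pre_mult s u y z))"
proof -
  obtain p q p' q' p'' q'' where xyz: "x = (p, q)" "y = (p', q')" "z = (p'', q'')"
    by (cases x, cases y, cases z) auto
  define \<eta> where "\<eta> = tw_hom s u"
  define b where "b = smult u (cofactor s u)"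
  define D1 where "D1 = \<eta> (\<eta> p'') - p''"
  define D2 where "D2 = \<eta> (\<eta> q'') - q''"
  define E where "E = (\<eta> b - b) * \<eta> (\<eta> q'') + b * (\<eta> (\<eta> q'') - \<eta> q'')"
  define G where "G = b * (\<eta> (\<eta> p'') - \<eta> p'')"
  have b: "modulus s u dvd b * (\<eta> r - r)" for r
    using cofactor_tw_hom[of s u r] by (simp add: b_def \<eta>_def dvd_smult)
  have "\<eta> b - b = smult u (\<eta> (cofactor s u) - cofactor s u)"
    by (simp add: b_def \<eta>_def pcompose_smult smult_diff_right)
  then have \<eta>b: "modulus s u dvd \<eta> b - b"
    using tw_hom_cofactor[of s u] by (simp add: \<eta>_def dvd_smult)
  have dvd: "modulus s u dvd D1" "modulus s u dvd D2" "modulus s u dvd E" "modulus s u dvd G"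
    using b \<eta>b tw_hom_tw_hom[of s u] by (auto simp: D1_def D2_def E_def G_def \<eta>_def)
  have \<eta>: "\<eta> (r + t) = \<eta> r + \<eta> t" "\<eta> (r * t) = \<eta> r * \<eta> t" for r t
    by (simp_all add: \<eta>_def pcompose_add pcompose_mult)
  have m: "pre_mult s u (a, a') (c, c') = (a * c + a' * \<eta> c', a * c' + a' * \<eta> c + b * a' * \<eta> c')"
    for a a' c c' by (simp add: pre_mult_def \<eta>_def b_def)
  have "fst (pre_mult s u (pre_mult s u x y) z) - fst (pre_mult s u x (pre_mult s u y z)) =
      - (q * \<eta> q') * D1 - (q * \<eta> q') * E"
    by (simp add: xyz m \<eta> D1_def E_def algebra_simps)
  moreover have "snd (pre_mult s u (pre_mult s u x y) z) - snd (pre_mult s u x (pre_mult s u y z)) =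
      - (q * \<eta> q') * D2 - (q * \<eta> q') * G - b * q * \<eta> q' * E"
    by (simp add: xyz m \<eta> D2_def E_def G_def algebra_simps)
  ultimately show ?thesis
    unfolding cong2_def using dvd by (metis dvd_diff dvd_mult)
qed

lemma pre_mult_add_left: "pre_mult s u (x + y) z = pre_mult s u x z + pre_mult s u y z"
  by (cases x, cases y, cases z) (simp add: pre_mult_def smult_add_right algebra_simps)

lemma pre_mult_add_right: "pre_mult s u z (x + y) = pre_mult s u z x + pre_mult s u z y"
  by (cases x, cases y, cases z) (simp add: pre_mult_def pcompose_add smult_add_right algebra_simps)

lemma twisted_algebra_simps:
  "carrier (twisted_algebra s u) = {p. degree p < s\<^sup>2 - 1} \<times> {p. degree p < s\<^sup>2 - 1}"
  "z \<otimes>\<^bsub>twisted_algebra s u\<^esub> w = red2 s u (pre_mult s u z w)"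
  "\<one>\<^bsub>twisted_algebra s u\<^esub> = (1, 0)"
  "\<zero>\<^bsub>twisted_algebra s u\<^esub> = 0"
  "add (twisted_algebra s u) = (+)"
  "c \<odot>\<^bsub>twisted_algebra s u\<^esub> z = map_prod (smult c) (smult c) z"
  by (simp_all add: twisted_algebra_def)

lemma cong2_refl: "cong2 s u z z" by (simp add: cong2_def)

lemma cong2_sym: "cong2 s u z w \<Longrightarrow> cong2 s u w z"
  unfolding cong2_def by (metis dvd_minus_iff minus_diff_eq)

lemma cong2_trans [trans]: "cong2 s u z w \<Longrightarrow> cong2 s u w v \<Longrightarrow> cong2 s u z v"
  using dvd_add[of "modulus s u" "fst z - fst w" "fst w - fst v"]
    dvd_add[of "modulus s u" "snd z - snd w" "snd w - snd v"] by (simp add: cong2_def)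

context
  fixes s :: nat
  assumes s: "s > 1"
begin

lemma red2_carrier: "red2 s u z \<in> carrier (twisted_algebra s u)"
  by (cases z) (simp add: red2_def twisted_algebra_simps degree_red[OF s, unfolded One_nat_def])

lemma red2_cong: "cong2 s u z w \<Longrightarrow> red2 s u z = red2 s u w"
  by (cases z, cases w) (auto simp: red2_def cong2_def intro: red_cong[OF s])

lemma red2_self: "cong2 s u z (red2 s u z)"
  by (cases z) (auto simp: red2_def cong2_def intro: red_dvd[OF s])

lemma red2_id: "z \<in> carrier (twisted_algebra s u) \<Longrightarrow> red2 s u z = z"
  by (cases z) (auto simp: red2_def twisted_algebra_simps intro!: red_id[OF s])

lemma red2_add: "red2 s u (z + w) = red2 s u z + red2 s u w"
  by (cases z, cases w) (simp add: red2_def red_add[OF s])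

lemma red2_smult: "red2 s u (map_prod (smult c) (smult c) z) = map_prod (smult c) (smult c) (red2 s u z)"
  by (cases z) (simp add: red2_def red_smult[OF s])

lemma twisted_algebra_closed:
  "x \<in> carrier (twisted_algebra s u) \<Longrightarrow> y \<in> carrier (twisted_algebra s u) \<Longrightarrow>
     x + y \<in> carrier (twisted_algebra s u)"
  "x \<in> carrier (twisted_algebra s u) \<Longrightarrow> - x \<in> carrier (twisted_algebra s u)"
  "x \<in> carrier (twisted_algebra s u) \<Longrightarrow> map_prod (smult c) (smult c) x \<in> carrier (twisted_algebra s u)"
  "0 \<in> carrier (twisted_algebra s u)" "(1, 0) \<in> carrier (twisted_algebra s u)"
  using s2_gt[OF s]
  by (auto simp: twisted_algebra_simps degree_add_less zero_prod_def intro: le_less_trans[OF degree_smult_le])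

lemma typed_algebra_twisted_algebra: "typed_algebra (twisted_algebra s u)"
proof -
  let ?A = "twisted_algebra s u"
  have one: "pre_mult s u (1, 0) x = x" "pre_mult s u x (1, 0) = x" for x
    by (simp_all add: pre_mult_def split_beta pcompose_1)
  have sm: "pre_mult s u (map_prod (smult c) (smult c) x) y = map_prod (smult c) (smult c) (pre_mult s u x y)"
    "pre_mult s u x (map_prod (smult c) (smult c) y) = map_prod (smult c) (smult c) (pre_mult s u x y)"
    for c x y
    by (simp_all add: pre_mult_def map_prod_def split_beta pcompose_smult smult_add_right mult.commute)
  have assoc: "x \<otimes>\<^bsub>?A\<^esub> y \<otimes>\<^bsub>?A\<^esub> z = x \<otimes>\<^bsub>?A\<^esub> (y \<otimes>\<^bsub>?A\<^esub> z)" for x y z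
  proof -
    have "cong2 s u (pre_mult s u (red2 s u (pre_mult s u x y)) z) (pre_mult s u (pre_mult s u x y) z)"
      by (intro pre_mult_cong cong2_refl cong2_sym[OF red2_self])
    moreover have "cong2 s u (pre_mult s u x (pre_mult s u y z)) (pre_mult s u x (red2 s u (pre_mult s u y z)))"
      by (intro pre_mult_cong cong2_refl red2_self)
    ultimately show ?thesis
      unfolding twisted_algebra_simps
      by (intro red2_cong) (metis cong2_trans pre_mult_assoc)
  qed
  have neg: "\<exists>y\<in>carrier ?A. y \<oplus>\<^bsub>?A\<^esub> x = \<zero>\<^bsub>?A\<^esub>" if "x \<in> carrier ?A" for x
    by (rule bexI[of _ "- x"]) (simp_all add: twisted_algebra_simps(4,5) twisted_algebra_closed that)
  note simps = twisted_algebra_simps(2-6)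
  have "assoc_algebra ?A"
  proof (rule assoc_algebraI)
    fix x y z
    show "x \<otimes>\<^bsub>?A\<^esub> y \<otimes>\<^bsub>?A\<^esub> z = x \<otimes>\<^bsub>?A\<^esub> (y \<otimes>\<^bsub>?A\<^esub> z)" by (rule assoc)
    show "x \<oplus>\<^bsub>?A\<^esub> y \<oplus>\<^bsub>?A\<^esub> z = x \<oplus>\<^bsub>?A\<^esub> (y \<oplus>\<^bsub>?A\<^esub> z)" by (simp add: simps add.assoc)
    show "x \<oplus>\<^bsub>?A\<^esub> y = y \<oplus>\<^bsub>?A\<^esub> x" by (simp add: simps add.commute)
    show "(x \<oplus>\<^bsub>?A\<^esub> y) \<otimes>\<^bsub>?A\<^esub> z = x \<otimes>\<^bsub>?A\<^esub> z \<oplus>\<^bsub>?A\<^esub> y \<otimes>\<^bsub>?A\<^esub> z"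
      by (simp only: simps pre_mult_add_left red2_add)
    show "z \<otimes>\<^bsub>?A\<^esub> (x \<oplus>\<^bsub>?A\<^esub> y) = z \<otimes>\<^bsub>?A\<^esub> x \<oplus>\<^bsub>?A\<^esub> z \<otimes>\<^bsub>?A\<^esub> y"
      by (simp only: simps pre_mult_add_right red2_add)
    fix c d
    show "(c + d) \<odot>\<^bsub>?A\<^esub> x = c \<odot>\<^bsub>?A\<^esub> x \<oplus>\<^bsub>?A\<^esub> d \<odot>\<^bsub>?A\<^esub> x"
      "c \<odot>\<^bsub>?A\<^esub> (x \<oplus>\<^bsub>?A\<^esub> y) = c \<odot>\<^bsub>?A\<^esub> x \<oplus>\<^bsub>?A\<^esub> c \<odot>\<^bsub>?A\<^esub> y"
      "(c * d) \<odot>\<^bsub>?A\<^esub> x = c \<odot>\<^bsub>?A\<^esub> (d \<odot>\<^bsub>?A\<^esub> x)" "1 \<odot>\<^bsub>?A\<^esub> x = x"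
      by (simp_all add: simps map_prod_def split_beta smult_add_left smult_add_right)
    show "(c \<odot>\<^bsub>?A\<^esub> x) \<otimes>\<^bsub>?A\<^esub> y = c \<odot>\<^bsub>?A\<^esub> (x \<otimes>\<^bsub>?A\<^esub> y)"
      "x \<otimes>\<^bsub>?A\<^esub> (c \<odot>\<^bsub>?A\<^esub> y) = c \<odot>\<^bsub>?A\<^esub> (x \<otimes>\<^bsub>?A\<^esub> y)"
      by (simp_all only: simps sm red2_smult)
  next
    fix x assume x: "x \<in> carrier ?A"
    show "\<zero>\<^bsub>?A\<^esub> \<oplus>\<^bsub>?A\<^esub> x = x" by (simp add: simps)
    show "\<one>\<^bsub>?A\<^esub> \<otimes>\<^bsub>?A\<^esub> x = x" "x \<otimes>\<^bsub>?A\<^esub> \<one>\<^bsub>?A\<^esub> = x"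
      using x by (simp_all only: simps one red2_id)
    show "\<exists>y\<in>carrier ?A. y \<oplus>\<^bsub>?A\<^esub> x = \<zero>\<^bsub>?A\<^esub>" by (rule neg[OF x])
  qed (simp_all only: simps twisted_algebra_closed red2_carrier)
  then show ?thesis
    by unfold_locales (simp_all add: twisted_algebra_simps)
qed

end


section \<open>Change of base ring\<close>

locale comm_ring_morphism =
  fixes \<phi> :: "'r::idom \<Rightarrow> 's::idom"
  assumes hom_1: "\<phi> 1 = 1" and hom_add: "\<phi> (x + y) = \<phi> x + \<phi> y"
    and hom_mult: "\<phi> (x * y) = \<phi> x * \<phi> y"
begin

lemma hom_0: "\<phi> 0 = 0"
  using hom_add[of 0 0] by (metis add_cancel_right_right add_0)

lemma hom_uminus: "\<phi> (- x) = - \<phi> x"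
  using hom_add[of x "- x"] hom_0 by (simp add: minus_unique)

lemma hom_diff: "\<phi> (x - y) = \<phi> x - \<phi> y"
  using hom_add[of x "- y"] hom_uminus by simp

lemma hom_power: "\<phi> (x ^ n) = \<phi> x ^ n"
  by (induction n) (simp_all add: hom_1 hom_mult)

lemma hom_sum: "\<phi> (sum f A) = (\<Sum>i\<in>A. \<phi> (f i))"
  by (induction A rule: infinite_finite_induct) (simp_all add: hom_0 hom_add)

lemma map_poly_hom_add: "map_poly \<phi> (p + q) = map_poly \<phi> p + map_poly \<phi> q"
  by (rule poly_eqI) (simp add: coeff_map_poly hom_0 hom_add)

lemma map_poly_hom_mult: "map_poly \<phi> (p * q) = map_poly \<phi> p * map_poly \<phi> q"
  by (rule poly_eqI) (simp add: coeff_map_poly hom_0 coeff_mult hom_sum hom_mult)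

lemma map_poly_hom_smult: "map_poly \<phi> (smult c p) = smult (\<phi> c) (map_poly \<phi> p)"
  by (rule poly_eqI) (simp add: coeff_map_poly hom_0 hom_mult)

lemma map_poly_hom_const: "map_poly \<phi> [:c:] = [:\<phi> c:]"
  by (rule poly_eqI) (simp add: coeff_map_poly hom_0 coeff_pCons split: nat.splits)

lemma map_poly_hom_pCons: "map_poly \<phi> (pCons c p) = pCons (\<phi> c) (map_poly \<phi> p)"
  by (rule poly_eqI) (simp add: coeff_map_poly hom_0 coeff_pCons split: nat.splits)

interpretation poly: comm_ring_morphism "map_poly \<phi>"
  by unfold_locales (simp_all add: hom_1 map_poly_hom_add map_poly_hom_mult)

lemma degree_map_poly_hom_le: "degree (map_poly \<phi> p) \<le> degree p"
  by (rule degree_le) (simp add: coeff_map_poly hom_0 coeff_eq_0)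

lemma map_poly_hom_pcompose: "map_poly \<phi> (pcompose p q) = pcompose (map_poly \<phi> p) (map_poly \<phi> q)"
  by (induction p)
    (simp_all add: pcompose_pCons map_poly_hom_pCons poly.hom_add poly.hom_mult map_poly_hom_const)

lemma map_poly_X: "map_poly \<phi> [:0, 1:] = [:0, 1:]"
  by (simp add: map_poly_hom_pCons hom_0 hom_1)

lemma map_poly_twist: "map_poly \<phi> (twist s u) = twist s (\<phi> u)"
  by (simp add: twist_def poly.hom_add poly.hom_power map_poly_X map_poly_hom_const hom_diff hom_power)

lemma map_poly_cofactor: "map_poly \<phi> (cofactor s u) = cofactor s (\<phi> u)"
  by (simp add: cofactor_def poly.hom_add poly.hom_sum poly.hom_mult poly.hom_power poly.hom_1
      map_poly_X map_poly_twist)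

lemma map_poly_modulus: "map_poly \<phi> (modulus s u) = modulus s (\<phi> u)"
proof -
  have "map_poly \<phi> ([:- u, 1:] * modulus s u) =
      tw_hom s (\<phi> u) (twist s (\<phi> u)) - [:0, 1:]"
    unfolding modulus_eq
    by (simp only: poly.hom_diff map_poly_hom_pcompose map_poly_twist map_poly_X)
  moreover have "map_poly \<phi> ([:- u, 1:] * modulus s u) = [:- \<phi> u, 1:] * map_poly \<phi> (modulus s u)"
    by (simp only: poly.hom_mult map_poly_hom_pCons map_poly_hom_const hom_uminus hom_1 map_poly_0)
  ultimately have "[:- \<phi> u, 1:] * map_poly \<phi> (modulus s u) = [:- \<phi> u, 1:] * modulus s (\<phi> u)"
    unfolding modulus_eq[of "\<phi> u"] by simp
  moreover have "[:- \<phi> u, 1:] \<noteq> 0" by simp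
  ultimately show ?thesis by (metis mult_left_cancel)
qed

definition base_change :: "'r poly \<times> 'r poly \<Rightarrow> 's poly \<times> 's poly" where
  "base_change = map_prod (map_poly \<phi>) (map_poly \<phi>)"

context
  fixes s :: nat
  assumes s: "s > 1"
begin

lemma map_poly_red: "map_poly \<phi> (red s u p) = red s (\<phi> u) (map_poly \<phi> p)"
proof (rule reduced_unique[OF s])
  have "modulus s (\<phi> u) dvd map_poly \<phi> (p - red s u p)"
    using red_dvd[OF s, of u p] by (auto simp: map_poly_modulus[symmetric] poly.hom_mult elim!: dvdE)
  moreover have "map_poly \<phi> (red s u p) - red s (\<phi> u) (map_poly \<phi> p) =
      (map_poly \<phi> p - red s (\<phi> u) (map_poly \<phi> p)) - map_poly \<phi> (p - red s u p)"
    by (simp add: poly.hom_diff)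
  ultimately show "modulus s (\<phi> u) dvd map_poly \<phi> (red s u p) - red s (\<phi> u) (map_poly \<phi> p)"
    using red_dvd[OF s] by (metis dvd_diff)
  show "degree (map_poly \<phi> (red s u p)) < s\<^sup>2 - 1"
    using degree_red[OF s] degree_map_poly_hom_le le_less_trans by blast
qed (rule degree_red[OF s])

lemma base_change_closed:
  "z \<in> carrier (twisted_algebra s u) \<Longrightarrow> base_change z \<in> carrier (twisted_algebra s (\<phi> u))"
  by (auto simp: twisted_algebra_simps base_change_def intro: le_less_trans[OF degree_map_poly_hom_le])

lemma base_change_add: "base_change (z + w) = base_change z + base_change w"
  by (cases z, cases w) (simp add: base_change_def poly.hom_add)

lemma base_change_smult:
  "base_change (map_prod (smult c) (smult c) z) = map_prod (smult (\<phi> c)) (smult (\<phi> c)) (base_change z)"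
  by (cases z) (simp add: base_change_def map_poly_hom_smult)

lemma base_change_one: "base_change (1, 0) = (1, 0)"
  by (simp add: base_change_def hom_1)

lemma base_change_mult:
  "base_change (z \<otimes>\<^bsub>twisted_algebra s u\<^esub> w) =
     base_change z \<otimes>\<^bsub>twisted_algebra s (\<phi> u)\<^esub> base_change w"
  by (cases z, cases w)
    (simp add: twisted_algebra_simps base_change_def red2_def pre_mult_def map_poly_red poly.hom_add
      poly.hom_mult map_poly_hom_pcompose map_poly_twist map_poly_hom_smult map_poly_cofactor
      del: mult_smult_left mult_smult_right)

end

end


section \<open>The monomial basis\<close>

definition basis_index :: "nat \<Rightarrow> (int \<times> int) set" where
  "basis_index s = {0..<int (s\<^sup>2 - 1)} \<times> {0, 1}"

definition monomial :: "int \<times> int \<Rightarrow> 'r::idom poly \<times> 'r poly" where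
  "monomial = (\<lambda>(i, h). if h = 0 then (monom 1 (nat i), 0) else (0, monom 1 (nat i)))"

definition coordinate :: "int \<times> int \<Rightarrow> 'r::idom poly \<times> 'r poly \<Rightarrow> 'r" where
  "coordinate = (\<lambda>(i, h) z. coeff (if h = 0 then fst z else snd z) (nat i))"

lemma coordinate_add: "coordinate i (z + w) = coordinate i z + coordinate i w"
  by (cases i) (simp add: coordinate_def)

lemma coordinate_monomial:
  "i \<in> basis_index s \<Longrightarrow> k \<in> basis_index s \<Longrightarrow>
     coordinate i (map_prod (smult c) (smult c) (monomial k)) = (if i = k then c else 0)"
  by (auto simp: basis_index_def coordinate_def monomial_def eq_nat_nat_iff simp del: of_nat_diff split: if_splits)

lemma monomial_closed: "i \<in> basis_index s \<Longrightarrow> monomial i \<in> carrier (twisted_algebra s u)"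
  by (auto simp: basis_index_def monomial_def twisted_algebra_simps degree_monom_eq simp del: of_nat_diff)

lemma monomial_expansion:
  assumes "z \<in> carrier (twisted_algebra s u)"
  shows "z = (\<Sum>i\<in>basis_index s. map_prod (smult (coordinate i z)) (smult (coordinate i z)) (monomial i))"
proof -
  let ?n = "s\<^sup>2 - 1"
  have p: "(\<Sum>i\<in>{0..<int ?n}. monom (coeff p (nat i)) (nat i)) = p" if "degree p < ?n" for p :: "'a poly"
  proof -
    have "(\<Sum>i\<in>{0..<int ?n}. monom (coeff p (nat i)) (nat i)) = (\<Sum>i<?n. monom (coeff p i) i)"
      by (rule sum.reindex_bij_witness[of _ int nat]) (auto simp del: of_nat_diff)
    also have "\<dots> = (\<Sum>i\<le>?n - 1. monom (coeff p i) i)"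
      by (rule sum.cong) (use that in auto)
    also have "\<dots> = p" by (rule poly_as_sum_of_monoms') (use that in simp)
    finally show ?thesis .
  qed
  have pair: "sum f A = (\<Sum>i\<in>A. fst (f i), \<Sum>i\<in>A. snd (f i))"
    for f :: "int \<Rightarrow> 'a poly \<times> 'a poly" and A
    by (induction A rule: infinite_finite_induct) (auto simp: zero_prod_def plus_prod_def)
  have "(\<Sum>i\<in>basis_index s. map_prod (smult (coordinate i z)) (smult (coordinate i z)) (monomial i)) =
      (\<Sum>i\<in>{0..<int ?n}. (monom (coeff (fst z) (nat i)) (nat i), monom (coeff (snd z) (nat i)) (nat i)))"
    unfolding basis_index_def
    by (subst sum.cartesian_product') (simp add: coordinate_def monomial_def smult_monom)
  also have "\<dots> = z"
    using assms by (cases z) (simp add: pair p[unfolded One_nat_def] twisted_algebra_simps)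
  finally show ?thesis by simp
qed

lemma (in typed_algebra) spansI:
  assumes I: "finite I" "I \<noteq> {}" and e: "\<And>i. i \<in> I \<Longrightarrow> e i \<in> carrier N"
    and x: "\<And>x. x \<in> carrier N \<Longrightarrow> \<exists>c. x = (\<Sum>i\<in>I. c i \<odot> e i)"
  shows "spans N I e"
  unfolding spans_def
proof (intro allI impI subsetI)
  fix U x assume U: "(\<forall>i\<in>I. \<forall>c. c \<odot> e i \<in> U) \<and> (\<forall>x\<in>U \<inter> carrier N. \<forall>y\<in>U \<inter> carrier N. x \<oplus> y \<in> U)"
    and "x \<in> carrier N"
  then obtain c where "x = (\<Sum>i\<in>I. c i \<odot> e i)" using x by blast
  moreover have "(\<Sum>i\<in>J. c i \<odot> e i) \<in> U \<inter> carrier N" if "finite J" "J \<noteq> {}" "J \<subseteq> I" for J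
    using that
  proof (induction J rule: finite_ne_induct)
    case (insert i J)
    then have 1: "(\<Sum>i\<in>J. c i \<odot> e i) \<in> U \<inter> carrier N" and 2: "c i \<odot> e i \<in> U \<inter> carrier N"
      using U e smult_closed by auto
    have "c i \<odot> e i \<oplus> (\<Sum>i\<in>J. c i \<odot> e i) \<in> U \<inter> carrier N"
      using U 1 2 a_closed by blast
    then show ?case using insert.hyps by (simp add: add_eq)
  qed (use U e smult_closed in auto)
  ultimately show "x \<in> U" using I by blast
qed

context
  fixes s :: nat
  assumes s: "s > 1"
begin

lemma finite_basis_index: "finite (basis_index s)"
  by (simp add: basis_index_def)

lemma spans_monomial: "spans (twisted_algebra s u) (basis_index s) monomial"
proof -
  interpret typed_algebra "twisted_algebra s u" by (rule typed_algebra_twisted_algebra[OF s])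
  have "(0, 0) \<in> basis_index s" using s2_gt[OF s] by (simp add: basis_index_def del: of_nat_diff)
  then have "basis_index s \<noteq> {}" by blast
  moreover have "\<exists>c. x = (\<Sum>i\<in>basis_index s. c i \<odot>\<^bsub>twisted_algebra s u\<^esub> monomial i)"
    if "x \<in> carrier (twisted_algebra s u)" for x
    unfolding twisted_algebra_simps(6)
    by (rule exI[of _ "\<lambda>i. coordinate i x"]) (rule monomial_expansion[OF that])
  ultimately show ?thesis
    by (intro spansI finite_basis_index monomial_closed)
qed

text \<open>Applying \<open>\<phi>\<close> to coefficients is a homomorphism over \<open>\<phi>\<close>, because all the data of the family
  are built from \<open>u\<close> by ring operations, and it carries the monomials to the monomials.  Hence
  \<open>extend_scalars_free\<close> applies.\<close>

theorem extend_scalars_twisted_algebra: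
  fixes M :: "('r::idom, 'a) module" and \<phi> :: "'r \<Rightarrow> 's::idom"
  assumes "comm_ring_morphism \<phi>" and M: "assoc_algebra M" and iso: "algebra_iso M (twisted_algebra s u)"
  shows "assoc_algebra (extend_scalars \<phi> M)"
    and "algebra_iso (extend_scalars \<phi> M) (twisted_algebra s (\<phi> u))"
proof -
  interpret comm_ring_morphism \<phi> by fact
  let ?A = "twisted_algebra s u" and ?B = "twisted_algebra s (\<phi> u)" and ?I = "basis_index s"
  obtain h where h: "bij_betw h (carrier M) (carrier ?A)" 
    "\<And>x y. x \<in> carrier M \<Longrightarrow> y \<in> carrier M \<Longrightarrow> h (x \<otimes>\<^bsub>M\<^esub> y) = h x \<otimes>\<^bsub>?A\<^esub> h y"
    "\<And>x y. x \<in> carrier M \<Longrightarrow> y \<in> carrier M \<Longrightarrow> h (x \<oplus>\<^bsub>M\<^esub> y) = h x \<oplus>\<^bsub>?A\<^esub> h y"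
    "h \<one>\<^bsub>M\<^esub> = \<one>\<^bsub>?A\<^esub>"
    "\<And>c x. x \<in> carrier M \<Longrightarrow> h (c \<odot>\<^bsub>M\<^esub> x) = c \<odot>\<^bsub>?A\<^esub> h x"
    using iso by (rule algebra_isoE) blast
  have hc: "h x \<in> carrier ?A" if "x \<in> carrier M" for x using h(1) that by (rule bij_betw_apply)
  have inj: "x = y" if "h x = h y" "x \<in> carrier M" "y \<in> carrier M" for x y
    using h(1) that by (auto simp: bij_betw_def inj_on_def)
  define e where "e = (\<lambda>i. inv_into (carrier M) h (monomial i))"
  have e: "e i \<in> carrier M" and he: "h (e i) = monomial i" if "i \<in> ?I" for i
    using h(1) monomial_closed[OF that, of u] unfolding e_def bij_betw_def
    by (auto intro: inv_into_into f_inv_into_f)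
  define j where "j = (\<lambda>x. base_change (h x))"
  have je: "j (e i) = monomial i" if "i \<in> ?I" for i
    using that by (auto simp: j_def he base_change_def monomial_def map_poly_monom hom_0 hom_1 split: prod.split)
  have "spans ?A ?I (\<lambda>i. h (e i))"
    using spans_monomial by (simp add: spans_def he)
  with e have span: "spans M ?I e"
    by (intro spans_transfer[OF M h(1,3,5)])
  have span2: "spans ?B ?I (\<lambda>i. j (e i))"
    using spans_monomial[of "\<phi> u"] by (simp add: spans_def je)
  have props: "\<And>x. x \<in> carrier M \<Longrightarrow> j x \<in> carrier ?B"
    "\<And>x y. x \<in> carrier M \<Longrightarrow> y \<in> carrier M \<Longrightarrow> j (x \<oplus>\<^bsub>M\<^esub> y) = j x + j y"
    "\<And>x y. x \<in> carrier M \<Longrightarrow> y \<in> carrier M \<Longrightarrow> j (x \<otimes>\<^bsub>M\<^esub> y) = j x \<otimes>\<^bsub>?B\<^esub> j y"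
    "j \<one>\<^bsub>M\<^esub> = \<one>\<^bsub>?B\<^esub>"
    "\<And>r x. x \<in> carrier M \<Longrightarrow> j (r \<odot>\<^bsub>M\<^esub> x) = \<phi> r \<odot>\<^bsub>?B\<^esub> j x"
    using hc
    by (simp_all add: j_def h base_change_closed[OF s] base_change_mult[OF s]
        twisted_algebra_simps(3,5,6) base_change_add[OF s] base_change_one[OF s] base_change_smult[OF s])
  have coord: "\<And>i x y. coordinate i (x + y) = coordinate i x + coordinate i y"
    "\<And>i k c. i \<in> ?I \<Longrightarrow> k \<in> ?I \<Longrightarrow> coordinate i (c \<odot>\<^bsub>?B\<^esub> j (e k)) = (if i = k then c else 0)"
    by (simp_all add: coordinate_add coordinate_monomial[of _ s] je twisted_algebra_simps(6))
  note * = M typed_algebra_twisted_algebra[OF s] props finite_basis_index e span span2 coord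
  show "assoc_algebra (extend_scalars \<phi> M)"
    by (rule extend_scalars_free(1)[where \<kappa> = coordinate and N = ?B, OF *])
  show "algebra_iso (extend_scalars \<phi> M) ?B"
    by (rule extend_scalars_free(2)[where \<kappa> = coordinate and N = ?B, OF *])
qed

end


section \<open>The group algebra\<close>

lemma pcompose_monom_monom: "pcompose (monom (1 :: 'r::idom) j) (monom 1 s) = monom 1 (s * j)"
  by (simp add: monom_altdef[of 1 j] pcompose_power pcompose_X monom_power)

context
  fixes s :: nat
  assumes s: "s > 1"
begin

lemma twist_0: "twist s (0 :: 'r::idom) = monom 1 s"
  using s by (simp add: twist_def monom_altdef)

lemma modulus_0: "modulus s (0 :: 'r::idom) = monom 1 (s\<^sup>2 - 1) - 1"
proof -
  have "s\<^sup>2 = Suc (s\<^sup>2 - 1)" using s by simp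
  then have "monom (1 :: 'r) (s\<^sup>2) = pCons 0 (monom 1 (s\<^sup>2 - 1))" by (metis monom_Suc)
  then have "[:0, 1:] * (monom 1 (s\<^sup>2 - 1) - 1 :: 'r poly) = monom 1 (s\<^sup>2) - [:0, 1:]"
    by (simp add: one_pCons)
  moreover have "[:0, 1:] * modulus s (0 :: 'r) = monom 1 (s\<^sup>2) - [:0, 1:]"
    using modulus_eq[of "0 :: 'r" s] s
    by (simp add: twist_0 pcompose_monom_monom power2_eq_square)
  ultimately have "[:0, 1:] * modulus s (0 :: 'r) = [:0, 1:] * (monom 1 (s\<^sup>2 - 1) - 1)" by simp
  then show ?thesis by (metis mult_left_cancel pCons_eq_0_iff one_neq_zero)
qed

lemma red_0_monom: "red s (0 :: 'r::idom) (monom 1 m) = monom 1 (m mod (s\<^sup>2 - 1))"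
proof -
  let ?n = "s\<^sup>2 - 1" and ?x = "[:0, 1:] :: 'r poly"
  have m: "monom 1 k = ?x ^ k" for k by (simp add: monom_altdef)
  have "m = ?n * (m div ?n) + m mod ?n" by simp
  then have "?x ^ m = (?x ^ ?n) ^ (m div ?n) * ?x ^ (m mod ?n)"
    by (metis power_add power_mult)
  then have "?x ^ m - ?x ^ (m mod ?n) = ((?x ^ ?n) ^ (m div ?n) - 1) * ?x ^ (m mod ?n)"
    by (simp add: algebra_simps)
  moreover have "?x ^ ?n - 1 dvd (?x ^ ?n) ^ (m div ?n) - 1"
    using pcompose_diff_dvd[of "?x ^ ?n" 1 "?x ^ (m div ?n)"] by (simp add: pcompose_power pcompose_X)
  ultimately have "modulus s 0 dvd monom 1 m - monom (1 :: 'r) (m mod ?n)"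
    by (simp add: modulus_0 m)
  then have "red s 0 (monom 1 m) = red s 0 (monom (1 :: 'r) (m mod ?n))" by (rule red_cong[OF s])
  also have "\<dots> = monom 1 (m mod ?n)"
    using s2_gt[OF s] by (intro red_id[OF s]) (simp add: degree_monom_eq)
  finally show ?thesis .
qed

lemma carrier_group_G: "carrier (group_G s) = basis_index s"
  using s2_gt[OF s]
  by (auto simp: group_G_def semidirect_product_def basis_index_def carrier_integer_mod_group
      simp del: of_nat_diff)

lemma mult_group_G:
  assumes "(i, h) \<in> basis_index s" "(j, h') \<in> basis_index s"
  shows "(i, h) \<otimes>\<^bsub>group_G s\<^esub> (j, h') =
    ((i + int s ^ nat h * j) mod int (s\<^sup>2 - 1), (h + h') mod 2)"
proof -
  have "j \<in> carrier (integer_mod_group (s\<^sup>2 - 1))"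
    using assms s2_gt[OF s] by (auto simp: basis_index_def carrier_integer_mod_group simp del: of_nat_diff)
  then show ?thesis
    by (simp add: group_G_def semidirect_product_def \<xi>_action_def mod_simps del: of_nat_diff)
qed

lemma one_group_G: "\<one>\<^bsub>group_G s\<^esub> = (0, 0)"
  by (simp add: group_G_def semidirect_product_def)

lemma mult_group_G_closed:
  assumes "g \<in> basis_index s" "g' \<in> basis_index s"
  shows "g \<otimes>\<^bsub>group_G s\<^esub> g' \<in> basis_index s"
  using assms s2_gt[OF s] mult_group_G[of "fst g" "snd g" "fst g'" "snd g'"]
  by (auto simp: basis_index_def simp del: of_nat_diff)

text \<open>At parameter \<open>0\<close> the twist is \<open>X \<mapsto> X\<^sup>s\<close>, the modulus is \<open>X\<^sup>n - 1\<close> and \<open>y\<^sup>2 = 1\<close>, so that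
  \<open>X\<close> and \<open>y\<close> satisfy the relations of \<open>\<sigma>\<close> and \<open>\<tau>\<close>.\<close>

lemma monomial_mult:
  assumes g: "g \<in> basis_index s" "g' \<in> basis_index s"
  shows "monomial (g \<otimes>\<^bsub>group_G s\<^esub> g') =
    monomial g \<otimes>\<^bsub>twisted_algebra s (0 :: 'r::idom)\<^esub> monomial g'"
proof -
  let ?n = "s\<^sup>2 - 1"
  obtain i h j h' where gg: "g = (i, h)" "g' = (j, h')" by (cases g, cases g') auto
  have ij: "i \<ge> 0" "j \<ge> 0" and hh: "h = 0 \<or> h = 1" "h' = 0 \<or> h' = 1"
    using g by (auto simp: gg basis_index_def)
  have nat: "nat ((i + int s ^ k * j) mod int ?n) = (nat i + s ^ k * nat j) mod ?n" for k
    using ij by (simp add: nat_mod_distrib nat_add_distrib nat_mult_distrib nat_power_eq del: of_nat_diff)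
  have r: "red s (0 :: 'r) (monom 1 a * monom 1 b) = monom 1 ((a + b) mod ?n)" for a b
    by (simp add: mult_monom red_0_monom)
  have r0: "red s (0 :: 'r) 0 = 0" by (rule red_id[OF s]) (use s2_gt[OF s] in simp)
  have gg': "g \<otimes>\<^bsub>group_G s\<^esub> g' = ((i + int s ^ nat h * j) mod int ?n, (h + h') mod 2)"
    unfolding gg by (rule mult_group_G) (use g in \<open>simp_all add: gg\<close>)
  note simps = twisted_algebra_simps red2_def pre_mult_def
    monomial_def r r0 nat[of 0, simplified power_0 mult_1] nat[of 1, simplified power_one_right] pcompose_monom_monom twist_0
  from hh show ?thesis
    unfolding gg'
    by (elim disjE) (simp_all add: gg simps del: of_nat_diff One_nat_def)
qed

lemma coordinate_sum: "coordinate i (sum f A) = (\<Sum>k\<in>A. coordinate i (f k))"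
  by (induction A rule: infinite_finite_induct)
    (simp_all add: coordinate_add, simp_all add: coordinate_def split_beta zero_prod_def)

theorem group_algebra_twisted_algebra:
  shows "assoc_algebra (group_algebra (group_G s) :: ('k::field, int \<times> int \<Rightarrow>\<^sub>0 'k) module)"
    and "algebra_iso (group_algebra (group_G s) :: ('k::field, int \<times> int \<Rightarrow>\<^sub>0 'k) module)
           (twisted_algebra s 0)"
proof -
  let ?A = "group_algebra (group_G s) :: ('k, int \<times> int \<Rightarrow>\<^sub>0 'k) module"
  let ?N = "twisted_algebra s (0 :: 'k)" and ?I = "basis_index s"
  interpret N: typed_algebra ?N by (rule typed_algebra_twisted_algebra[OF s])
  let ?h = "N.lin_ext monomial"
  have cA: "carrier ?A = {f. Poly_Mapping.keys f \<subseteq> ?I}"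
    by (simp add: group_algebra_def carrier_group_G)
  have A: "\<zero>\<^bsub>?A\<^esub> = 0" "add ?A = (+)" "\<one>\<^bsub>?A\<^esub> = Poly_Mapping.single (0, 0) 1"
    "c \<odot>\<^bsub>?A\<^esub> f = Poly_Mapping.map ((*) c) f" for c f
    by (simp_all add: group_algebra_def one_group_G)
  have lookup_smult: "Poly_Mapping.lookup (Poly_Mapping.map ((*) c) f) i = c * Poly_Mapping.lookup f i"
    for c i and f :: "int \<times> int \<Rightarrow>\<^sub>0 'k"
    by (simp add: Poly_Mapping.map.rep_eq when_def)
  have keys_smult: "Poly_Mapping.keys (Poly_Mapping.map ((*) c) f) \<subseteq> Poly_Mapping.keys f"
    for c and f :: "int \<times> int \<Rightarrow>\<^sub>0 'k"
    by (auto simp: in_keys_iff lookup_smult)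
  have h: "?h f = (\<Sum>i\<in>?I. map_prod (smult (Poly_Mapping.lookup f i)) (smult (Poly_Mapping.lookup f i)) (monomial i))"
    if "f \<in> carrier ?A" for f
    using that by (subst N.lin_ext_superset[of ?I])
      (auto simp: cA finite_basis_index[OF s] monomial_closed twisted_algebra_simps(6))
  have h': "?h f = (\<Sum>i\<in>?I. Poly_Mapping.lookup f i \<odot>\<^bsub>?N\<^esub> monomial i)" if "f \<in> carrier ?A" for f
    using h[OF that] by (simp add: twisted_algebra_simps(6))
  have hc: "?h f \<in> carrier ?N" if "f \<in> carrier ?A" for f
    by (rule N.lin_ext_closed) (use that in \<open>auto simp: cA monomial_closed\<close>)
  have coord: "coordinate i (?h f) = Poly_Mapping.lookup f i" if "f \<in> carrier ?A" "i \<in> ?I" for f i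
    using that by (simp add: h coordinate_sum coordinate_monomial[of _ s] finite_basis_index[OF s])
  have bij: "bij_betw ?h (carrier ?A) (carrier ?N)"
    unfolding bij_betw_def
  proof
    show "inj_on ?h (carrier ?A)"
    proof (rule inj_onI)
      fix f f' assume f: "f \<in> carrier ?A" "f' \<in> carrier ?A" "?h f = ?h f'"
      have "Poly_Mapping.lookup f i = Poly_Mapping.lookup f' i" for i
      proof (cases "i \<in> ?I")
        case True
        then show ?thesis using coord f by metis
      next
        case False
        then have "i \<notin> Poly_Mapping.keys f" "i \<notin> Poly_Mapping.keys f'" using f cA by auto
        then show ?thesis by (simp add: in_keys_iff)
      qed
      then show "f = f'" by (rule poly_mapping_eqI)
    qed
    show "?h ` carrier ?A = carrier ?N"
    proof
      show "carrier ?N \<subseteq> ?h ` carrier ?A"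
      proof
        fix z assume z: "z \<in> carrier ?N"
        define f where "f = (\<Sum>i\<in>?I. Poly_Mapping.single i (coordinate i z))"
        have "Poly_Mapping.keys f \<subseteq> ?I"
          using Poly_Mapping.keys_sum[of "\<lambda>i. Poly_Mapping.single i (coordinate i z)" ?I]
          by (auto simp: f_def split: if_splits)
        then have f: "f \<in> carrier ?A" by (simp add: cA)
        have "Poly_Mapping.lookup f i = coordinate i z" if "i \<in> ?I" for i
          using that by (simp add: f_def lookup_sum lookup_single when_def finite_basis_index[OF s])
        then have "?h f = z"
          using monomial_expansion[OF z] by (simp add: h[OF f])
        then show "z \<in> ?h ` carrier ?A" using f by blast
      qed
    qed (use hc in auto)
  qed
  have k: "monomial g \<in> carrier ?N" if "f \<in> carrier ?A" "g \<in> Poly_Mapping.keys f" for f g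
    using that by (auto simp: cA monomial_closed)
  have add: "?h (f \<oplus>\<^bsub>?A\<^esub> f') = ?h f \<oplus>\<^bsub>?N\<^esub> ?h f'" if "f \<in> carrier ?A" "f' \<in> carrier ?A" for f f'
    unfolding A N.add_eq by (rule N.lin_ext_add) (use that k in blast)+
  have mult: "?h (f \<otimes>\<^bsub>?A\<^esub> f') = ?h f \<otimes>\<^bsub>?N\<^esub> ?h f'" if "f \<in> carrier ?A" "f' \<in> carrier ?A" for f f'
    by (rule N.lin_ext_mult)
      (use that in \<open>auto simp: carrier_group_G mult_group_G_closed monomial_closed monomial_mult cA\<close>)
  have z: "(0, 0) \<in> ?I" using s2_gt[OF s] by (simp add: basis_index_def del: of_nat_diff)
  have one: "?h \<one>\<^bsub>?A\<^esub> = \<one>\<^bsub>?N\<^esub>"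
    using N.lin_ext_single[of monomial "(0, 0)" 1] monomial_closed[OF z, of 0]
    by (simp add: A twisted_algebra_simps monomial_def)
  have smult: "?h (c \<odot>\<^bsub>?A\<^esub> f) = c \<odot>\<^bsub>?N\<^esub> ?h f" if f: "f \<in> carrier ?A" for c f
  proof -
    have cf: "c \<odot>\<^bsub>?A\<^esub> f \<in> carrier ?A" using f keys_smult by (auto simp: A cA)
    have "c \<odot>\<^bsub>?N\<^esub> ?h f = (\<Sum>i\<in>?I. c \<odot>\<^bsub>?N\<^esub> (Poly_Mapping.lookup f i \<odot>\<^bsub>?N\<^esub> monomial i))"
      unfolding h'[OF f]
      by (rule N.smult_sum) (simp add: N.smult_closed monomial_closed)
    also have "\<dots> = ?h (c \<odot>\<^bsub>?A\<^esub> f)"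
      unfolding h'[OF cf]
      by (rule sum.cong) (simp_all add: A lookup_smult N.smult_assoc monomial_closed)
    finally show ?thesis ..
  qed
  show "algebra_iso ?A ?N" by (rule algebra_isoI[OF bij mult add one smult])
  show "assoc_algebra ?A"
  proof (rule assoc_algebra_transfer[OF N.assoc bij mult add one _ smult])
    show "f \<otimes>\<^bsub>?A\<^esub> f' \<in> carrier ?A" if "f \<in> carrier ?A" "f' \<in> carrier ?A" for f f'
      using that group_algebra_mult_closed[of "group_G s" f f'] mult_group_G_closed
      by (simp add: cA carrier_group_G)
    show "f \<oplus>\<^bsub>?A\<^esub> f' \<in> carrier ?A" if "f \<in> carrier ?A" "f' \<in> carrier ?A" for f f'
      using that Poly_Mapping.keys_add[of f f'] by (auto simp: cA A)
    show "c \<odot>\<^bsub>?A\<^esub> f \<in> carrier ?A" if "f \<in> carrier ?A" for c f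
      using that keys_smult[of c f] by (auto simp: cA A)
    show "?h \<zero>\<^bsub>?A\<^esub> = \<zero>\<^bsub>?N\<^esub>" by (simp add: A N.lin_ext_zero N.zero_eq)
    show "\<one>\<^bsub>?A\<^esub> \<in> carrier ?A" "\<zero>\<^bsub>?A\<^esub> \<in> carrier ?A" using z by (auto simp: A cA)
  qed
qed

end


section \<open>The operators of multiplication by polynomials and by y\<close>

text \<open>For the averaging arguments the algebra is viewed as \<open>K[X]\<^sup>2\<close> modulo \<open>\<pi> K[X]\<^sup>2\<close>.  Left
  multiplication by a polynomial and by \<open>y\<close> then are operators on \<open>K[X]\<^sup>2\<close> without any reduction, and
  reduction is postponed to the congruences between them.\<close>

definition act :: "'r::idom poly \<Rightarrow> 'r poly \<times> 'r poly \<Rightarrow> 'r poly \<times> 'r poly" where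
  "act d z = (d * fst z, d * snd z)"

definition yact :: "nat \<Rightarrow> 'r::idom \<Rightarrow> 'r poly \<times> 'r poly \<Rightarrow> 'r poly \<times> 'r poly" where
  "yact s u z =
     (tw_hom s u (snd z), tw_hom s u (fst z) + smult u (cofactor s u) * tw_hom s u (snd z))"

lemma pre_mult_eq: "pre_mult s u z w = act (fst z) w + act (snd z) (yact s u w)"
  by (simp add: pre_mult_def act_def yact_def split_beta smult_add_right algebra_simps)

lemma act_add: "act d (z + w) = act d z + act d w"
  by (simp add: act_def plus_prod_def distrib_left)

lemma act_add_left: "act (d + e) z = act d z + act e z"
  by (simp add: act_def distrib_right)

lemma act_act: "act d (act e z) = act (d * e) z"
  by (simp add: act_def mult.assoc)

lemma act_1: "act 1 z = z"
  by (simp add: act_def)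

lemma act_0: "act 0 z = 0"
  by (simp add: act_def zero_prod_def)

lemma act_diff: "act d (z - w) = act d z - act d w"
  by (simp add: act_def algebra_simps)

lemma act_sum: "act d (sum f A) = (\<Sum>i\<in>A. act d (f i))"
  by (induction A rule: infinite_finite_induct) (simp_all add: act_add, simp_all add: act_def zero_prod_def)

lemma act_sum_left: "act (sum f A) z = (\<Sum>i\<in>A. act (f i) z)"
  by (induction A rule: infinite_finite_induct) (simp_all add: act_add_left act_0)

lemma act_const: "act [:c:] z = map_prod (smult c) (smult c) z"
  by (cases z) (simp add: act_def)

lemma yact_add: "yact s u (z + w) = yact s u z + yact s u w"
  by (simp add: yact_def plus_prod_def pcompose_add algebra_simps smult_add_right)

lemma yact_act: "yact s u (act d z) = act (tw_hom s u d) (yact s u z)"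
  by (simp add: yact_def act_def pcompose_mult algebra_simps smult_add_right)

lemma cong2_add: "cong2 s u z z' \<Longrightarrow> cong2 s u w w' \<Longrightarrow> cong2 s u (z + w) (z' + w')"
  by (auto simp: cong2_def intro: dvd_add_diff)

lemma cong2_act: "modulus s u dvd d - d' \<Longrightarrow> cong2 s u z z' \<Longrightarrow> cong2 s u (act d z) (act d' z')"
  by (auto simp: cong2_def act_def intro: dvd_mult_diff)

lemma cong2_yact: "cong2 s u z z' \<Longrightarrow> cong2 s u (yact s u z) (yact s u z')"
  by (auto simp: cong2_def yact_def simp del: mult_smult_left mult_smult_right
      intro!: dvd_add_diff dvd_mult_diff tw_hom_cong)

lemma cong2_zeroD:
  assumes "cong2 s u z 0"
  obtains w where "z = act (modulus s u) w"
proof -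
  obtain a b where "fst z = modulus s u * a" "snd z = modulus s u * b"
    using assms by (auto simp: cong2_def elim!: dvdE)
  then have "z = act (modulus s u) (a, b)" by (simp add: act_def prod_eq_iff)
  then show ?thesis by (rule that)
qed

lemma cong2_act_modulus: "cong2 s u (act (modulus s u) z) 0"
  by (simp add: cong2_def act_def)

lemma cong2_diff_iff: "cong2 s u z w \<longleftrightarrow> cong2 s u (z - w) 0"
  by (simp add: cong2_def)

lemma tw_hom_cofactor_smult:
  "modulus s u dvd smult u (cofactor s u) * (tw_hom s u p - p)"
  "modulus s u dvd tw_hom s u (smult u (cofactor s u)) - smult u (cofactor s u)"
  using dvd_smult[OF cofactor_tw_hom[of s u p], of u] dvd_smult[OF tw_hom_cofactor[of s u], of u]
  by (simp_all add: pcompose_smult smult_diff_right)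

lemma yact_yact:
  "cong2 s u (yact s u (yact s u z)) (z + act (smult u (cofactor s u)) (yact s u z))"
proof -
  obtain p q where z: "z = (p, q)" by (cases z)
  define \<eta> where "\<eta> = tw_hom s u"
  define b where "b = smult u (cofactor s u)"
  have b: "modulus s u dvd b * (\<eta> r - r)" "modulus s u dvd \<eta> b - b" for r
    unfolding b_def \<eta>_def by (rule tw_hom_cofactor_smult)+
  have i: "modulus s u dvd \<eta> (\<eta> r) - r" for r
    unfolding \<eta>_def by (rule tw_hom_tw_hom)
  have \<eta>: "\<eta> (r + t) = \<eta> r + \<eta> t" "\<eta> (r * t) = \<eta> r * \<eta> t" for r t
    by (simp_all add: \<eta>_def pcompose_add pcompose_mult)
  have y: "yact s u (r, t) = (\<eta> t, \<eta> r + b * \<eta> t)" for r t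
    by (simp only: yact_def \<eta>_def b_def fst_conv snd_conv)
  have "\<eta> (\<eta> p + b * \<eta> q) - (p + b * \<eta> q) =
      (\<eta> (\<eta> p) - p) + ((\<eta> b - b) * \<eta> (\<eta> q) + b * (\<eta> (\<eta> q) - \<eta> q))"
    by (simp add: \<eta> algebra_simps)
  then have 1: "modulus s u dvd \<eta> (\<eta> p + b * \<eta> q) - (p + b * \<eta> q)"
    by (metis b i dvd_add dvd_mult2)
  have "\<eta> (\<eta> q) + b * \<eta> (\<eta> p + b * \<eta> q) - (q + b * (\<eta> p + b * \<eta> q)) =
      (\<eta> (\<eta> q) - q) + b * (\<eta> (\<eta> p + b * \<eta> q) - (\<eta> p + b * \<eta> q))"
    by (simp add: algebra_simps)
  then have 2: "modulus s u dvd \<eta> (\<eta> q) + b * \<eta> (\<eta> p + b * \<eta> q) - (q + b * (\<eta> p + b * \<eta> q))"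
    using b i by (metis dvd_add)
  show ?thesis
    using 1 2 by (simp add: z y cong2_def act_def b_def[symmetric])
qed


section \<open>Coprimality over an algebraically closed field of characteristic two\<close>

text \<open>A nonzero combination of least degree divides both polynomials, and a root of it would be a
  common root.\<close>

lemma bezout_of_no_common_root:
  fixes p q :: "'k::alg_closed_field poly"
  assumes "\<And>x. poly p x = 0 \<Longrightarrow> poly q x = 0 \<Longrightarrow> False"
  obtains a b where "a * p + b * q = 1"
proof -
  define S where "S = {r. \<exists>a b. r = a * p + b * q}"
  have "p = 1 * p + 0 * q" "q = 0 * p + 1 * q" by simp_all
  then have pq: "p \<in> S" "q \<in> S" unfolding S_def by blast+
  have "p \<noteq> 0 \<or> q \<noteq> 0" using assms[of 0] by auto
  then have "\<exists>d. d \<in> S \<and> d \<noteq> 0" using pq by blast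
  then obtain d where d: "d \<in> S" "d \<noteq> 0" and min: "\<And>r. r \<in> S \<Longrightarrow> r \<noteq> 0 \<Longrightarrow> degree d \<le> degree r"
    using ex_has_least_nat[of "\<lambda>d. d \<in> S \<and> d \<noteq> 0" _ degree] by blast
  obtain a b where ab: "d = a * p + b * q" using d by (auto simp: S_def)
  have "d dvd r" if r: "r \<in> S" for r
  proof -
    obtain a' b' where "r = a' * p + b' * q" using r by (auto simp: S_def)
    then have "r mod d = (a' - r div d * a) * p + (b' - r div d * b) * q"
      by (simp add: minus_div_mult_eq_mod[symmetric] ab algebra_simps)
    then have "r mod d \<in> S" unfolding S_def by blast
    then have "r mod d = 0" using min degree_mod_less'[OF d(2), of r] by fastforce
    then show ?thesis by (simp add: dvd_eq_mod_eq_0)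
  qed
  then have dvd: "d dvd p" "d dvd q" using pq by auto
  have "degree d = 0"
  proof (rule ccontr)
    assume "degree d \<noteq> 0"
    then obtain x where "poly d x = 0" using alg_closed_imp_poly_has_root[of d] by auto
    then show False using dvd assms by (metis dvdE mult_zero_left poly_mult)
  qed
  then obtain c where c: "d = [:c:]" by (metis degree_eq_zeroE)
  with d have "c \<noteq> 0" by auto
  have "smult (inverse c) a * p + smult (inverse c) b * q = smult (inverse c) d"
    by (simp add: ab smult_add_right)
  also have "\<dots> = 1" using c \<open>c \<noteq> 0\<close> by (simp add: one_pCons)
  finally show ?thesis by (rule that)
qed

lemma pderiv_sum: "pderiv (sum f A) = (\<Sum>i\<in>A. pderiv (f i))"
  by (induction A rule: infinite_finite_induct) (simp_all add: pderiv_add)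

lemma of_nat_char2: "(2 :: 'k::comm_ring_1) = 0 \<Longrightarrow> (of_nat n :: 'k) = (if even n then 0 else 1)"
  by (auto elim!: evenE oddE)

lemma minus_char2: "(2 :: 'k::comm_ring_1) = 0 \<Longrightarrow> - x = (x :: 'k)"
  by (metis add_eq_0_iff mult_2 mult_zero_left)

lemma power_two_collision:
  assumes "m > 0"
  obtains i j :: nat where "i < j" "2 ^ i mod m = (2 ^ j mod m :: nat)"
proof -
  have "\<not> inj (\<lambda>i::nat. 2 ^ i mod m :: nat)"
  proof
    assume "inj (\<lambda>i::nat. 2 ^ i mod m :: nat)"
    moreover have "range (\<lambda>i::nat. 2 ^ i mod m :: nat) \<subseteq> {..<m}" using assms by auto
    ultimately show False using finite_subset finite_imageD by (metis finite_lessThan infinite_UNIV_nat)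
  qed
  then show ?thesis using that unfolding inj_def by (metis nat_neq_iff)
qed

lemma add_power_two_power:
  assumes "(2 :: 'k::comm_ring_1) = 0"
  shows "(x + y :: 'k) ^ (2 ^ i) = x ^ (2 ^ i) + y ^ (2 ^ i)"
proof (induction i)
  case (Suc i)
  have "(x + y) ^ (2 ^ Suc i) = ((x + y) ^ (2 ^ i)) ^ 2" by (simp add: power_mult[symmetric] mult.commute)
  also have "\<dots> = (x ^ (2 ^ i)) ^ 2 + (y ^ (2 ^ i)) ^ 2 + 2 * x ^ (2 ^ i) * y ^ (2 ^ i)"
    unfolding Suc by (simp add: power2_sum)
  finally show ?case using assms by (simp add: power_mult[symmetric] mult.commute)
qed simp

context
  fixes s :: nat and u :: "'k::alg_closed_field"
  assumes s: "s > 1" and char2: "(2 :: 'k) = 0"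
    and generic: "inj (\<lambda>i::nat. (u - u ^ s) ^ (2 ^ i))"
begin

lemma generic_nonzero: "u - u ^ s \<noteq> 0"
proof
  assume "u - u ^ s = 0"
  then have "(u - u ^ s) ^ (2 ^ 0) = (u - u ^ s) ^ (2 ^ 1)" by simp
  then show False using injD[OF generic, of 0 1] by simp
qed

lemma parameter_nonzero: "u \<noteq> 0"
  using generic_nonzero s by auto

text \<open>At a common root \<open>x\<close> of \<open>\<pi>\<close> and \<open>\<pi>'\<close>, with \<open>y = f(x)\<close>, the chain rule gives
  \<open>s\<^sup>2 (x y)\<^bsup>s-1\<^esup> = 1\<close>.  This forces \<open>s\<close> to be odd, and then \<open>f(x) = y\<close>, \<open>f(y) = x\<close> give
  \<open>x + y = c\<close> and \<open>x\<^bsup>s-1\<^esup> = y\<^bsup>s-1\<^esup> = 1\<close>.  If \<open>2\<^sup>i\<close> and \<open>2\<^sup>j\<close> agree modulo \<open>s - 1\<close>, then the powers of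
  \<open>x\<close> and of \<open>y\<close> with these exponents agree, and in characteristic two so do those of their sum \<open>c\<close>.
  A generic \<open>c\<close> excludes this.\<close>

lemma modulus_separable:
  obtains a b where "a * modulus s u + b * pderiv (modulus s u) = 1"
proof (rule bezout_of_no_common_root)
  fix x assume x: "poly (modulus s u) x = 0" "poly (pderiv (modulus s u)) x = 0"
  define c where "c = u - u ^ s"
  define y where "y = x ^ s + c"
  obtain m where m: "s = Suc m" using s by (cases s) auto
  have "poly ([:- u, 1:] * modulus s u) x = 0" using x by simp
  then have yx: "y ^ s + c = x"
    unfolding modulus_eq by (simp add: poly_pcompose poly_twist y_def c_def)
  have pX: "pderiv ([:0, 1:] :: 'k poly) = 1" by (simp add: pderiv_pCons one_pCons)
  have pt: "pderiv (twist s u) = smult (of_nat s) ([:0, 1:] ^ m)"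
    unfolding twist_def m pderiv_add pderiv_power_Suc pX by simp
  have fs: "pderiv (twist s u ^ s) = smult (of_nat s) (twist s u ^ m) * pderiv (twist s u)"
    unfolding m by (rule pderiv_power_Suc)
  have "poly (pderiv ([:- u, 1:] * modulus s u)) x = 0"
    using x unfolding pderiv_mult by simp
  moreover have "pderiv (tw_hom s u (twist s u) - [:0, 1:]) =
      smult (of_nat s) (twist s u ^ m) * (smult (of_nat s) ([:0, 1:] ^ m)) - 1"
    using pt pX by (simp only: tw_hom_twist pderiv_diff pderiv_add fs pderiv_singleton add_0_right)
  ultimately have 1: "of_nat s * of_nat s * (y ^ m * x ^ m) = 1"
    unfolding modulus_eq by (simp add: poly_twist y_def c_def algebra_simps)
  then have "odd s" using of_nat_char2[OF char2, of s] by (auto split: if_splits)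
  with 1 have xy1: "y ^ m * x ^ m = 1" using of_nat_char2[OF char2, of s] by simp
  have "m > 0" using s m by simp
  have xs: "x ^ s = y - c" "y ^ s = x - c" using yx by (auto simp: y_def algebra_simps)
  have "(y - c) * (x - c) = (y ^ m * x ^ m) * (x * y)"
    by (simp add: xs[symmetric] m)
  then have "c * (x + y) = c * c" unfolding xy1 by (simp add: algebra_simps)
  then have c: "x + y = c" using generic_nonzero by (simp add: c_def)
  have "y - c = - x" "x - c = - y" unfolding c[symmetric] by simp_all
  then have "x ^ s = x" "y ^ s = y" unfolding xs minus_char2[OF char2] by simp_all
  moreover have "x \<noteq> 0" "y \<noteq> 0" using xy1 \<open>m > 0\<close> by (auto simp: power_0_left)
  ultimately have xm: "x ^ m = 1" "y ^ m = 1" by (simp_all add: m)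
  obtain i j where ij: "i < j" "2 ^ i mod m = (2 ^ j mod m :: nat)"
    using power_two_collision[OF \<open>m > 0\<close>] by blast
  have red: "z ^ (2 ^ i) = z ^ (2 ^ j)" if "z ^ m = 1" for z :: 'k
  proof -
    have "z ^ k = z ^ (k mod m)" for k
      using that by (metis div_mult_mod_eq mult.commute power_add power_mult power_one mult_1)
    then show ?thesis using ij by metis
  qed
  have "c ^ (2 ^ i) = c ^ (2 ^ j)"
    unfolding c[symmetric] add_power_two_power[OF char2] using red xm by simp
  then show False using injD[OF generic, of i j] ij by (simp add: c_def)
qed

text \<open>At a fixed point \<open>x\<close> of the twist the cofactor takes the value \<open>1 + s x\<^bsup>s-1\<^esup>\<close>.\<close>

lemma cofactor_coprime:
  obtains a b where "a * (twist s u - [:0, 1:]) + b * cofactor s u = 1"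
proof (rule bezout_of_no_common_root)
  fix x assume x: "poly (twist s u - [:0, 1:]) x = 0" "poly (cofactor s u) x = 0"
  obtain m where m: "s = Suc m" using s by (cases s) auto
  have fx: "x ^ s + (u - u ^ s) = x" using x(1) by (simp add: poly_twist)
  then have fx': "poly (twist s u) x = x" by (simp add: poly_twist)
  have "poly (cofactor s u) x = 1 + (\<Sum>i<s. x ^ i * x ^ (s - 1 - i))"
    by (simp add: cofactor_def poly_sum fx')
  also have "(\<Sum>i<s. x ^ i * x ^ (s - 1 - i)) = (\<Sum>i<s. x ^ m)"
    by (rule sum.cong) (simp_all add: m power_add[symmetric])
  finally have "1 + of_nat s * x ^ m = 0" using x(2) by simp
  then have "x ^ m = 1"
    using of_nat_char2[OF char2, of s] minus_char2[OF char2]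
    by (auto split: if_splits simp: add_eq_0_iff)
  then have "x ^ s = x" by (simp add: m)
  then show False using fx generic_nonzero by simp
qed



section \<open>Semisimplicity\<close>

text \<open>Averaging over \<open>K[X]/(\<pi>)\<close> by its separability idempotent.  A linear projection \<open>P\<close> onto \<open>W\<close>
  is inserted between the two variables of \<open>(\<pi>(X) - \<pi>(Z)) / (X - Z)\<close>.  The commutator of the
  resulting operator \<open>T\<close> with \<open>X\<close> telescopes to \<open>P(\<pi> z) - \<pi> P(z)\<close>, which vanishes modulo \<open>\<pi>\<close>; on \<open>W\<close>
  it is multiplication by \<open>\<pi>'\<close>, which is invertible modulo \<open>\<pi>\<close>.\<close>

lemma polynomial_averaging:
  assumes add: "\<And>z w. z \<in> W \<Longrightarrow> w \<in> W \<Longrightarrow> z + w \<in> W"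
    and actW: "\<And>d z. z \<in> W \<Longrightarrow> act d z \<in> W"
    and zero: "\<And>z. cong2 s u z 0 \<Longrightarrow> z \<in> W"
  obtains P where "\<And>z. P z \<in> W" "\<And>z w. P (z + w) = P z + P w"
    "\<And>z. z \<in> W \<Longrightarrow> cong2 s u (P z) z"
    "\<And>d z. cong2 s u (P (act d z)) (act d (P z))"
proof -
  let ?sc = "\<lambda>c::'k. map_prod (smult c) (smult c)"
  define \<pi> where "\<pi> = modulus s u"
  interpret V: vector_space_pair ?sc ?sc
    by unfold_locales (simp_all add: map_prod_def split_beta plus_prod_def smult_add_left smult_add_right)
  have 0: "0 \<in> W" using zero cong2_refl by blast
  have W: "V.vs1.subspace W"
    by (rule V.vs1.subspaceI) (use 0 add actW in \<open>simp_all flip: act_const\<close>)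
  have "Vector_Spaces.linear ?sc ?sc id"
    by (rule V.vs1.linear_id[unfolded id_def[symmetric]])
  then obtain P where P: "P ` UNIV \<subseteq> W" "Vector_Spaces.linear ?sc ?sc P" "\<forall>z\<in>W. P z = z"
    using V.linear_exists_left_inverse_on[of id W] W by auto
  have PW: "P z \<in> W" for z using P(1) by blast
  interpret P: Vector_Spaces.linear ?sc ?sc P by (rule P(2))
  have Pc: "P (act [:c:] z) = act [:c:] (P z)" for c z
    by (simp add: act_const P.scale)
  define x where "x = ([:0, 1:] :: 'k poly)"
  have sumW: "sum f A \<in> W" if "\<And>i. i \<in> A \<Longrightarrow> f i \<in> W" for f and A :: "nat set"
    using that by (induction A rule: infinite_finite_induct) (auto simp: 0 add)
  define T where "T = (\<lambda>z. \<Sum>j\<le>degree \<pi>. act [:coeff \<pi> j:] (\<Sum>i<j. act (x ^ i) (P (act (x ^ (j - 1 - i)) z))))"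
  have TW: "T z \<in> W" for z
    unfolding T_def by (intro sumW actW PW)
  have Tadd: "T (z + w) = T z + T w" for z w
    by (simp add: T_def act_add P.add sum.distrib)
  have \<pi>sum: "(\<Sum>j\<le>degree \<pi>. act ([:coeff \<pi> j:] * x ^ j) z) = act \<pi> z" for z
  proof -
    have "(\<Sum>j\<le>degree \<pi>. [:coeff \<pi> j:] * x ^ j) = \<pi>"
      using poly_as_sum_of_monoms[of \<pi>] by (simp add: monom_altdef x_def)
    then show ?thesis by (simp only: act_sum_left[symmetric])
  qed
  have TX: "cong2 s u (T (act x z)) (act x (T z))" for z
  proof -
    have "T (act x z) - act x (T z) = (\<Sum>j\<le>degree \<pi>. act [:coeff \<pi> j:]
        (\<Sum>i<j. act (x ^ i) (P (act (x ^ (j - i)) z)) - act (x ^ Suc i) (P (act (x ^ (j - Suc i)) z))))"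
      unfolding T_def act_sum sum_subtractf[symmetric]
    proof (intro sum.cong refl)
      fix j i assume "j \<in> {..degree \<pi>}" "i \<in> {..<j}"
      then have "x ^ (j - 1 - i) * x = x ^ (j - i)"
        by (metis lessThan_iff Suc_diff_Suc diff_Suc_eq_diff_pred power_Suc2)
      then show "act [:coeff \<pi> j:] (act (x ^ i) (P (act (x ^ (j - 1 - i)) (act x z)))) -
          act x (act [:coeff \<pi> j:] (act (x ^ i) (P (act (x ^ (j - 1 - i)) z)))) =
        act [:coeff \<pi> j:] (act (x ^ i) (P (act (x ^ (j - i)) z)) - act (x ^ Suc i) (P (act (x ^ (j - Suc i)) z)))"
        by (simp only: act_act[of _ x z] diff_Suc_eq_diff_pred power_Suc)
          (simp add: act_diff act_act mult.commute mult.left_commute)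
    qed
    also have "\<dots> = (\<Sum>j\<le>degree \<pi>. act [:coeff \<pi> j:] (P (act (x ^ j) z) - act (x ^ j) (P z)))"
      by (subst sum_lessThan_telescope') (simp add: act_1)
    also have "\<dots> = (\<Sum>j\<le>degree \<pi>. P (act ([:coeff \<pi> j:] * x ^ j) z) - act ([:coeff \<pi> j:] * x ^ j) (P z))"
      by (intro sum.cong refl) (simp only: act_diff act_act[symmetric] Pc)
    also have "\<dots> = P (act \<pi> z) - act \<pi> (P z)"
      by (simp only: sum_subtractf P.sum[symmetric] \<pi>sum)
    also have "P (act \<pi> z) = act \<pi> z"
      using P(3) zero[OF cong2_act_modulus] unfolding \<pi>_def by blast
    also have "act \<pi> z - act \<pi> (P z) = act \<pi> (z - P z)"
      by (simp add: act_def algebra_simps)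
    finally show ?thesis
      using cong2_act_modulus by (subst cong2_diff_iff) (simp add: \<pi>_def)
  qed
  have Pm: "P (act e (act [:c:] z)) = act [:c:] (P (act e z))" for c e z
    by (metis act_act mult.commute Pc)
  have Tc: "T (act [:c:] z) = act [:c:] (T z)" for c z
    unfolding T_def Pm act_sum by (simp only: act_act mult.commute mult.left_commute)
  have Td: "cong2 s u (T (act d z)) (act d (T z))" for d z
  proof (induction d)
    case 0
    have "T 0 = 0" using Tadd[of 0 0] by simp
    then show ?case by (simp add: act_0 cong2_refl)
  next
    case (pCons c d)
    have e: "act (pCons c d) w = act [:c:] w + act x (act d w)" for w
      by (simp add: act_act act_add_left[symmetric] x_def)
    have "T (act (pCons c d) z) = act [:c:] (T z) + T (act x (act d z))"
      by (simp only: e Tadd Tc)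
    also have "cong2 s u \<dots> (act [:c:] (T z) + act x (T (act d z)))"
      by (intro cong2_add cong2_refl TX)
    also have "cong2 s u \<dots> (act [:c:] (T z) + act x (act d (T z)))"
      by (intro cong2_add cong2_refl cong2_act pCons.IH) simp
    finally show ?case by (simp only: e)
  qed
  have TonW: "T z = act (pderiv \<pi>) z" if z: "z \<in> W" for z
  proof -
    have "T z = (\<Sum>j\<le>degree \<pi>. act [:coeff \<pi> j:] (\<Sum>i<j. act (x ^ (j - 1)) z))"
      unfolding T_def
    proof (intro sum.cong refl arg_cong[where f = "act _"])
      fix i j :: nat assume "i \<in> {..<j}"
      then have "x ^ i * x ^ (j - 1 - i) = x ^ (j - 1)" by (simp add: power_add[symmetric])
      then show "act (x ^ i) (P (act (x ^ (j - 1 - i)) z)) = act (x ^ (j - 1)) z"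
        using P(3) actW[OF z] by (simp add: act_act)
    qed
    also have "\<dots> = (\<Sum>j\<le>degree \<pi>. act (pderiv (monom (coeff \<pi> j) j)) z)"
      by (rule sum.cong)
        (simp_all only: act_sum_left[symmetric] act_act sum_constant card_lessThan pderiv_monom,
          simp add: x_def monom_altdef of_nat_poly)
    also have "\<dots> = act (pderiv \<pi>) z"
      by (simp only: act_sum_left[symmetric] pderiv_sum[symmetric] poly_as_sum_of_monoms)
    finally show ?thesis .
  qed
  obtain a v where av: "a * \<pi> + v * pderiv \<pi> = 1"
    using modulus_separable unfolding \<pi>_def by blast
  show ?thesis
  proof (rule that[of "\<lambda>z. act v (T z)"])
    show "act v (T z) \<in> W" for z by (intro actW TW)
    show "act v (T (z + w)) = act v (T z) + act v (T w)" for z w by (simp add: Tadd act_add)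
    show "cong2 s u (act v (T z)) z" if "z \<in> W" for z
    proof -
      have "v * pderiv \<pi> = 1 - a * \<pi>" using av by (simp add: algebra_simps)
      then have "act v (T z) = act (1 - a * \<pi>) z"
        by (simp add: TonW that act_act)
      moreover have "cong2 s u (act (1 - a * \<pi>) z) (act 1 z)"
        by (rule cong2_act) (simp_all add: \<pi>_def cong2_refl)
      ultimately show ?thesis by (simp add: act_1)
    qed
    show "cong2 s u (act v (T (act d z))) (act d (act v (T z)))" for d z
    proof -
      have "cong2 s u (act v (T (act d z))) (act v (act d (T z)))"
        by (rule cong2_act) (simp_all add: Td)
      then show ?thesis by (simp add: act_act mult.commute)
    qed
  qed
qed

text \<open>Write \<open>g = f - X\<close> and \<open>\<alpha> g + v h = 1\<close>.  Modulo \<open>\<pi>\<close>, \<open>\<phi> = v h\<close> and \<open>\<psi> = \<alpha> g\<close> are the complementary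
  idempotents that separate the fixed points of the twist from the orbits of length two.  At the
  fixed points \<open>d = \<phi> v / u\<close> is inverse to \<open>b = u h\<close>.  On the other orbits \<open>\<alpha>\<close> is inverse to \<open>g\<close>, and
  \<open>w = - X g\<^sup>-\<^sup>1\<close> satisfies \<open>w + \<eta>(w) = 1\<close> because \<open>\<eta>(g) = - g\<close>; this is an element of trace one
  written without choosing a point in each orbit.\<close>

lemma averaging_coefficients:
  defines "\<eta> \<equiv> tw_hom s u" and "b \<equiv> smult u (cofactor s u)"
  obtains w d where "\<And>p. modulus s u dvd d * \<eta> p - d * p" "modulus s u dvd \<eta> d - d"
    "modulus s u dvd w * b" "modulus s u dvd w + \<eta> w + d * b - 1"
proof -
  define f where "f = twist s u"
  define g where "g = f - [:0, 1:]"
  define h where "h = cofactor s u"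
  define \<pi> where "\<pi> = modulus s u"
  obtain \<alpha> v where bez: "\<alpha> * g + v * h = 1"
    using cofactor_coprime unfolding g_def f_def h_def by blast
  define \<phi> where "\<phi> = v * h"
  define \<psi> where "\<psi> = \<alpha> * g"
  define d where "d = smult (inverse u) (v * v) * h"
  define w where "w = - (\<alpha> * \<alpha> * g * [:0, 1:])"
  have \<eta>: "\<eta> (p + q) = \<eta> p + \<eta> q" "\<eta> (p * q) = \<eta> p * \<eta> q" "\<eta> (p - q) = \<eta> p - \<eta> q" "\<eta> (- p) = - \<eta> p"
    "\<eta> [:0, 1:] = f" for p q
    by (simp_all add: \<eta>_def f_def pcompose_add pcompose_mult pcompose_diff pcompose_uminus pcompose_X)
  have gh: "\<pi> dvd g * h"
    using cofactor_eq[of s u] modulus_dvd[of s u] by (simp add: g_def f_def h_def \<pi>_def)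
  have h\<eta>: "\<pi> dvd h * (\<eta> p - p)" for p
    unfolding h_def \<pi>_def \<eta>_def by (rule cofactor_tw_hom)
  have \<eta>h: "\<pi> dvd \<eta> h - h"
    unfolding h_def \<pi>_def \<eta>_def by (rule tw_hom_cofactor)
  have \<eta>mh: "\<pi> dvd \<eta> (m * h) - m * h" for m
  proof -
    have "\<eta> (m * h) - m * h = \<eta> m * (\<eta> h - h) + h * (\<eta> m - m)" by (simp add: \<eta> algebra_simps)
    then show ?thesis using \<eta>h h\<eta> by simp
  qed
  have \<eta>g: "\<pi> dvd \<eta> g + g"
  proof -
    have "\<eta> g + g = \<eta> f - [:0, 1:]" unfolding g_def \<eta>(3,5) by simp
    then show ?thesis using modulus_dvd[of s u] unfolding \<pi>_def \<eta>_def f_def by metis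
  qed
  have \<psi>: "\<pi> dvd \<eta> \<alpha> * \<eta> g - \<alpha> * g"
  proof -
    have "\<alpha> * g = 1 - v * h" using bez by (simp add: algebra_simps)
    moreover have "\<eta> 1 = 1" by (simp add: \<eta>_def pcompose_1)
    ultimately have eq: "\<eta> \<alpha> * \<eta> g - \<alpha> * g = - (\<eta> (v * h) - v * h)"
      by (simp add: \<eta>(2)[symmetric] \<eta>(3))
    show ?thesis unfolding eq dvd_minus_iff by (rule \<eta>mh)
  qed
  show ?thesis
  proof (rule that[of d w])
    show "modulus s u dvd d * \<eta> p - d * p" for p
    proof -
      have "d * \<eta> p - d * p = smult (inverse u) (v * v) * (h * (\<eta> p - p))"
        by (simp only: d_def mult.assoc right_diff_distrib)
      then show ?thesis using h\<eta>[of p] unfolding \<pi>_def by (metis dvd_mult)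
    qed
    show "modulus s u dvd \<eta> d - d"
      unfolding d_def using \<eta>mh unfolding \<pi>_def by blast
    have "w * b = smult u (- (\<alpha> * \<alpha> * x) * (g * h))" if "x = [:0, 1:]" for x
      unfolding b_def w_def h_def that[symmetric] by (simp add: algebra_simps)
    from this[OF refl] show "modulus s u dvd w * b"
      using gh unfolding \<pi>_def by (metis dvd_smult dvd_mult)
    have db: "d * b = \<phi> * \<phi>"
      using parameter_nonzero by (simp add: d_def b_def \<phi>_def h_def algebra_simps)
    have "w + \<eta> w + d * b - 1 =
      - f * (\<eta> \<alpha> * (\<eta> \<alpha> * \<eta> g - \<alpha> * g) + \<alpha> * (\<eta> \<alpha> * (\<eta> g + g) - (\<eta> \<alpha> * \<eta> g - \<alpha> * g)))
      + (\<psi> * \<psi> + \<phi> * \<phi> - 1)" if x: "x = [:0, 1:]" for x :: "'k poly"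
    proof -
      have "\<eta> x = f" using \<eta>(5) x by simp
      then show ?thesis
        unfolding db w_def \<psi>_def g_def x[symmetric] by (simp add: \<eta>(1-4) algebra_simps)
    qed
    note this[OF refl]
    moreover have "\<psi> * \<psi> + \<phi> * \<phi> - 1 = - (2 * \<alpha> * v) * (g * h)"
    proof -
      have "1 = (\<psi> + \<phi>) * (\<psi> + \<phi>)" using bez by (simp add: \<psi>_def \<phi>_def)
      then have "\<psi> * \<psi> + \<phi> * \<phi> - 1 = - (2 * \<psi> * \<phi>)" by (simp add: algebra_simps)
      then show ?thesis by (simp add: \<psi>_def \<phi>_def algebra_simps)
    qed
    ultimately show "modulus s u dvd w + \<eta> w + d * b - 1"
      unfolding \<pi>_def[symmetric]
      using \<psi> \<eta>g gh by (metis dvd_add dvd_diff dvd_mult)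
  qed
qed

text \<open>A projection \<open>P\<close> that commutes with polynomials is averaged once more.  On the orbits of length
  two, where \<open>y\<^sup>2 = 1\<close>, the average is \<open>w P + y w P y\<close> with the weight \<open>w\<close> of trace one.  At the fixed
  points it comes from the quadratic algebra \<open>y\<^sup>2 = b y + 1\<close>, whose separability idempotent in
  characteristic two is \<open>1 \<otimes> 1 + b\<^sup>-\<^sup>1 (y \<otimes> 1 + 1 \<otimes> y)\<close>.\<close>

lemma twisted_averaging:
  assumes add: "\<And>z w. z \<in> W \<Longrightarrow> w \<in> W \<Longrightarrow> z + w \<in> W"
    and actW: "\<And>d z. z \<in> W \<Longrightarrow> act d z \<in> W"
    and yactW: "\<And>z. z \<in> W \<Longrightarrow> yact s u z \<in> W"
    and zero: "\<And>z. cong2 s u z 0 \<Longrightarrow> z \<in> W"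
  obtains Q where "\<And>z. Q z \<in> W" "\<And>z w. Q (z + w) = Q z + Q w"
    "\<And>z. z \<in> W \<Longrightarrow> cong2 s u (Q z) z"
    "\<And>d z. cong2 s u (Q (act d z)) (act d (Q z))"
    "\<And>z. cong2 s u (Q (yact s u z)) (yact s u (Q z))"
proof -
  define \<eta> where "\<eta> = tw_hom s u"
  define b where "b = smult u (cofactor s u)"
  define Y where "Y = yact s u"
  obtain P where P: "\<And>z. P z \<in> W" "\<And>z w. P (z + w) = P z + P w"
    "\<And>z. z \<in> W \<Longrightarrow> cong2 s u (P z) z" "\<And>d z. cong2 s u (P (act d z)) (act d (P z))"
    using polynomial_averaging[OF add actW zero] by blast
  obtain w d where wd: "\<And>p. modulus s u dvd d * \<eta> p - d * p" "modulus s u dvd \<eta> d - d"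
    "modulus s u dvd w * b" "modulus s u dvd w + \<eta> w + d * b - 1"
    using averaging_coefficients unfolding \<eta>_def b_def by blast
  have b: "modulus s u dvd b * (\<eta> r - r)" "modulus s u dvd \<eta> b - b" for r
    unfolding b_def \<eta>_def by (rule tw_hom_cofactor_smult)+
  have bw: "modulus s u dvd b * \<eta> w"
  proof -
    have "b * \<eta> w = b * (\<eta> w - w) + w * b" by (simp add: algebra_simps)
    then show ?thesis using b wd by simp
  qed
  have \<eta>wb: "modulus s u dvd \<eta> (w * b)"
    unfolding \<eta>_def by (rule modulus_dvd_tw_hom) (rule wd)
  have \<eta>\<eta>: "modulus s u dvd \<eta> (\<eta> p) - p" for p
    unfolding \<eta>_def by (rule tw_hom_tw_hom)
  have \<eta>: "\<eta> (r + t) = \<eta> r + \<eta> t" "\<eta> (r * t) = \<eta> r * \<eta> t" for r t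
    by (simp_all add: \<eta>_def pcompose_add pcompose_mult)
  have Ya: "Y (z + z') = Y z + Y z'" "Y (act e z) = act (\<eta> e) (Y z)" for z z' e
    unfolding Y_def \<eta>_def by (rule yact_add yact_act)+
  have YY: "cong2 s u (Y (Y z)) (z + act b (Y z))" for z
    unfolding Y_def b_def by (rule yact_yact)
  have Yc: "cong2 s u (Y z) (Y z')" if "cong2 s u z z'" for z z'
    unfolding Y_def by (rule cong2_yact[OF that])
  have Pc: "cong2 s u (P z) (P z')" if "cong2 s u z z'" for z z'
  proof -
    have "cong2 s u (z - z') 0" using that cong2_diff_iff by blast
    then obtain x where "z - z' = act (modulus s u) x" by (rule cong2_zeroD)
    then have "P z = P (act (modulus s u) x) + P z'" by (metis P(2) diff_add_cancel)
    moreover have "cong2 s u (P (act (modulus s u) x)) (act (modulus s u) (P x))" by (rule P(4))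
    then have "cong2 s u (P (act (modulus s u) x)) 0"
      using cong2_act_modulus cong2_trans by blast
    ultimately show ?thesis using cong2_add[OF _ cong2_refl, of s u _ 0 "P z'"] by simp
  qed
  have two: "p + p = 0" for p :: "'k poly"
  proof -
    have "p + p = smult 2 p" by (metis smult_1_left smult_add_left one_add_one)
    then show ?thesis using char2 by simp
  qed
  note refl = cong2_refl
  define Q where "Q = (\<lambda>z. act (w + d * b) (P z) + Y (act w (P (Y z))) + act d (Y (P z) + P (Y z)))"
  \<comment> \<open>Both sides of the commutation rules are combinations of the same four vectors, so that they
    can be compared coefficient by coefficient.\<close>
  define comb where "comb = (\<lambda>z a1 a2 a3 a4.
      act a1 (P z) + act a2 (Y (P z)) + act a3 (P (Y z)) + act a4 (Y (P (Y z))))"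
  have comb_cong: "cong2 s u (comb z a1 a2 a3 a4) (comb z b1 b2 b3 b4)"
    if "modulus s u dvd a1 - b1" "modulus s u dvd a2 - b2"
      "modulus s u dvd a3 - b3" "modulus s u dvd a4 - b4" for z a1 a2 a3 a4 b1 b2 b3 b4
    unfolding comb_def by (intro cong2_add cong2_act refl that)
  have Qcomb: "Q z = comb z (w + d * b) d d (\<eta> w)" for z
    by (simp add: Q_def comb_def Ya act_add)
  show ?thesis
  proof (rule that[of Q])
    show "Q z \<in> W" for z
      unfolding Q_def Y_def by (intro add actW yactW P)
    show "Q (z + z') = Q z + Q z'" for z z'
      by (simp add: Q_def P(2) Ya act_add)
    show "cong2 s u (Q z) z" if z: "z \<in> W" for z
    proof -
      have "cong2 s u (Q z) (act (w + d * b) z + Y (act w (Y z)) + act d (Y z + Y z))"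
        unfolding Q_def
        by (intro cong2_add cong2_act Yc P(3) z yactW[folded Y_def]) simp_all
      also have "act d (Y z + Y z) = 0"
        by (simp add: act_add act_add_left[symmetric] two act_0)
      also have "act (w + d * b) z + Y (act w (Y z)) + 0 = act (w + d * b) z + act (\<eta> w) (Y (Y z))"
        by (simp add: Ya)
      also have "cong2 s u \<dots> (act (w + d * b) z + act (\<eta> w) (z + act b (Y z)))"
        by (intro cong2_add cong2_act refl YY) simp
      also have "\<dots> = act (w + \<eta> w + d * b) z + act (b * \<eta> w) (Y z)"
        by (simp add: act_add act_act act_add_left mult.commute)
      also have "cong2 s u \<dots> (act 1 z + act 0 (Y z))"
        by (intro cong2_add cong2_act refl wd) (simp add: bw)
      finally show ?thesis by (simp add: act_1 act_0)
    qed
    show "cong2 s u (Q (act e z)) (act e (Q z))" for e z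
    proof -
      have PY: "cong2 s u (P (Y (act e z))) (act (\<eta> e) (P (Y z)))"
        unfolding Ya by (rule P(4))
      have "cong2 s u (Q (act e z)) (act (w + d * b) (act e (P z)) + Y (act w (act (\<eta> e) (P (Y z))))
          + act d (Y (act e (P z)) + act (\<eta> e) (P (Y z))))"
        unfolding Q_def by (intro cong2_add cong2_act Yc P(4) PY) simp_all
      also have "\<dots> = comb z ((w + d * b) * e) (d * \<eta> e) (d * \<eta> e) (\<eta> w * \<eta> (\<eta> e))"
        by (simp add: comb_def Ya act_add act_act \<eta>)
      also have "cong2 s u \<dots> (comb z ((w + d * b) * e) (d * e) (d * e) (\<eta> w * e))"
        by (rule comb_cong) (simp_all add: wd dvd_mult_diff \<eta>\<eta>)
      also have "\<dots> = act e (Q z)"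
        by (simp add: Qcomb) (simp add: comb_def act_add act_act mult.commute)
      finally show ?thesis .
    qed
    show "cong2 s u (Q (yact s u z)) (yact s u (Q z))" for z
    proof -
      have PYY: "cong2 s u (P (Y (Y z))) (P z + act b (P (Y z)))"
      proof -
        have "cong2 s u (P (Y (Y z))) (P z + P (act b (Y z)))"
          using Pc[OF YY] by (simp add: P(2))
        also have "cong2 s u \<dots> (P z + act b (P (Y z)))"
          by (intro cong2_add refl P(4))
        finally show ?thesis .
      qed
      have 1: "cong2 s u (Q (Y z)) (act (w + d * b) (P (Y z)) + Y (act w (P z + act b (P (Y z))))
          + act d (Y (P (Y z)) + (P z + act b (P (Y z)))))"
        unfolding Q_def by (intro cong2_add cong2_act Yc PYY refl) simp_all
      have 2: "act (w + d * b) (P (Y z)) + Y (act w (P z + act b (P (Y z))))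
          + act d (Y (P (Y z)) + (P z + act b (P (Y z)))) =
          comb z d (\<eta> w) (w + (d * b + d * b)) (\<eta> (w * b) + d)"
        by (simp only: comb_def Ya act_add act_act act_add_left \<eta> add_ac mult.commute)
      have "cong2 s u (Y (Q z)) (act (\<eta> (w + d * b)) (Y (P z)) + (act w (P (Y z)) + act b (Y (act w (P (Y z)))))
          + act (\<eta> d) ((P z + act b (Y (P z))) + Y (P (Y z))))"
        unfolding Q_def Ya(1) Ya(2)[of "w + d * b"] Ya(2)[of d] by (intro cong2_add cong2_act YY refl) simp_all
      also have "\<dots> = comb z (\<eta> d) (\<eta> w + (\<eta> d * \<eta> b + \<eta> d * b)) w (b * \<eta> w + \<eta> d)"
        by (simp only: comb_def Ya act_add act_act act_add_left \<eta> add_ac mult.commute)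
      finally have 3: "cong2 s u (Y (Q z)) (comb z (\<eta> d) (\<eta> w + (\<eta> d * \<eta> b + \<eta> d * b)) w (b * \<eta> w + \<eta> d))" .
      have "\<eta> d * \<eta> b + \<eta> d * b = \<eta> d * (\<eta> b - b) + (\<eta> d * b + \<eta> d * b)" by (simp add: algebra_simps)
      then have "modulus s u dvd \<eta> d * \<eta> b + \<eta> d * b" using b by (simp add: two)
      moreover have "modulus s u dvd (b * \<eta> w + \<eta> d) - (\<eta> (w * b) + d)"
      proof -
        have "(b * \<eta> w + \<eta> d) - (\<eta> (w * b) + d) = b * \<eta> w - \<eta> (w * b) + (\<eta> d - d)" by simp
        then show ?thesis using bw \<eta>wb wd by (metis dvd_add dvd_diff)
      qed
      ultimately have 4: "cong2 s u (comb z (\<eta> d) (\<eta> w + (\<eta> d * \<eta> b + \<eta> d * b)) w (b * \<eta> w + \<eta> d))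
          (comb z d (\<eta> w) (w + (d * b + d * b)) (\<eta> (w * b) + d))"
        by (intro comb_cong) (simp_all add: wd two)
      from cong2_trans[OF cong2_trans[OF 1[unfolded 2] cong2_sym[OF 4]] cong2_sym[OF 3]]
      show ?thesis unfolding Y_def .
    qed
  qed
qed

text \<open>The complement of a left ideal is the kernel of an averaged projection onto it.\<close>

theorem semisimple_twisted_algebra: "semisimple_ring (twisted_algebra s u)"
proof -
  let ?A = "twisted_algebra s u"
  interpret typed_algebra ?A by (rule typed_algebra_twisted_algebra[OF s])
  note refl = cong2_refl and sym = cong2_sym and trans = cong2_trans
    and self = red2_self[OF s]
  show ?thesis
    unfolding semisimple_ring_def
  proof (intro conjI allI impI ring_axioms)
    fix L assume "left_ideal L ?A"
    then have L: "L \<subseteq> carrier ?A" "0 \<in> L" "\<And>x y. x \<in> L \<Longrightarrow> y \<in> L \<Longrightarrow> x + y \<in> L"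
      "\<And>a x. x \<in> L \<Longrightarrow> red2 s u (pre_mult s u (red2 s u a) x) \<in> L"
      using red2_carrier[OF s, of u]
      unfolding left_ideal_iff[OF ring_axioms] add_eq zero_eq twisted_algebra_simps(2) by blast+
    \<comment> \<open>The preimage of the ideal among the unreduced pairs.\<close>
    define W where "W = {z. red2 s u z \<in> L}"
    have pm: "pre_mult s u a z \<in> W" if "z \<in> W" for a z
    proof -
      have "cong2 s u (pre_mult s u a z) (pre_mult s u (red2 s u a) (red2 s u z))"
        by (intro pre_mult_cong self)
      then have "red2 s u (pre_mult s u a z) = red2 s u (pre_mult s u (red2 s u a) (red2 s u z))"
        by (rule red2_cong[OF s])
      then show ?thesis using that L(4) by (simp add: W_def)
    qed
    have red0: "red2 s u 0 = 0"
      by (rule red2_id[OF s]) (rule zero_in_carrier)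
    obtain Q where Q: "\<And>z. Q z \<in> W" "\<And>z w. Q (z + w) = Q z + Q w"
      "\<And>z. z \<in> W \<Longrightarrow> cong2 s u (Q z) z" "\<And>d z. cong2 s u (Q (act d z)) (act d (Q z))"
      "\<And>z. cong2 s u (Q (yact s u z)) (yact s u (Q z))"
    proof (rule twisted_averaging[of W])
      show "z + w \<in> W" if "z \<in> W" "w \<in> W" for z w
        using that L(3) by (simp add: W_def red2_add[OF s])
      show "act d z \<in> W" if "z \<in> W" for d z
        using pm[OF that, of "(d, 0)"] by (simp add: pre_mult_eq act_0)
      show "yact s u z \<in> W" if "z \<in> W" for z
        using pm[OF that, of "(0, 1)"] by (simp add: pre_mult_eq act_0 act_1)
      show "z \<in> W" if "cong2 s u z 0" for z
        using red2_cong[OF s that] L(2) by (simp add: W_def red0)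
    qed blast
    have Qm: "cong2 s u (Q (pre_mult s u a z)) (pre_mult s u a (Q z))" for a z
    proof -
      have "cong2 s u (Q (pre_mult s u a z)) (act (fst a) (Q z) + act (snd a) (Q (yact s u z)))"
        unfolding pre_mult_eq Q(2) by (intro cong2_add Q(4))
      also have "cong2 s u \<dots> (act (fst a) (Q z) + act (snd a) (yact s u (Q z)))"
        by (intro cong2_add refl cong2_act Q(5)) simp
      finally show ?thesis by (simp add: pre_mult_eq)
    qed
    have Q0: "Q 0 = 0" using Q(2)[of 0 0] by simp
    have Qd: "Q (z - w) = Q z - Q w" for z w using Q(2)[of "z - w" w] by simp
    have Qc: "cong2 s u (Q z) (Q z')" if "cong2 s u z z'" for z z'
    proof -
      have "cong2 s u (z - z') 0" using that cong2_diff_iff by blast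
      then obtain x where "z - z' = act (modulus s u) x" by (rule cong2_zeroD)
      then have "Q z - Q z' = Q (act (modulus s u) x)" by (simp add: Qd[symmetric])
      then have "cong2 s u (Q z - Q z') (act (modulus s u) (Q x))" using Q(4) by simp
      then have "cong2 s u (Q z - Q z') 0" using cong2_act_modulus trans by blast
      then show ?thesis using cong2_diff_iff by blast
    qed
    define K where "K = {z \<in> carrier ?A. cong2 s u (Q z) 0}"
    have K: "left_ideal K ?A"
      unfolding left_ideal_iff[OF ring_axioms]
    proof (intro conjI ballI)
      show "K \<subseteq> carrier ?A" by (auto simp: K_def)
      show "\<zero>\<^bsub>?A\<^esub> \<in> K" by (simp add: K_def zero_eq zero_in_carrier Q0 refl)
      show "x \<oplus>\<^bsub>?A\<^esub> y \<in> K" if "x \<in> K" "y \<in> K" for x y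
        using that cong2_add[of s u "Q x" 0 "Q y" 0] by (simp add: K_def add_eq plus_closed Q(2))
      show "a \<otimes>\<^bsub>?A\<^esub> x \<in> K" if "x \<in> K" "a \<in> carrier ?A" for a x
      proof -
        have "cong2 s u (Q (red2 s u (pre_mult s u a x))) (Q (pre_mult s u a x))"
          by (rule Qc) (rule sym[OF self])
        also have "cong2 s u \<dots> (pre_mult s u a (Q x))" by (rule Qm)
        also have "cong2 s u \<dots> (pre_mult s u a 0)"
          by (intro pre_mult_cong refl) (use that in \<open>simp add: K_def\<close>)
        also have "pre_mult s u a 0 = 0" by (simp add: pre_mult_def split_beta zero_prod_def)
        finally show ?thesis
          using red2_carrier[OF s] by (simp add: K_def twisted_algebra_simps(2))
      qed
    qed
    have LW: "z \<in> W" if "z \<in> L" for z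
      using that L(1) red2_id[OF s, of z u] by (auto simp: W_def)
    have "L \<inter> K = {0}"
    proof (intro equalityI subsetI)
      fix z assume z: "z \<in> L \<inter> K"
      have "cong2 s u z (Q z)" by (rule sym[OF Q(3)[OF LW]]) (use z in simp)
      also have "cong2 s u (Q z) 0" using z by (simp add: K_def)
      finally have "red2 s u z = red2 s u 0" by (rule red2_cong[OF s])
      moreover have "red2 s u z = z" using z L(1) by (intro red2_id[OF s]) blast
      ultimately show "z \<in> {0}" unfolding red0 by simp
    qed (use L(2) K[unfolded left_ideal_iff[OF ring_axioms]] in \<open>auto simp: zero_eq\<close>)
    moreover have "L <+>\<^bsub>?A\<^esub> K = carrier ?A"
    proof (intro equalityI subsetI)
      show "z \<in> carrier ?A" if "z \<in> L <+>\<^bsub>?A\<^esub> K" for z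
        using that L(1) plus_closed by (auto simp: set_add_def' add_eq K_def)
    next
      fix z assume z: "z \<in> carrier ?A"
      define l where "l = red2 s u (Q z)"
      have l: "l \<in> L" using Q(1)[of z] by (simp add: l_def W_def)
      have lA: "l \<in> carrier ?A" using l L(1) by blast
      have "cong2 s u (Q l) (Q z)"
        using Q(3)[OF LW[OF l]] sym[OF self, of u "Q z"] trans unfolding l_def by blast
      then have "cong2 s u (Q z - Q l) 0" using sym cong2_diff_iff by blast
      moreover have "z - l \<in> carrier ?A"
        using plus_closed[OF z twisted_algebra_closed(2)[OF s lA]] by simp
      ultimately have "z - l \<in> K" by (simp add: K_def Qd)
      then have "l + (z - l) \<in> L <+>\<^bsub>?A\<^esub> K" using l unfolding set_add_def' add_eq by blast
      then show "z \<in> L <+>\<^bsub>?A\<^esub> K" by simp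
    qed
    ultimately show "\<exists>L'. left_ideal L' ?A \<and> L \<inter> L' = {\<zero>\<^bsub>?A\<^esub>} \<and> L <+>\<^bsub>?A\<^esub> L' = carrier ?A"
      using K by (auto simp: zero_eq)
  qed
qed

end


section \<open>The deformation\<close>

lemma comm_ring_morphism_fps_const: "comm_ring_morphism (fps_const :: 'k::field \<Rightarrow> 'k fps)"
  by unfold_locales (simp_all flip: fps_const_add fps_const_mult)

lemma comm_ring_morphism_fps_nth_0: "comm_ring_morphism (\<lambda>f :: 'k::field fps. fps_nth f 0)"
  by unfold_locales simp_all

lemma comm_ring_morphism_fps_to_fls: "comm_ring_morphism (fps_to_fls :: 'k::field fps \<Rightarrow> 'k fls)"
  by unfold_locales (simp_all add: fls_times_fps_to_fls)

lemma comm_ring_morphism_to_ac: "comm_ring_morphism (to_ac :: 'k::field \<Rightarrow> 'k alg_closure)"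
  by unfold_locales simp_all

lemma (in comm_ring_morphism) hom_two_eq_0: "(2 :: 'r) = 0 \<Longrightarrow> (2 :: 's) = 0"
  by (metis hom_0 hom_1 hom_add one_add_one)

lemma fps_divisible_by_X:
  assumes "fps_nth (f :: 'k::field fps) 0 = 0"
  shows "fps_X * fps_shift 1 f = f"
  by (rule fps_ext) (use assms in \<open>auto simp: fps_X_mult_nth\<close>)

lemma poly_divisible_by_fps_X:
  assumes "map_poly (\<lambda>f. fps_nth f 0) (p :: 'k::field fps poly) = 0"
  obtains p' where "p = smult fps_X p'" "degree p' \<le> degree p"
proof
  have "fps_nth (coeff p i) 0 = 0" for i
    using arg_cong[OF assms, of "\<lambda>q. coeff q i"] by (simp add: coeff_map_poly)
  then show "p = smult fps_X (map_poly (fps_shift 1) p)"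
    by (intro poly_eqI) (simp add: coeff_map_poly fps_divisible_by_X[unfolded One_nat_def])
  show "degree (map_poly (fps_shift 1) p) \<le> degree p"
    by (rule degree_le) (simp add: coeff_map_poly coeff_eq_0)
qed

text \<open>The module \<open>k[[t]] \<otimes> kG\<^sub>s\<close> is identified with the member of the family at parameter \<open>0\<close>, which
  has the same underlying module as the member at parameter \<open>t\<close>; the multiplication of the latter is
  carried back.  Taking constant coefficients maps the parameter \<open>t\<close> to \<open>0\<close> and has kernel the
  multiples of \<open>t\<close>.\<close>

theorem group_algebra_deformation:
  assumes s: "s > 1"
  obtains A\<^sub>t :: "('k::field fls, ('k::field fls, ('k::field fps, int \<times> int \<Rightarrow>\<^sub>0 'k::field) tensor) tensor) module"
  where "deformation (group_algebra (group_G s) :: ('k::field, int \<times> int \<Rightarrow>\<^sub>0 'k::field) module) A\<^sub>t"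
    and "assoc_algebra A\<^sub>t" and "algebra_iso A\<^sub>t (twisted_algebra s fls_X)"
proof -
  let ?A = "group_algebra (group_G s) :: ('k, int \<times> int \<Rightarrow>\<^sub>0 'k) module"
  let ?E = "extend_scalars fps_const ?A"
  let ?c = "\<lambda>f :: 'k fps. fps_nth f 0"
  let ?N = "twisted_algebra s (fps_X :: 'k fps)" and ?NZ = "twisted_algebra s (0 :: 'k)"
  note A = group_algebra_twisted_algebra[OF s, where 'k = 'k]
  interpret c: comm_ring_morphism ?c by (rule comm_ring_morphism_fps_nth_0)
  interpret N: typed_algebra ?N by (rule typed_algebra_twisted_algebra[OF s])
  have E: "assoc_algebra ?E" "algebra_iso ?E (twisted_algebra s (fps_const 0))"
    using extend_scalars_twisted_algebra[OF s comm_ring_morphism_fps_const A] by blast+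
  \<comment> \<open>As modules, the algebras of the family over \<open>k[[t]]\<close> do not depend on the parameter.\<close>
  obtain h where h: "bij_betw h (carrier ?E) (carrier ?N)" 
    and ha: "\<And>x y. x \<in> carrier ?E \<Longrightarrow> y \<in> carrier ?E \<Longrightarrow> h (x \<oplus>\<^bsub>?E\<^esub> y) = h x + h y"
    and hs: "\<And>c x. x \<in> carrier ?E \<Longrightarrow> h (c \<odot>\<^bsub>?E\<^esub> x) = c \<odot>\<^bsub>?N\<^esub> h x"
    using E(2) by (rule algebra_isoE) (auto simp: twisted_algebra_simps)
  interpret E: ring ?E by (rule assoc_algebraD(1)[OF E(1)])
  define g where "g = inv_into (carrier ?E) h"
  have hg: "h (g z) = z" and gc: "g z \<in> carrier ?E" if "z \<in> carrier ?N" for z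
    using h that by (auto simp: g_def bij_betw_def intro: f_inv_into_f inv_into_into)
  have hc: "h x \<in> carrier ?N" if "x \<in> carrier ?E" for x using h that by (rule bij_betw_apply)
  have inj: "x = y" if "h x = h y" "x \<in> carrier ?E" "y \<in> carrier ?E" for x y
    using h that by (auto simp: bij_betw_def inj_on_def)
  have h0: "h \<zero>\<^bsub>?E\<^esub> = 0"
    using ha[of "\<zero>\<^bsub>?E\<^esub>" "\<zero>\<^bsub>?E\<^esub>"] by simp
  define B where "B = \<lparr>carrier = carrier ?E, monoid.mult = (\<lambda>x y. g (h x \<otimes>\<^bsub>?N\<^esub> h y)),
    monoid.one = g \<one>\<^bsub>?N\<^esub>, ring.zero = \<zero>\<^bsub>?E\<^esub>, add = add ?E, module.smult = module.smult ?E\<rparr>"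
  have Bs: "carrier B = carrier ?E" "\<zero>\<^bsub>B\<^esub> = \<zero>\<^bsub>?E\<^esub>" "add B = add ?E" "module.smult B = module.smult ?E"
    "\<one>\<^bsub>B\<^esub> = g \<one>\<^bsub>?N\<^esub>" "x \<otimes>\<^bsub>B\<^esub> y = g (h x \<otimes>\<^bsub>?N\<^esub> h y)" for x y
    by (simp_all add: B_def)
  have Bh: "bij_betw h (carrier B) (carrier ?N)"
    "\<And>x y. x \<in> carrier B \<Longrightarrow> y \<in> carrier B \<Longrightarrow> h (x \<otimes>\<^bsub>B\<^esub> y) = h x \<otimes>\<^bsub>?N\<^esub> h y"
    "\<And>x y. x \<in> carrier B \<Longrightarrow> y \<in> carrier B \<Longrightarrow> h (x \<oplus>\<^bsub>B\<^esub> y) = h x \<oplus>\<^bsub>?N\<^esub> h y"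
    "h \<one>\<^bsub>B\<^esub> = \<one>\<^bsub>?N\<^esub>" "h \<zero>\<^bsub>B\<^esub> = \<zero>\<^bsub>?N\<^esub>"
    "\<And>c x. x \<in> carrier B \<Longrightarrow> h (c \<odot>\<^bsub>B\<^esub> x) = c \<odot>\<^bsub>?N\<^esub> h x"
    using h by (simp_all add: Bs hg hc ha hs h0 N.add_eq N.zero_eq)
  have B: "assoc_algebra B"
    by (rule assoc_algebra_transfer[OF N.assoc Bh])
      (simp_all add: Bs gc hc assoc_algebraD(2)[OF E(1)])
  have BN: "algebra_iso B ?N" by (rule algebra_isoI[OF Bh(1-4,6)])
  interpret B: ring B by (rule assoc_algebraD(1)[OF B])

  define I where "I = (\<lambda>x. fps_X \<odot>\<^bsub>B\<^esub> x) ` carrier B"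
  define \<Phi> where "\<Phi> = (\<lambda>x. c.base_change (h x))"
  let ?NR = "restrict_scalars ?c ?NZ"
  interpret N0: typed_algebra ?NZ by (rule typed_algebra_twisted_algebra[OF s])
  have N1: "assoc_algebra ?NR"
    by (rule assoc_algebra_restrict_scalars[OF N0.assoc]) (rule c.hom_1 c.hom_add c.hom_mult)+
  have N1s: "carrier ?NR = carrier ?NZ" "monoid.mult ?NR = monoid.mult ?NZ" "add ?NR = (+)"
    "\<zero>\<^bsub>?NR\<^esub> = 0" "\<one>\<^bsub>?NR\<^esub> = (1, 0)" "module.smult ?NR = (\<lambda>f. module.smult ?NZ (?c f))"
    by (simp_all add: restrict_scalars_def with_smult_def twisted_algebra_simps)
  have cX: "?c fps_X = 0" by simp
  have \<Phi>c: "\<Phi> x \<in> carrier ?NZ" if "x \<in> carrier B" for x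
    using c.base_change_closed[OF s, of "h x" fps_X] hc that unfolding \<Phi>_def Bs cX by blast
  have \<Phi>s: "\<Phi> (f \<odot>\<^bsub>B\<^esub> x) = ?c f \<odot>\<^bsub>?NZ\<^esub> \<Phi> x" if "x \<in> carrier B" for f x
    using that by (simp add: \<Phi>_def Bh(6) twisted_algebra_simps(6) c.base_change_smult[OF s])
  have surj: "\<Phi> ` carrier B = carrier ?NR"
  proof (intro equalityI subsetI)
    fix z assume z: "z \<in> carrier ?NR"
    interpret i: comm_ring_morphism "fps_const :: 'k \<Rightarrow> 'k fps" by (rule comm_ring_morphism_fps_const)
    have "i.base_change z \<in> carrier ?N"
      using z i.degree_map_poly_hom_le le_less_trans
      by (fastforce simp: N1s twisted_algebra_simps(1) i.base_change_def)
    then have "h (g (i.base_change z)) = i.base_change z" "g (i.base_change z) \<in> carrier B"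
      by (simp_all add: hg gc Bs)
    moreover have "c.base_change (i.base_change z) = z"
      by (cases z) (simp add: c.base_change_def i.base_change_def map_poly_map_poly o_def)
    ultimately show "z \<in> \<Phi> ` carrier B" unfolding \<Phi>_def by (metis imageI)
  qed (use \<Phi>c in \<open>auto simp: N1s\<close>)
  have ker: "I = {x \<in> carrier B. \<Phi> x = \<zero>\<^bsub>?NR\<^esub>}"
  proof (intro equalityI subsetI)
    fix x assume "x \<in> I"
    then show "x \<in> {x \<in> carrier B. \<Phi> x = \<zero>\<^bsub>?NR\<^esub>}"
      using N0.smult_zero_left[OF \<Phi>c] assoc_algebraD(2)[OF B] by (auto simp: I_def N1s \<Phi>s)
  next
    fix x assume "x \<in> {x \<in> carrier B. \<Phi> x = \<zero>\<^bsub>?NR\<^esub>}"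
    then have x: "x \<in> carrier B" "\<Phi> x = 0" by (auto simp: N1s)
    obtain p q where pq: "h x = (p, q)" by (cases "h x")
    have "map_poly ?c p = 0" "map_poly ?c q = 0"
      using x(2) by (simp_all add: \<Phi>_def c.base_change_def pq zero_prod_def)
    then obtain p' q' where p': "p = smult fps_X p'" "degree p' \<le> degree p"
      and q': "q = smult fps_X q'" "degree q' \<le> degree q"
      by (metis poly_divisible_by_fps_X)
    have z: "(p', q') \<in> carrier ?N"
      using hc[of x] x p' q' by (auto simp: pq twisted_algebra_simps(1) Bs)
    have "x = fps_X \<odot>\<^bsub>B\<^esub> g (p', q')"
    proof (rule inj)
      show "h x = h (fps_X \<odot>\<^bsub>B\<^esub> g (p', q'))"
        using gc[OF z] hg[OF z] p'(1) q'(1) by (simp add: Bs hs pq twisted_algebra_simps(6))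
      show "fps_X \<odot>\<^bsub>B\<^esub> g (p', q') \<in> carrier ?E"
        using assoc_algebraD(2)[OF B, of "g (p', q')"] gc[OF z] by (simp add: Bs)
    qed (use x in \<open>simp add: Bs\<close>)
    then show "x \<in> I" using gc[OF z] by (auto simp: I_def Bs)
  qed
  have Q: "assoc_algebra (quotient_algebra B I)" "algebra_iso (quotient_algebra B I) ?NR"
  proof -
    note hyps = N1 B.abelian_group_axioms B.m_closed B.one_closed assoc_algebraD(2)[OF B] surj _ _ _ _ ker
    have 1: "\<Phi> (x \<otimes>\<^bsub>B\<^esub> y) = \<Phi> x \<otimes>\<^bsub>?NR\<^esub> \<Phi> y" if "x \<in> carrier B" "y \<in> carrier B" for x y
      using that c.base_change_mult[OF s, where z = "h x" and u = fps_X and w = "h y"] by (simp add: \<Phi>_def Bh(2) N1s)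
    have 2: "\<Phi> (x \<oplus>\<^bsub>B\<^esub> y) = \<Phi> x \<oplus>\<^bsub>?NR\<^esub> \<Phi> y" if "x \<in> carrier B" "y \<in> carrier B" for x y
      using that by (simp add: \<Phi>_def Bh(3) N.add_eq N1s c.base_change_add[OF s])
    have 3: "\<Phi> \<one>\<^bsub>B\<^esub> = \<one>\<^bsub>?NR\<^esub>"
      by (simp add: \<Phi>_def Bh(4) N1s twisted_algebra_simps(3) c.base_change_one[OF s])
    have 4: "\<Phi> (f \<odot>\<^bsub>B\<^esub> x) = f \<odot>\<^bsub>?NR\<^esub> \<Phi> x" if "x \<in> carrier B" for f x
      using \<Phi>s[OF that] by (simp add: N1s)
    show "assoc_algebra (quotient_algebra B I)"
      by (rule quotient_algebra_first_iso(1)[where \<Phi> = \<Phi>, OF hyps]) (use 1 2 3 4 in auto)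
    show "algebra_iso (quotient_algebra B I) ?NR"
      by (rule quotient_algebra_first_iso(2)[where \<Phi> = \<Phi>, OF hyps]) (use 1 2 3 4 in auto)
  qed
  have AQ: "algebra_iso ?A (restrict_scalars fps_const (quotient_algebra B I))"
  proof -
    let ?Q = "restrict_scalars fps_const (quotient_algebra B I)"
    have "assoc_algebra ?Q"
      by (rule assoc_algebra_restrict_scalars[OF Q(1)]) (simp_all flip: fps_const_add fps_const_mult)
    moreover have "algebra_iso ?Q ?NZ"
    proof -
      obtain k where "bij_betw k (carrier (quotient_algebra B I)) (carrier ?NR)" 
        "\<And>x y. x \<in> carrier (quotient_algebra B I) \<Longrightarrow> y \<in> carrier (quotient_algebra B I) \<Longrightarrow>
          k (x \<otimes>\<^bsub>quotient_algebra B I\<^esub> y) = k x \<otimes>\<^bsub>?NR\<^esub> k y"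
        "\<And>x y. x \<in> carrier (quotient_algebra B I) \<Longrightarrow> y \<in> carrier (quotient_algebra B I) \<Longrightarrow>
          k (x \<oplus>\<^bsub>quotient_algebra B I\<^esub> y) = k x \<oplus>\<^bsub>?NR\<^esub> k y"
        "k \<one>\<^bsub>quotient_algebra B I\<^esub> = \<one>\<^bsub>?NR\<^esub>"
        "\<And>f x. x \<in> carrier (quotient_algebra B I) \<Longrightarrow>
          k (f \<odot>\<^bsub>quotient_algebra B I\<^esub> x) = f \<odot>\<^bsub>?NR\<^esub> k x"
        using Q(2) by (rule algebra_isoE) blast
      then show ?thesis
        by (intro algebra_isoI[of k])
          (simp_all add: restrict_scalars_def with_smult_def twisted_algebra_simps(3,5))
    qed
    ultimately show ?thesis
      using A(2) algebra_iso_sym algebra_iso_trans by blast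
  qed
  note At = extend_scalars_twisted_algebra[OF s comm_ring_morphism_fps_to_fls B BN]
  show ?thesis
  proof (rule that[of "extend_scalars fps_to_fls B"])
    show "deformation ?A (extend_scalars fps_to_fls B)"
      unfolding deformation_def
      using A(1) At(1) B AQ algebra_iso_refl unfolding I_def by (intro conjI exI[of _ B]) (auto simp: Bs)
    show "algebra_iso (extend_scalars fps_to_fls B) (twisted_algebra s fls_X)"
      using At(2) by simp
  qed (rule At(1))
qed

text \<open>The power series \<open>t - t\<^sup>s\<close> has order one, so that its powers have different orders.\<close>

lemma deformation_parameter_generic:
  assumes s: "s > 1"
  defines "u \<equiv> (to_ac fls_X :: 'k::field fls alg_closure)"
  shows "inj (\<lambda>i::nat. (u - u ^ s) ^ (2 ^ i))"
proof (rule injI)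
  fix i j :: nat
  define c :: "'k fps" where "c = fps_X - fps_X ^ s"
  interpret comm_ring_morphism "fps_to_fls :: 'k fps \<Rightarrow> 'k fls" by (rule comm_ring_morphism_fps_to_fls)
  have u: "(u - u ^ s) ^ n = to_ac (fps_to_fls (c ^ n))" for n
    by (simp add: u_def c_def hom_power hom_diff)
  have "subdegree c = 1"
    using s by (intro subdegreeI) (auto simp: c_def fps_X_power_nth)
  then have deg: "subdegree (c ^ n) = n" for n by simp
  assume "(u - u ^ s) ^ (2 ^ i) = (u - u ^ s) ^ (2 ^ j)"
  then have "c ^ (2 ^ i) = c ^ (2 ^ j)" by (simp add: u)
  then have "(2::nat) ^ i = 2 ^ j" using deg by metis
  then show "i = j" by simp
qed

theorem theoremB:
  fixes s :: nat
  assumes "s > 1" and "CHAR('k::field) = 2"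
  shows "has_separable_deformation (group_algebra (group_G s) :: ('k, int \<times> int \<Rightarrow>\<^sub>0 'k) module)"
proof -
  note s = assms(1)
  let ?K = "to_ac :: 'k fls \<Rightarrow> 'k fls alg_closure"
  obtain A\<^sub>t :: "('k fls, ('k fls, ('k fps, int \<times> int \<Rightarrow>\<^sub>0 'k) tensor) tensor) module"
    where A\<^sub>t: "deformation (group_algebra (group_G s) :: ('k::field, int \<times> int \<Rightarrow>\<^sub>0 'k) module) A\<^sub>t"
      "assoc_algebra A\<^sub>t" "algebra_iso A\<^sub>t (twisted_algebra s fls_X)"
    by (rule group_algebra_deformation[OF s])
  have "(2 :: 'k) = 0" using of_nat_CHAR[where 'a = 'k] assms(2) by simp
  then have "(2 :: 'k fps) = 0"
    by (rule comm_ring_morphism.hom_two_eq_0[OF comm_ring_morphism_fps_const])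
  then have "(2 :: 'k fls) = 0"
    by (rule comm_ring_morphism.hom_two_eq_0[OF comm_ring_morphism_fps_to_fls])
  then have char2: "(2 :: 'k fls alg_closure) = 0"
    by (rule comm_ring_morphism.hom_two_eq_0[OF comm_ring_morphism_to_ac])
  note ext = extend_scalars_twisted_algebra[OF s comm_ring_morphism_to_ac A\<^sub>t(2,3)]
  have "semisimple_ring (twisted_algebra s (?K fls_X))"
    by (rule semisimple_twisted_algebra[OF s char2 deformation_parameter_generic[OF s]])
  then have "semisimple_ring (extend_scalars ?K A\<^sub>t)"
    by (rule semisimple_ring_transfer[OF ext(1) _ ext(2)])
  moreover have "finite_dimensional_algebra A\<^sub>t"
  proof -
    let ?N = "twisted_algebra s (fls_X :: 'k fls)" and ?I = "basis_index s"
    obtain h where h: "bij_betw h (carrier A\<^sub>t) (carrier ?N)" 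
      "\<And>x y. x \<in> carrier A\<^sub>t \<Longrightarrow> y \<in> carrier A\<^sub>t \<Longrightarrow> h (x \<oplus>\<^bsub>A\<^sub>t\<^esub> y) = h x \<oplus>\<^bsub>?N\<^esub> h y"
      "\<And>c x. x \<in> carrier A\<^sub>t \<Longrightarrow> h (c \<odot>\<^bsub>A\<^sub>t\<^esub> x) = c \<odot>\<^bsub>?N\<^esub> h x"
      using A\<^sub>t(3) by (rule algebra_isoE) blast
    define e where "e = (\<lambda>i. inv_into (carrier A\<^sub>t) h (monomial i))"
    have e: "e i \<in> carrier A\<^sub>t" and he: "h (e i) = monomial i" if "i \<in> ?I" for i
      using h(1) monomial_closed[OF that, of fls_X] unfolding e_def bij_betw_def
      by (auto intro: inv_into_into f_inv_into_f)
    have "spans ?N ?I (\<lambda>i. h (e i))"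
      using spans_monomial[OF s] by (simp add: spans_def he)
    with e have "spans A\<^sub>t ?I e" by (intro spans_transfer[OF A\<^sub>t(2) h])
    with e show ?thesis by (intro spans_finite_dimensional[OF A\<^sub>t(2) finite_basis_index[OF s]])
  qed
  ultimately have "separable_algebra A\<^sub>t" using A\<^sub>t(2) by (simp add: separable_algebra_def)
  then show ?thesis using A\<^sub>t(1) unfolding has_separable_deformation_def by blast
qed

end
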